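(* Let $\rho:\mathbf{NCSym}\to\mathbf{Sym}$ be the map letting the variables commute and let $\tilde\rho:\mathbf{Sym}\to\mathbf{NCSym}$ be the graded linear map defined as the composition $$\mathbf{Sym}\xrightarrow{\overline f_\Pi^{-1}}\overline{\mathcal K}(\mathbf\Pi)\xrightarrow{\overline{\mathcal K}(\Psi)^{-1}}\overline{\mathcal K}(\mathfrak S)\xrightarrow{\overline f_{\mathfrak S}}\mathrm{ClassFun}(S_\bullet)\hookrightarrow\mathrm{Fun}(S_\bullet)\xrightarrow{f_{\mathfrak S}^{-1}}\mathcal K(\mathfrak S)\xrightarrow{\mathcal K(\Psi)}\mathcal K(\mathbf\Pi)\xrightarrow{f_\Pi}\mathbf{NCSym}.$$ Then $\rho\circ\tilde\rho$ acts as multiplication by $n!$ on the subspace of degree $n$ elements in $\mathbf{Sym}$. Moreover, if $\lambda$ is an integer partition of $n\ge0$, then the images of $m_\lambda$, $p_\lambda$, $e_\lambda$, $h_\lambda$ under $\tilde\rho$ are $$\lambda!\cdot\sum_\Lambda m_\Lambda,\qquad\lambda!\cdot\lambda^!\cdot\sum_\Lambda p_\Lambda,\qquad\lambda^!\cdot\sum_\Lambda e_\Lambda,\qquad\lambda^!\cdot\sum_\Lambda h_\Lambda$$ respectively, where each sum is over all set partitions $\Lambda$ of $[n]$ of type $\lambda$.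
   Context: $\mathbb K$ is a field of characteristic zero; $[n]=\{1,\dots,n\}$. **$\mathbf{NCSym}$ and $\mathbf{Sym}$.** $\mathbf{NCSym}$ is the space of formal power series of bounded degree over $\mathbb K$ in noncommuting variables $x_1,x_2,\dots$ which are invariant, for every $n$, under permuting the indices of $x_1,\dots,x_n$; $\mathbf{Sym}$ is the analogous space for commuting variables (symmetric functions). For a partition $\Lambda$ of $[n]$, the elements $m_\Lambda,p_\Lambda,e_\Lambda\in\mathbf{NCSym}$ are each sums $\sum x_{i_1}\cdots x_{i_n}$ over $n$-tuples of positive integers such that, respectively, (for $m$) $i_j=i_k$ if and only if $j,k$ are in the same block of $\Lambda$; (for $p$) $i_j=i_k$ if $j,k$ are in the same block; (for $e$) $i_j\neq i_k$ if $j\ne k$ are in the same block. And $h_\Lambda=\sum_{(f,L)}x_{f(1)}\cdots x_{f(n)}$ over pairs of a map $f:[n]\to\{1,2,\dots\}$ and a sequence $L$ of linear orderings of each of the sets $f^{-1}(i)\cap B$ ($i\ge1$, $B\in\Lambda$). In $\mathbf{Sym}$, $m_\lambda,p_\lambda,e_\lambda,h_\lambda$ are the usual monomial, power sum, elementary, complete homogeneous symmetric functions. **Set partitions and permutations.** For a finite set $I$ let $\Pi[I]$ be its set of partitions and $\mathfrak S[I]$ its set of permutations; $\mathbb K\Pi[I]$ and $\mathbb K\mathfrak S[I]$ are the vector spaces they span. Order $\Pi[I]$ by refinement. For $\sigma\in\mathfrak S[I]$ and $S\subset I$, $\sigma|_S\in\mathfrak S[S]$ sends $i\in S$ to the first element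 of $\sigma(i),\sigma^2(i),\dots$ lying in $S$. Let $\preceq$ be the partial order on $\mathfrak S[I]$ which is the reflexive transitive closure of the relations $\sigma|_S\sqcup\sigma|_T\preceq\sigma$ for $I=S\sqcup T$. In both posets, with Möbius function $\mu$, define for each element $\lambda$: $p_\lambda=\sum_{\lambda'\preceq\lambda}\mu(\lambda',\lambda)\lambda'$ and $m_\lambda=\sum_{\lambda'\succeq\lambda}\mu(\lambda,\lambda')p_{\lambda'}$; the $p_\lambda$ form a basis. **The spaces and maps.** $\mathcal K(\mathbf\Pi)=\bigoplus_n\mathbb K\Pi[[n]]$ and $\mathcal K(\mathfrak S)=\bigoplus_n\mathbb K\mathfrak S[[n]]$; $\overline{\mathcal K}(\mathbf\Pi)$ and $\overline{\mathcal K}(\mathfrak S)$ are the corresponding direct sums of $S_n$-coinvariants (quotients by the span of all $x-\sigma x$, where $S_n$ acts on partitions naturally and on permutations by conjugation). $\mathrm{Fun}(S_\bullet)=\bigoplus_n\{\text{maps }S_n\to\mathbb K\}$ and $\mathrm{ClassFun}(S_\bullet)\subset\mathrm{Fun}(S_\bullet)$ is the subspace of functions constant on conjugacy classes. The following are graded linear isomorphisms: $f_\Pi:\mathcal K(\mathbf\Pi)\to\mathbf{NCSym}$, $p_\Lambda\mapsto p_\Lambda$; $\overline f_\Pi:\overline{\mathcal K}(\mathbf\Pi)\to\mathbf{Sym}$, $p_\Lambda\mapsto p_\lambda$ for $\Lambda$ of type $\lambda$; $f_{\mathfrak S}:\mathcal K(\mathfrak S)\to\mathrm{Fun}(S_\bullet)$,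 $p_\sigma\mapsto1_\sigma$ (indicator function of $\{\sigma\}$); $\overline f_{\mathfrak S}:\overline{\mathcal K}(\mathfrak S)\to\mathrm{ClassFun}(S_\bullet)$, $p_\sigma\mapsto z_\lambda\cdot1_\lambda$ for $\sigma$ of cycle type $\lambda$, where $1_\lambda$ is the indicator function of the permutations of cycle type $\lambda$ and $z_\lambda$ is the order of the centralizer of such a permutation. **The map $\Psi$.** For each finite set $I$ let $\zeta_I:\mathbb K\mathfrak S[I]\to\mathbb K$ be the linear map with $\zeta_I(p_\sigma)=1$ for all $\sigma\in\mathfrak S[I]$. $\Psi_I:\mathbb K\mathfrak S[I]\to\mathbb K\Pi[I]$ is the linear map with $\Psi_I(\sigma)=\sum_{\Lambda\in\Pi[I]}\Big(\prod_{B\in\Lambda}\zeta_B(\sigma|_B)\Big)m_\Lambda$ for $\sigma\in\mathfrak S[I]$. (This is the unique morphism of Hopf monoids in species from permutations to set partitions that is compatible with $\zeta$ and with the character sending every $p_\Lambda$ to $1$.) $\mathcal K(\Psi)$ is the graded map with components $\Psi_{[n]}$, and $\overline{\mathcal K}(\Psi)$ is the induced map on coinvariants, which is an isomorphism. **Notation.** The type of a set partition is the integer partition of its block sizes. For $\lambda=(\lambda_1,\dots,\lambda_\ell)\vdash n$, $\lambda!=\lambda_1!\cdots\lambda_\ell!$ and $\lambda^!=m_1!\cdots m_n!$, where $m_i$ is the number of parts equal to $i$. *)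

theory Defs
  imports
    "HOL-Library.Function_Algebras"
    "HOL-Library.FuncSet"
    "HOL-Library.Indicator_Function"
    "HOL-Library.Disjoint_Sets"
    "HOL-Library.Multiset"
    "HOL-Combinatorics.Permutations"
    "HOL-Combinatorics.Orbits"
begin

section \<open>Linear algebra in function spaces\<close>

text \<open>
  Every vector space below is a subspace of a space \<^typ>\<open>'a \<Rightarrow> 'k\<close> with pointwise addition
  (from \<^theory>\<open>HOL-Library.Function_Algebras\<close>) and the following scalar multiplication.  The span of a
  finite set \<open>A\<close> is the space of functions vanishing outside \<open>A\<close>, and the basis vector \<open>a \<in> A\<close> is
  \<open>indicator {a}\<close>.
\<close>

definition fscale :: "'k::field \<Rightarrow> ('a \<Rightarrow> 'k) \<Rightarrow> ('a \<Rightarrow> 'k)" where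
  "fscale c f = (\<lambda>x. c * f x)"

interpretation fun_vs: vector_space "fscale :: 'k::field \<Rightarrow> ('a \<Rightarrow> 'k) \<Rightarrow> ('a \<Rightarrow> 'k)"
  by unfold_locales (auto simp: fscale_def fun_eq_iff algebra_simps)

text \<open>The linear map sending the basis vector \<open>v j\<close> to \<open>w j\<close> for every \<open>j \<in> J\<close>, where \<open>v\<close> is injective
  on \<open>J\<close> with linearly independent image, and \<open>s\<close> is the scalar multiplication of the target space.
  Only its values on the span of \<open>v ` J\<close> are meaningful.\<close>

definition linear_ext ::
  "('k::field \<Rightarrow> 'w::ab_group_add \<Rightarrow> 'w) \<Rightarrow> 'j set \<Rightarrow> ('j \<Rightarrow> ('a \<Rightarrow> 'k)) \<Rightarrow> ('j \<Rightarrow> 'w) \<Rightarrow> ('a \<Rightarrow> 'k) \<Rightarrow> 'w"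
  where "linear_ext s J v w = vector_space_pair.construct fscale s (v ` J) (w \<circ> inv_into J v)"

text \<open>The linear map on finitely supported functions that sends the basis vector \<open>b\<close> to \<open>g b\<close>.\<close>

definition push_forward :: "('b \<Rightarrow> 'c) \<Rightarrow> ('b \<Rightarrow> 'k::field) \<Rightarrow> ('c \<Rightarrow> 'k)" where
  "push_forward g x = (\<Sum>b | x b \<noteq> 0. fscale (x b) (indicator {g b}))"


section \<open>Direct sums over all degrees and coinvariants\<close>

text \<open>For finite sets \<open>B n\<close>, the direct sum over \<open>n\<close> of the spaces spanned by \<open>B n\<close>.  The function
  \<open>curry x n\<close> is the component of \<open>x\<close> in degree \<open>n\<close>.\<close>

definition graded_space :: "(nat \<Rightarrow> 'b set) \<Rightarrow> (nat \<times> 'b \<Rightarrow> 'k::field) set" where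
  "graded_space B = {x. finite {j. x j \<noteq> 0} \<and> (\<forall>n b. x (n, b) \<noteq> 0 \<longrightarrow> b \<in> B n)}"

definition in_degree :: "nat \<Rightarrow> ('b \<Rightarrow> 'k::field) \<Rightarrow> (nat \<times> 'b \<Rightarrow> 'k)" where
  "in_degree n v = (\<lambda>(k, b). if k = n then v b else 0)"

text \<open>Here \<open>act\<close> gives, for every \<open>n\<close>, an action of the permutations of \<open>{1..n}\<close> on \<open>B n\<close>.  The direct sum
  of the spaces of coinvariants is taken to be the quotient of the direct sum by the (direct) sum of
  the subspaces spanned by all \<open>x - \<sigma> x\<close> in each degree.\<close>

definition coinv_relators ::
  "(nat \<Rightarrow> 'b set) \<Rightarrow> ((nat \<Rightarrow> nat) \<Rightarrow> 'b \<Rightarrow> 'b) \<Rightarrow> (nat \<times> 'b \<Rightarrow> 'k::field) set" where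
  "coinv_relators B act = fun_vs.span
     {in_degree n (x - push_forward (act \<sigma>) x) | n \<sigma> x.
        \<sigma> permutes {1..n} \<and> (\<forall>b. x b \<noteq> 0 \<longrightarrow> b \<in> B n)}"

definition coinv_rel ::
  "(nat \<Rightarrow> 'b set) \<Rightarrow> ((nat \<Rightarrow> nat) \<Rightarrow> 'b \<Rightarrow> 'b) \<Rightarrow> ((nat \<times> 'b \<Rightarrow> 'k::field) \<times> (nat \<times> 'b \<Rightarrow> 'k)) set" where
  "coinv_rel B act =
     {(x, y). x \<in> graded_space B \<and> y \<in> graded_space B \<and> x - y \<in> coinv_relators B act}"

definition coinvariants ::
  "(nat \<Rightarrow> 'b set) \<Rightarrow> ((nat \<Rightarrow> nat) \<Rightarrow> 'b \<Rightarrow> 'b) \<Rightarrow> (nat \<times> 'b \<Rightarrow> 'k::field) set set" where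
  "coinvariants B act = graded_space B // coinv_rel B act"


section \<open>Moebius functions of finite posets\<close>

lemma card_down_less:
  assumes "finite r" "partial_order_on (Field r) r" "(z, y) \<in> r" "z \<noteq> y"
  shows "card {w. (w, z) \<in> r} < card {w. (w, y) \<in> r}"
proof -
  have r: "(y, y) \<in> r" "trans r" "antisym r"
    using assms by (auto simp: order_on_defs refl_on_def Field_def)
  have "finite {w. (w, y) \<in> r}"
    by (rule finite_subset[of _ "fst ` r"]) (use assms(1) in force)+
  moreover have "{w. (w, z) \<in> r} \<subset> {w. (w, y) \<in> r}"
    using assms(3,4) r by (auto dest: transD antisymD)
  ultimately show ?thesis
    by (rule psubset_card_mono)
qed

text \<open>The posets are given by their order relations (as sets of pairs).\<close>

function mobius :: "('a \<times> 'a) set \<Rightarrow> 'a \<Rightarrow> 'a \<Rightarrow> int" where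
  "mobius r x y =
     (if finite r \<and> partial_order_on (Field r) r \<and> (x, y) \<in> r then
        if x = y then 1 else - (\<Sum>z | (x, z) \<in> r \<and> (z, y) \<in> r \<and> z \<noteq> y. mobius r x z)
      else 0)"
  by auto
termination
  by (relation "measure (\<lambda>(r, x, y). card {w. (w, y) \<in> r})") (auto intro: card_down_less)

declare mobius.simps [simp del]

definition p_vec :: "('a \<times> 'a) set \<Rightarrow> 'a \<Rightarrow> ('a \<Rightarrow> 'k::field)" where
  "p_vec r l = (\<Sum>l' | (l', l) \<in> r. fscale (of_int (mobius r l' l)) (indicator {l'}))"

definition m_vec :: "('a \<times> 'a) set \<Rightarrow> 'a \<Rightarrow> ('a \<Rightarrow> 'k::field)" where
  "m_vec r l = (\<Sum>l' | (l, l') \<in> r. fscale (of_int (mobius r l l')) (p_vec r l'))"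


section \<open>Set partitions and permutations\<close>

text \<open>A permutation of \<open>I\<close> is a function \<open>\<sigma>\<close> with \<open>\<sigma> permutes I\<close>; it is the identity outside \<open>I\<close>.\<close>

definition setpart_order :: "'a set \<Rightarrow> ('a set set \<times> 'a set set) set" where
  "setpart_order I = {(P, Q). refines I P Q}"

definition perm_restr :: "('a \<Rightarrow> 'a) \<Rightarrow> 'a set \<Rightarrow> 'a \<Rightarrow> 'a" where
  "perm_restr \<sigma> S i = (if i \<in> S then (\<sigma> ^^ (LEAST k. 1 \<le> k \<and> (\<sigma> ^^ k) i \<in> S)) i else i)"

definition perm_union :: "'a set \<Rightarrow> ('a \<Rightarrow> 'a) \<Rightarrow> ('a \<Rightarrow> 'a) \<Rightarrow> 'a \<Rightarrow> 'a" where
  "perm_union S \<sigma> \<tau> i = (if i \<in> S then \<sigma> i else \<tau> i)"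

definition perm_order :: "'a set \<Rightarrow> (('a \<Rightarrow> 'a) \<times> ('a \<Rightarrow> 'a)) set" where
  "perm_order I = {(\<tau>, \<sigma>). \<tau> permutes I \<and> \<sigma> permutes I \<and>
     (\<tau>, \<sigma>) \<in> {(perm_union S (perm_restr \<sigma> S) (perm_restr \<sigma> T), \<sigma>) | \<sigma> S T.
                \<sigma> permutes I \<and> S \<union> T = I \<and> S \<inter> T = {}}\<^sup>*}"

text \<open>Integer partitions are weakly decreasing lists of positive integers.\<close>

definition int_partition :: "nat \<Rightarrow> nat list \<Rightarrow> bool" where
  "int_partition n l \<longleftrightarrow> sorted_wrt (\<ge>) l \<and> (\<forall>k\<in>set l. 0 < k) \<and> sum_list l = n"

definition setpart_type :: "'a set set \<Rightarrow> nat list" where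
  "setpart_type P = rev (sorted_list_of_multiset (image_mset card (mset_set P)))"

definition cycle_type :: "nat \<Rightarrow> (nat \<Rightarrow> nat) \<Rightarrow> nat list" where
  "cycle_type n \<sigma> = setpart_type (orbit \<sigma> ` {1..n})"

definition centralizer_order :: "nat \<Rightarrow> (nat \<Rightarrow> nat) \<Rightarrow> nat" where
  "centralizer_order n \<sigma> = card {\<tau>. \<tau> permutes {1..n} \<and> \<tau> \<circ> \<sigma> = \<sigma> \<circ> \<tau>}"

definition parts_fact :: "nat list \<Rightarrow> nat" where
  "parts_fact l = prod_list (map fact l)"

definition mults_fact :: "nat list \<Rightarrow> nat" where
  "mults_fact l = (\<Prod>i = 1..sum_list l. fact (count_list l i))"


section \<open>Power series in noncommuting and commuting variables\<close>

text \<open>The variables are indexed by the positive integers.  A power series is its coefficient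
  function; the monomial \<open>x\<^bsub>i1\<^esub> \<dots> x\<^bsub>in\<^esub>\<close> is the list \<open>[i1, \<dots>, in]\<close> in the noncommutative case
  and the multiset of indices in the commutative case.\<close>

definition NCSym :: "(nat list \<Rightarrow> 'k::field) set" where
  "NCSym = {f. (\<forall>w. f w \<noteq> 0 \<longrightarrow> set w \<subseteq> {1..}) \<and>
     (\<exists>d. \<forall>w. f w \<noteq> 0 \<longrightarrow> length w \<le> d) \<and>
     (\<forall>n \<pi>. \<pi> permutes {1..n} \<longrightarrow> (\<forall>w. f (map \<pi> w) = f w))}"

definition Sym :: "(nat multiset \<Rightarrow> 'k::field) set" where
  "Sym = {f. (\<forall>M. f M \<noteq> 0 \<longrightarrow> set_mset M \<subseteq> {1..}) \<and>
     (\<exists>d. \<forall>M. f M \<noteq> 0 \<longrightarrow> size M \<le> d) \<and>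
     (\<forall>n \<pi>. \<pi> permutes {1..n} \<longrightarrow> (\<forall>M. f (image_mset \<pi> M) = f M))}"

definition Sym_degree :: "nat \<Rightarrow> (nat multiset \<Rightarrow> 'k::field) set" where
  "Sym_degree n = {f \<in> Sym. \<forall>M. f M \<noteq> 0 \<longrightarrow> size M = n}"

definition rho :: "(nat list \<Rightarrow> 'k::field) \<Rightarrow> (nat multiset \<Rightarrow> 'k)" where
  "rho f = (\<lambda>M. \<Sum>w | mset w = M. f w)"

definition nc_words :: "nat \<Rightarrow> nat list set" where
  "nc_words n = {w. length w = n \<and> set w \<subseteq> {1..}}"

text \<open>The \<open>j\<close>-th letter, for \<open>j\<close> in \<open>{1..n}\<close>; list positions in HOL start at 0.\<close>

definition letter :: "nat list \<Rightarrow> nat \<Rightarrow> nat" where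
  "letter w j = w ! (j - 1)"

definition nc_m :: "nat \<Rightarrow> nat set set \<Rightarrow> (nat list \<Rightarrow> 'k::field)" where
  "nc_m n P = indicator {w \<in> nc_words n. \<forall>j\<in>{1..n}. \<forall>k\<in>{1..n}.
     letter w j = letter w k \<longleftrightarrow> (\<exists>B\<in>P. j \<in> B \<and> k \<in> B)}"

definition nc_p :: "nat \<Rightarrow> nat set set \<Rightarrow> (nat list \<Rightarrow> 'k::field)" where
  "nc_p n P = indicator {w \<in> nc_words n. \<forall>j\<in>{1..n}. \<forall>k\<in>{1..n}.
     (\<exists>B\<in>P. j \<in> B \<and> k \<in> B) \<longrightarrow> letter w j = letter w k}"

definition nc_e :: "nat \<Rightarrow> nat set set \<Rightarrow> (nat list \<Rightarrow> 'k::field)" where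
  "nc_e n P = indicator {w \<in> nc_words n. \<forall>j\<in>{1..n}. \<forall>k\<in>{1..n}.
     j \<noteq> k \<and> (\<exists>B\<in>P. j \<in> B \<and> k \<in> B) \<longrightarrow> letter w j \<noteq> letter w k}"

text \<open>The word \<open>w\<close> is the map \<open>f\<close>, and its coefficient is the number of choices of the linear orderings
  \<open>L\<close>.  This is finite, since all but finitely many of the sets to be ordered are empty and the empty
  set has a single linear ordering.\<close>

definition nc_h :: "nat \<Rightarrow> nat set set \<Rightarrow> (nat list \<Rightarrow> 'k::field)" where
  "nc_h n P = (\<lambda>w. if w \<in> nc_words n then
       of_nat (card (PiE ({1..} \<times> P) (\<lambda>(i, B). {r. linear_order_on {j \<in> B. letter w j = i} r})))
     else 0)"

definition ps_mult ::
  "(nat multiset \<Rightarrow> 'k::field) \<Rightarrow> (nat multiset \<Rightarrow> 'k) \<Rightarrow> (nat multiset \<Rightarrow> 'k)" where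
  "ps_mult f g = (\<lambda>M. \<Sum>A | A \<subseteq># M. f A * g (M - A))"

definition ps_one :: "nat multiset \<Rightarrow> 'k::field" where
  "ps_one = indicator {{#}}"

definition sym_m :: "nat list \<Rightarrow> (nat multiset \<Rightarrow> 'k::field)" where
  "sym_m l = indicator {M. set_mset M \<subseteq> {1..} \<and> image_mset (count M) (mset_set (set_mset M)) = mset l}"

definition sym_p :: "nat list \<Rightarrow> (nat multiset \<Rightarrow> 'k::field)" where
  "sym_p l = foldr ps_mult (map (\<lambda>k. indicator {replicate_mset k i | i. 1 \<le> i}) l) ps_one"

definition sym_e :: "nat list \<Rightarrow> (nat multiset \<Rightarrow> 'k::field)" where
  "sym_e l = foldr ps_mult
     (map (\<lambda>k. indicator {M. set_mset M \<subseteq> {1..} \<and> size M = k \<and> (\<forall>i. count M i \<le> 1)}) l) ps_one"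

definition sym_h :: "nat list \<Rightarrow> (nat multiset \<Rightarrow> 'k::field)" where
  "sym_h l = foldr ps_mult (map (\<lambda>k. indicator {M. set_mset M \<subseteq> {1..} \<and> size M = k}) l) ps_one"


section \<open>The spaces and the isomorphisms\<close>

definition setparts :: "nat \<Rightarrow> nat set set set" where
  "setparts n = {P. partition_on {1..n} P}"

definition perms :: "nat \<Rightarrow> (nat \<Rightarrow> nat) set" where
  "perms n = {\<sigma>. \<sigma> permutes {1..n}}"

definition setpart_act :: "(nat \<Rightarrow> nat) \<Rightarrow> nat set set \<Rightarrow> nat set set" where
  "setpart_act \<sigma> P = (\<lambda>B. \<sigma> ` B) ` P"

definition perm_act :: "(nat \<Rightarrow> nat) \<Rightarrow> (nat \<Rightarrow> nat) \<Rightarrow> (nat \<Rightarrow> nat)" where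
  "perm_act \<sigma> \<tau> = \<sigma> \<circ> \<tau> \<circ> inv \<sigma>"

definition K_Pi :: "(nat \<times> nat set set \<Rightarrow> 'k::field) set" where
  "K_Pi = graded_space setparts"

definition K_S :: "(nat \<times> (nat \<Rightarrow> nat) \<Rightarrow> 'k::field) set" where
  "K_S = graded_space perms"

definition Kbar_Pi :: "(nat \<times> nat set set \<Rightarrow> 'k::field) set set" where
  "Kbar_Pi = coinvariants setparts setpart_act"

definition Kbar_S :: "(nat \<times> (nat \<Rightarrow> nat) \<Rightarrow> 'k::field) set set" where
  "Kbar_S = coinvariants perms perm_act"

definition f_Pi :: "(nat \<times> nat set set \<Rightarrow> 'k::field) \<Rightarrow> (nat list \<Rightarrow> 'k)" where
  "f_Pi = linear_ext fscale (SIGMA n:UNIV. setparts n)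
     (\<lambda>(n, P). in_degree n (p_vec (setpart_order {1..n}) P))
     (\<lambda>(n, P). nc_p n P)"

text \<open>A linear map out of a quotient is the map induced by its lift: its value at a class is the common
  value of the lift at the elements of the class.\<close>

definition fbar_Pi :: "(nat \<times> nat set set \<Rightarrow> 'k::field) set \<Rightarrow> (nat multiset \<Rightarrow> 'k)" where
  "fbar_Pi C = the_elem (linear_ext fscale (SIGMA n:UNIV. setparts n)
     (\<lambda>(n, P). in_degree n (p_vec (setpart_order {1..n}) P))
     (\<lambda>(n, P). sym_p (setpart_type P)) ` C)"

text \<open>The space \<open>\<Oplus>\<^sub>n {maps S\<^sub>n \<rightarrow> K}\<close> consists of the finitely supported functions of pairs \<open>(n, \<sigma>)\<close> with
  \<open>\<sigma> \<in> perms n\<close>.  The class functions form a subset of it, so their inclusion is not visible below.\<close>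

definition f_S :: "(nat \<times> (nat \<Rightarrow> nat) \<Rightarrow> 'k::field) \<Rightarrow> (nat \<times> (nat \<Rightarrow> nat) \<Rightarrow> 'k)" where
  "f_S = linear_ext fscale (SIGMA n:UNIV. perms n)
     (\<lambda>(n, \<sigma>). in_degree n (p_vec (perm_order {1..n}) \<sigma>))
     (\<lambda>(n, \<sigma>). indicator {(n, \<sigma>)})"

definition fbar_S :: "(nat \<times> (nat \<Rightarrow> nat) \<Rightarrow> 'k::field) set \<Rightarrow> (nat \<times> (nat \<Rightarrow> nat) \<Rightarrow> 'k)" where
  "fbar_S C = the_elem (linear_ext fscale (SIGMA n:UNIV. perms n)
     (\<lambda>(n, \<sigma>). in_degree n (p_vec (perm_order {1..n}) \<sigma>))
     (\<lambda>(n, \<sigma>). fscale (of_nat (centralizer_order n \<sigma>))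
        (indicator {(n, \<tau>) | \<tau>. \<tau> \<in> perms n \<and> cycle_type n \<tau> = cycle_type n \<sigma>})) ` C)"


section \<open>The map Psi\<close>

definition zeta :: "'a set \<Rightarrow> (('a \<Rightarrow> 'a) \<Rightarrow> 'k::field) \<Rightarrow> 'k" where
  "zeta I = linear_ext (*) {\<sigma>. \<sigma> permutes I} (p_vec (perm_order I)) (\<lambda>_. 1)"

definition Psi :: "'a set \<Rightarrow> (('a \<Rightarrow> 'a) \<Rightarrow> 'k::field) \<Rightarrow> ('a set set \<Rightarrow> 'k)" where
  "Psi I x = (\<Sum>\<sigma> | \<sigma> permutes I. fscale (x \<sigma>)
     (\<Sum>P | partition_on I P.
        fscale (\<Prod>B\<in>P. zeta B (indicator {perm_restr \<sigma> B})) (m_vec (setpart_order I) P)))"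

definition K_Psi :: "(nat \<times> (nat \<Rightarrow> nat) \<Rightarrow> 'k::field) \<Rightarrow> (nat \<times> nat set set \<Rightarrow> 'k)" where
  "K_Psi x = (\<lambda>(n, P). Psi {1..n} (curry x n) P)"

definition Kbar_Psi ::
  "(nat \<times> (nat \<Rightarrow> nat) \<Rightarrow> 'k::field) set \<Rightarrow> (nat \<times> nat set set \<Rightarrow> 'k) set" where
  "Kbar_Psi C = the_elem ((\<lambda>x. coinv_rel setparts setpart_act `` {K_Psi x}) ` C)"

definition rho_tilde :: "(nat multiset \<Rightarrow> 'k::field) \<Rightarrow> (nat list \<Rightarrow> 'k)" where
  "rho_tilde = f_Pi \<circ> K_Psi \<circ> inv_into K_S f_S \<circ> fbar_S \<circ> inv_into Kbar_S Kbar_Psi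
     \<circ> inv_into Kbar_Pi fbar_Pi"

end

theory Submission
  imports Defs "HOL-Combinatorics.Multiset_Permutations"
begin

text \<open>
  The composition has a closed form: it sends a symmetric function \<open>f\<close> to the noncommutative power
  series \<open>lift f\<close> whose coefficient at a word \<open>w\<close> is the coefficient of \<open>f\<close> at the commutative image of \<open>w\<close>,
  times the number of permutations of the positions that fix \<open>w\<close>; in other words, a monomial of
  degree \<open>n\<close> becomes the sum of the words obtained by writing its \<open>n\<close> factors in all \<open>n!\<close> orders.  From
  this description \<open>rho \<circ> lift\<close> is visibly multiplication by \<open>n!\<close> in degree \<open>n\<close>, and the image of
  \<open>m\<^sub>\<lambda>\<close> can be read off.  For \<open>p\<^sub>\<lambda>\<close>, \<open>e\<^sub>\<lambda>\<close> and \<open>h\<^sub>\<lambda>\<close> one uses that \<open>lift\<close> turns a product into the sum over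
  all ways to distribute the positions of the word to the factors
  (\<open>product_over_set_partitions\<close>).  Such a distribution is a set partition of type \<open>\<lambda>\<close> whose blocks are
  labelled by the parts of \<open>\<lambda>\<close> of the right size, whence the factor \<open>\<lambda>\<^sup>!\<close>, and each block contributes
  the value of the lifted factor at a subword, whence the noncommutative functions and the factor
  \<open>\<lambda>!\<close> for power sums.

  That the composition is \<open>lift\<close> is checked on power sums, which span the symmetric functions.
  The main point (\<open>p_coord_Psi\<close>) is that Psi maps \<open>p\<^sub>\<sigma>\<close> to \<open>p\<^sub>\<Lambda>\<close> for the partition \<open>\<Lambda>\<close> of the ground set
  into the orbits of \<open>\<sigma>\<close>.  Indeed, \<open>\<sigma>\<close> is the sum of all \<open>p\<^sub>\<tau>\<close> with \<open>\<tau> \<preceq> \<sigma>\<close>, so that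
  \<open>\<zeta>(\<sigma>)\<close> is the number of such \<open>\<tau>\<close>; restriction and gluing of permutations are monotone, so that the product
  of the values \<open>\<zeta>(\<sigma>|\<^sub>B)\<close> over the blocks \<open>B\<close> of a set partition \<open>P\<close> counts the \<open>\<tau> \<preceq> \<sigma>\<close> with orbits
  inside the blocks of \<open>P\<close> (\<open>card_perm_order_blocks\<close>); and Moebius inversion in the lattice of set
  partitions turns this count into the one of those \<open>\<tau>\<close> whose orbits are the blocks.

  Hence the composition sends \<open>p\<^sub>\<lambda>\<close> to the sum of \<open>p\<^sub>\<Lambda>\<close> over the orbit partitions \<open>\<Lambda>\<close> of all
  permutations \<open>\<tau>\<close> of cycle type \<open>\<lambda>\<close>, multiplied by the order of the centralizer of one of them, \<open>\<sigma>\<close>.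
  This is a sum over the symmetric group: \<open>\<pi>\<close> contributes \<open>\<tau> = \<pi>\<sigma>\<pi>\<^sup>-\<^sup>1\<close>, whose orbit partition is the image of that of
  \<open>\<sigma>\<close> under \<open>\<pi>\<close> (\<open>centralizer_sum\<close>).  It is a multiple of the sum of all \<open>p\<^sub>\<Lambda>\<close> of type \<open>\<lambda>\<close>, as is
  \<open>lift p\<^sub>\<lambda>\<close>, and evaluation at a constant word shows that the two multiples agree
  (\<open>sum_permutes_nc_p\<close>).  The same identity yields the spanning property: a noncommutative symmetric function is a
  combination of the \<open>p\<^sub>\<Lambda>\<close>, and averaging \<open>lift f\<close> over the permutations of the positions writes it as
  a combination of lifts of power sums (\<open>Sym_combination_of_sym_p\<close>).
\<close>

section \<open>Moebius inversion and the p-basis\<close>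

lemma sum_apply: "(\<Sum>j\<in>S. f j) x = (\<Sum>j\<in>S. f j x)"
  by (induction S rule: infinite_finite_induct) auto

locale finite_poset =
  fixes A :: "'a set" and r :: "('a \<times> 'a) set"
  assumes finite_carrier: "finite A" and order: "partial_order_on A r"
begin

lemma r_subset: "r \<subseteq> A \<times> A"
  using order by (rule partial_order_onD)

lemma finite_r: "finite r"
  using finite_subset[OF r_subset] finite_carrier by blast

lemma r_refl: "x \<in> A \<Longrightarrow> (x, x) \<in> r"
  using partial_order_onD(1)[OF order] by (rule refl_onD)

lemma r_trans: "(x, y) \<in> r \<Longrightarrow> (y, z) \<in> r \<Longrightarrow> (x, z) \<in> r"
  using partial_order_onD(2)[OF order] by (rule transD)

lemma r_antisym: "(x, y) \<in> r \<Longrightarrow> (y, x) \<in> r \<Longrightarrow> x = y"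
  using partial_order_onD(3)[OF order] by (rule antisymD)

lemma r_carrier: "(x, y) \<in> r \<Longrightarrow> x \<in> A" "(x, y) \<in> r \<Longrightarrow> y \<in> A"
  using r_subset by auto

lemma Field_r: "Field r = A"
  using r_subset r_refl by (auto simp: Field_def)

lemma finite_up: "finite {z. (x, z) \<in> r}" and finite_down: "finite {z. (z, x) \<in> r}"
  by (rule finite_subset[OF _ finite_carrier], use r_carrier in blast)+

lemma finite_between: "finite {z. (x, z) \<in> r \<and> (z, y) \<in> r}"
  by (rule finite_subset[OF _ finite_carrier]) (use r_carrier in blast)

lemma sum_mobius_above:
  assumes "(x, y) \<in> r"
  shows "(\<Sum>z | (x, z) \<in> r \<and> (z, y) \<in> r. mobius r x z) = (if x = y then 1 else 0)"
proof (cases "x = y")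
  case True
  then have "{z. (x, z) \<in> r \<and> (z, y) \<in> r} = {x}"
    using assms r_antisym by auto
  moreover have "mobius r x x = 1"
    using assms True finite_r order by (subst mobius.simps) (auto simp: Field_r)
  ultimately show ?thesis
    using True by simp
next
  case False
  have "{z. (x, z) \<in> r \<and> (z, y) \<in> r} = insert y {z. (x, z) \<in> r \<and> (z, y) \<in> r \<and> z \<noteq> y}"
    using assms r_refl r_carrier by auto
  moreover have "mobius r x y = - (\<Sum>z | (x, z) \<in> r \<and> (z, y) \<in> r \<and> z \<noteq> y. mobius r x z)"
    using assms False finite_r order by (subst mobius.simps) (auto simp: Field_r)
  moreover have "finite {z. (x, z) \<in> r \<and> (z, y) \<in> r \<and> z \<noteq> y}"
    by (rule finite_subset[OF _ finite_carrier]) (use r_carrier in blast)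
  ultimately show ?thesis
    using False by simp
qed

text \<open>The zeta matrix of the poset is triangular, so that its left inverse, the Moebius matrix, is
  also a right inverse.\<close>

lemma sum_mobius_below:
  assumes "(x, y) \<in> r"
  shows "(\<Sum>z | (x, z) \<in> r \<and> (z, y) \<in> r. mobius r z y) = (if x = y then 1 else 0)"
proof -
  define W where "W y = (\<Sum>z | (x, z) \<in> r \<and> (z, y) \<in> r. mobius r z y)" for y
  have total: "(\<Sum>y' | (x, y') \<in> r \<and> (y', y) \<in> r. W y') = 1" if xy: "(x, y) \<in> r" for y
  proof -
    have "(\<Sum>y' | (x, y') \<in> r \<and> (y', y) \<in> r. W y')
        = (\<Sum>y'\<in>{y'. (x, y') \<in> r \<and> (y', y) \<in> r}. \<Sum>z\<in>{z. (x, z) \<in> r \<and> (z, y) \<in> r}.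
             if (z, y') \<in> r then mobius r z y' else 0)"
      unfolding W_def sum.inter_filter[OF finite_between, symmetric]
      by (intro sum.cong) (auto intro: r_trans)
    also have "\<dots> = (\<Sum>z\<in>{z. (x, z) \<in> r \<and> (z, y) \<in> r}.
        \<Sum>y'\<in>{y'. (x, y') \<in> r \<and> (y', y) \<in> r}. if (z, y') \<in> r then mobius r z y' else 0)"
      by (rule sum.swap)
    also have "\<dots> = (\<Sum>z\<in>{z. (x, z) \<in> r \<and> (z, y) \<in> r}. if z = y then 1 else 0)"
    proof (intro sum.cong refl)
      fix z assume z: "z \<in> {z. (x, z) \<in> r \<and> (z, y) \<in> r}"
      have "(\<Sum>y'\<in>{y'. (x, y') \<in> r \<and> (y', y) \<in> r}. if (z, y') \<in> r then mobius r z y' else 0)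
          = (\<Sum>y' | (z, y') \<in> r \<and> (y', y) \<in> r. mobius r z y')"
        unfolding sum.inter_filter[OF finite_between, symmetric]
        using z by (intro sum.cong) (auto intro: r_trans)
      then show "(\<Sum>y'\<in>{y'. (x, y') \<in> r \<and> (y', y) \<in> r}. if (z, y') \<in> r then mobius r z y' else 0)
          = (if z = y then 1 else 0)"
        using sum_mobius_above[of z y] z by simp
    qed
    also have "\<dots> = 1"
      using xy r_refl r_carrier finite_between by (simp add: sum.delta')
    finally show ?thesis .
  qed
  have "W y = (if x = y then 1 else 0)" if "(x, y) \<in> r" for y
    using that
  proof (induction "card {w. (w, y) \<in> r}" arbitrary: y rule: less_induct)
    case less
    let ?I = "{y'. (x, y') \<in> r \<and> (y', y) \<in> r}"
    have smaller: "W y' = (if x = y' then 1 else 0)" if "y' \<in> ?I - {y}" for y'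
    proof (rule less.hyps)
      show "card {w. (w, y') \<in> r} < card {w. (w, y) \<in> r}"
        using that by (intro card_down_less[OF finite_r]) (auto simp: Field_r order)
    qed (use that in auto)
    have "y \<in> ?I" "x \<in> ?I"
      using less.prems r_refl r_carrier by auto
    have "1 = W y + (\<Sum>y'\<in>?I - {y}. W y')"
      using total[OF less.prems] sum.remove[OF finite_between \<open>y \<in> ?I\<close>, of W] by simp
    also have "(\<Sum>y'\<in>?I - {y}. W y') = (\<Sum>y'\<in>?I - {y}. if x = y' then 1 else 0)"
      using smaller by (intro sum.cong) auto
    also have "\<dots> = (if x = y then 0 else 1)"
      using \<open>x \<in> ?I\<close> finite_between by (simp add: sum.delta)
    finally show ?case
      by (simp split: if_splits)
  qed
  then show ?thesis
    using assms by (simp add: W_def)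
qed

text \<open>Exchanging the order of summation reduces a double sum over chains \<open>x \<le> z \<le> K\<close> to the identities for
  the intervals from \<open>x\<close> to \<open>K\<close>.  Both \<open>sum_mobius_above\<close> and \<open>sum_mobius_below\<close> are of the required form.\<close>

lemma sum_below_collapse:
  fixes g :: "'a \<Rightarrow> 'k::comm_ring_1"
  assumes K: "K \<in> A" and m: "\<And>x. (x, K) \<in> r \<Longrightarrow>
      (\<Sum>z | (x, z) \<in> r \<and> (z, K) \<in> r. m x z) = (if x = K then 1 else 0)"
  shows "(\<Sum>z | (z, K) \<in> r. \<Sum>x | (x, z) \<in> r. m x z * g x) = g K"
proof -
  have "(\<Sum>z | (z, K) \<in> r. \<Sum>x | (x, z) \<in> r. m x z * g x)
      = (\<Sum>(z, x)\<in>Sigma {z. (z, K) \<in> r} (\<lambda>z. {x. (x, z) \<in> r}). m x z * g x)"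
    using finite_down by (intro sum.Sigma) auto
  also have "\<dots> = (\<Sum>(x, z)\<in>Sigma {x. (x, K) \<in> r} (\<lambda>x. {z. (x, z) \<in> r \<and> (z, K) \<in> r}). m x z * g x)"
    by (rule sum.reindex_bij_witness[of _ prod.swap prod.swap]) (auto dest: r_trans)
  also have "\<dots> = (\<Sum>x | (x, K) \<in> r. \<Sum>z | (x, z) \<in> r \<and> (z, K) \<in> r. m x z * g x)"
    using finite_down finite_between by (intro sum.Sigma[symmetric]) auto
  also have "\<dots> = (\<Sum>x | (x, K) \<in> r. if x = K then g x else 0)"
    by (intro sum.cong refl) (simp add: m sum_distrib_right[symmetric])
  also have "\<dots> = g K"
    using r_refl[OF K] finite_down by (simp add: sum.delta)
  finally show ?thesis .
qed

lemma p_vec_apply: "(p_vec r l x :: 'k::field) = (if (x, l) \<in> r then of_int (mobius r x l) else 0)"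
proof -
  have "(p_vec r l x :: 'k) = (\<Sum>l' | (l', l) \<in> r. if l' = x then of_int (mobius r l' l) else 0)"
    unfolding p_vec_def sum_apply by (rule sum.cong) (auto simp: fscale_def indicator_def)
  then show ?thesis
    using finite_down by (simp add: sum.delta')
qed

end

text \<open>The coefficient of the p-basis vector at \<open>l\<close> in \<open>x\<close>: the basis vector at \<open>l'\<close> is the sum of the p-basis
  vectors at all \<open>l \<le> l'\<close>.\<close>

definition p_coord :: "('a \<times> 'a) set \<Rightarrow> ('a \<Rightarrow> 'k::field) \<Rightarrow> 'a \<Rightarrow> 'k" where
  "p_coord r x l = (\<Sum>l' | (l, l') \<in> r. x l')"

lemma p_coord_add: "p_coord r (x + y) l = p_coord r x l + p_coord r y l"
  by (simp add: p_coord_def sum.distrib)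

lemma p_coord_scale: "p_coord r (fscale c x) l = c * p_coord r x l"
  by (simp add: p_coord_def fscale_def sum_distrib_left)

lemma p_coord_zero [simp]: "p_coord r 0 l = 0"
  by (simp add: p_coord_def)

lemma p_coord_sum: "p_coord r (sum f S) l = (\<Sum>j\<in>S. p_coord r (f j) l)"
  by (induction S rule: infinite_finite_induct) (simp_all only: sum.infinite sum.empty sum.insert not_False_eq_True p_coord_add p_coord_zero)

lemma p_coord_diff: "p_coord r (x - y) l = p_coord r x l - p_coord r y l"
  by (simp add: p_coord_def sum_subtractf)

context finite_poset
begin

lemma p_coord_p_vec:
  assumes "l \<in> A" "l0 \<in> A"
  shows "p_coord r (p_vec r l0) l = (if l = l0 then 1 else 0 :: 'k::field)"
proof (cases "(l, l0) \<in> r")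
  case True
  have "p_coord r (p_vec r l0) l = (\<Sum>l' | (l, l') \<in> r \<and> (l', l0) \<in> r. of_int (mobius r l' l0) :: 'k)"
    unfolding p_coord_def p_vec_apply
    by (rule sum.mono_neutral_cong_right[OF finite_up]) auto
  also have "\<dots> = of_int (\<Sum>l' | (l, l') \<in> r \<and> (l', l0) \<in> r. mobius r l' l0)"
    by simp
  finally show ?thesis
    using sum_mobius_below[OF True] by simp
next
  case False
  then have "p_coord r (p_vec r l0) l = (0::'k)"
    unfolding p_coord_def p_vec_apply by (intro sum.neutral) (auto dest: r_trans)
  then show ?thesis
    using False assms r_refl by auto
qed

text \<open>Since \<open>p_coord\<close> sums over upper sets and \<open>p_vec\<close> carries the Moebius function, this is Moebius inversion
  in the form \<open>sum_mobius_above\<close>.\<close>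

lemma p_expansion:
  fixes x :: "'a \<Rightarrow> 'k::field"
  assumes "\<And>a. x a \<noteq> 0 \<Longrightarrow> a \<in> A"
  shows "x = (\<Sum>l\<in>A. fscale (p_coord r x l) (p_vec r l))"
proof
  fix a
  have "(\<Sum>l\<in>A. fscale (p_coord r x l) (p_vec r l)) a
      = (\<Sum>l\<in>A. p_coord r x l * (if (a, l) \<in> r then of_int (mobius r a l) else 0))"
    by (simp add: sum_apply fscale_def p_vec_apply)
  also have "\<dots> = (\<Sum>l\<in>A. \<Sum>l'\<in>A. if (a, l) \<in> r \<and> (l, l') \<in> r then of_int (mobius r a l) * x l' else 0)"
  proof (rule sum.cong[OF refl])
    fix l assume "l \<in> A"
    have "p_coord r x l = (\<Sum>l'\<in>A. if (l, l') \<in> r then x l' else 0)"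
      unfolding p_coord_def sum.inter_filter[OF finite_carrier, symmetric]
      by (rule sum.cong) (auto dest: r_carrier)
    then show "p_coord r x l * (if (a, l) \<in> r then of_int (mobius r a l) else 0)
        = (\<Sum>l'\<in>A. if (a, l) \<in> r \<and> (l, l') \<in> r then of_int (mobius r a l) * x l' else 0)"
      by (auto simp: sum_distrib_right intro!: sum.cong)
  qed
  also have "\<dots> = (\<Sum>l'\<in>A. x l' * of_int (\<Sum>l | (a, l) \<in> r \<and> (l, l') \<in> r. mobius r a l))"
  proof (subst sum.swap, rule sum.cong[OF refl])
    fix l' assume "l' \<in> A"
    have "{l \<in> A. (a, l) \<in> r \<and> (l, l') \<in> r} = {l. (a, l) \<in> r \<and> (l, l') \<in> r}"
      by (auto dest: r_carrier)
    then show "(\<Sum>l\<in>A. if (a, l) \<in> r \<and> (l, l') \<in> r then of_int (mobius r a l) * x l' else 0)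
        = x l' * of_int (\<Sum>l | (a, l) \<in> r \<and> (l, l') \<in> r. mobius r a l)"
      by (simp add: sum.inter_filter[OF finite_carrier, symmetric] sum_distrib_left mult.commute)
  qed
  also have "\<dots> = (\<Sum>l'\<in>A. if a = l' then x l' else 0)"
  proof (rule sum.cong[OF refl])
    fix l' assume "l' \<in> A"
    show "x l' * of_int (\<Sum>l | (a, l) \<in> r \<and> (l, l') \<in> r. mobius r a l) = (if a = l' then x l' else 0)"
    proof (cases "(a, l') \<in> r")
      case True
      then show ?thesis
        by (simp only: sum_mobius_above[OF True]) simp
    next
      case False
      then have none: "{l. (a, l) \<in> r \<and> (l, l') \<in> r} = {}"
        by (auto dest: r_trans)
      have "a \<noteq> l'"
        using False \<open>l' \<in> A\<close> r_refl by auto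
      then show ?thesis
        unfolding none by simp
    qed
  qed
  also have "\<dots> = x a"
    using assms finite_carrier by (auto simp: sum.delta)
  finally show "x a = (\<Sum>l\<in>A. fscale (p_coord r x l) (p_vec r l)) a" ..
qed

lemma p_vec_support: "(p_vec r l a :: 'k::field) \<noteq> 0 \<Longrightarrow> a \<in> A"
  by (auto simp: p_vec_apply split: if_splits dest: r_carrier)

lemma eq_if_p_coord_eq:
  fixes x y :: "'a \<Rightarrow> 'k::field"
  assumes "\<And>a. x a \<noteq> 0 \<Longrightarrow> a \<in> A" "\<And>a. y a \<noteq> 0 \<Longrightarrow> a \<in> A"
    and "\<And>l. l \<in> A \<Longrightarrow> p_coord r x l = p_coord r y l"
  shows "x = y"
proof -
  have "x = (\<Sum>l\<in>A. fscale (p_coord r x l) (p_vec r l))"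
    using assms by (intro p_expansion)
  also have "\<dots> = (\<Sum>l\<in>A. fscale (p_coord r y l) (p_vec r l))"
    using assms by simp
  also have "\<dots> = y"
    using assms by (intro p_expansion[symmetric])
  finally show ?thesis .
qed

end


section \<open>Linear extension from a basis with known coordinate functionals\<close>

text \<open>A family \<open>v\<close> together with functionals that take the values 0 and 1 on it as coordinates do.  Such
  functionals make the independence of \<open>v\<close> immediate and are explicit for the p-bases, so that no
  abstract basis expansion enters the computations.\<close>

locale dual_family =
  fixes J :: "'j set" and v :: "'j \<Rightarrow> ('a \<Rightarrow> 'k::field)" and coord :: "'j \<Rightarrow> ('a \<Rightarrow> 'k) \<Rightarrow> 'k"
  assumes coord_add: "\<And>j x y. coord j (x + y) = coord j x + coord j y"
    and coord_scale: "\<And>j c x. coord j (fscale c x) = c * coord j x"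
    and coord_basis: "\<And>i j. i \<in> J \<Longrightarrow> j \<in> J \<Longrightarrow> coord i (v j) = (if i = j then 1 else 0)"
begin

lemma coord_zero: "coord j 0 = 0"
  using coord_scale[of j 0 0] by simp

lemma coord_sum: "coord j (sum f S) = (\<Sum>i\<in>S. coord j (f i))"
  by (induction S rule: infinite_finite_induct) (simp_all only: sum.infinite sum.empty sum.insert not_False_eq_True coord_zero coord_add)

lemma inj_on_basis: "inj_on v J"
proof (rule inj_onI)
  fix i j assume "i \<in> J" "j \<in> J" "v i = v j"
  then show "i = j"
    using coord_basis[of i i] coord_basis[of i j] by (simp split: if_splits)
qed

lemma independent_basis: "fun_vs.independent (v ` J)"
  unfolding fun_vs.independent_explicit_finite_subsets
proof (intro allI impI ballI)
  fix S u y assume S: "S \<subseteq> v ` J" "finite S" "(\<Sum>x\<in>S. fscale (u x) x) = 0" "y \<in> S"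
  then obtain i where i: "i \<in> J" "y = v i"
    by auto
  have "coord i x = (if x = y then 1 else 0)" if "x \<in> S" for x
    using that S(1) i inj_onD[OF inj_on_basis] by (auto simp: coord_basis)
  then have "coord i (\<Sum>x\<in>S. fscale (u x) x) = (\<Sum>x\<in>S. if x = y then u x else 0)"
    unfolding coord_sum coord_scale by (intro sum.cong) auto
  then show "u y = 0"
    using S by (simp add: coord_zero sum.delta)
qed

context
  fixes s :: "'k \<Rightarrow> 'w::ab_group_add \<Rightarrow> 'w" and w :: "'j \<Rightarrow> 'w"
  assumes target: "vector_space s"
begin

lemma linear_linear_ext: "Vector_Spaces.linear fscale s (linear_ext s J v w)"
proof -
  interpret vector_space_pair fscale s
    using target by (intro vector_space_pair.intro fun_vs.vector_space_axioms)
  show ?thesis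
    unfolding linear_ext_def by (rule linear_construct[OF independent_basis])
qed

lemma linear_ext_basis: "j \<in> J \<Longrightarrow> linear_ext s J v w (v j) = w j"
proof -
  assume j: "j \<in> J"
  interpret vector_space_pair fscale s
    using target by (intro vector_space_pair.intro fun_vs.vector_space_axioms)
  show ?thesis
    unfolding linear_ext_def using j inj_on_basis
    by (subst construct_basis[OF independent_basis]) auto
qed

lemma linear_ext_sum:
  assumes "x = (\<Sum>j\<in>F. fscale (c j) (v j))" "F \<subseteq> J"
  shows "linear_ext s J v w x = (\<Sum>j\<in>F. s (c j) (w j))"
proof -
  interpret l: Vector_Spaces.linear fscale s "linear_ext s J v w"
    by (rule linear_linear_ext)
  show ?thesis
    unfolding assms(1) l.sum l.scale using assms(2)
    by (intro sum.cong) (auto simp: linear_ext_basis)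
qed

end

end


section \<open>Graded spaces and coinvariants\<close>

text \<open>The coordinate of \<open>x\<close> at the p-basis vector of index \<open>snd j\<close> in degree \<open>fst j\<close>.\<close>

definition graded_coord ::
  "(nat \<Rightarrow> ('b \<times> 'b) set) \<Rightarrow> nat \<times> 'b \<Rightarrow> (nat \<times> 'b \<Rightarrow> 'k::field) \<Rightarrow> 'k" where
  "graded_coord r j x = p_coord (r (fst j)) (curry x (fst j)) (snd j)"

lemma curry_in_degree: "curry (in_degree n v) m = (if m = n then v else 0)"
  by (auto simp: in_degree_def fun_eq_iff)

lemma in_degree_apply: "in_degree n v (m, b) = (if m = n then v b else 0)"
  by (simp add: in_degree_def)

lemma graded_space_zero: "0 \<in> graded_space B"
  by (simp add: graded_space_def)

lemma graded_space_add: "x \<in> graded_space B \<Longrightarrow> y \<in> graded_space B \<Longrightarrow> x + y \<in> graded_space B"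
proof -
  assume x: "x \<in> graded_space B" and y: "y \<in> graded_space B"
  have "{j. (x + y) j \<noteq> 0} \<subseteq> {j. x j \<noteq> 0} \<union> {j. y j \<noteq> 0}"
    by auto
  then have "finite {j. (x + y) j \<noteq> 0}"
    by (rule finite_subset) (use x y in \<open>auto simp: graded_space_def\<close>)
  moreover have "x (n, b) \<noteq> 0 \<or> y (n, b) \<noteq> 0" if "(x + y) (n, b) \<noteq> 0" for n b
    using that by auto
  ultimately show ?thesis
    using x y unfolding graded_space_def by blast
qed

lemma graded_space_scale: "x \<in> graded_space B \<Longrightarrow> fscale c x \<in> graded_space B"
proof -
  assume x: "x \<in> graded_space B"
  have "{j. fscale c x j \<noteq> 0} \<subseteq> {j. x j \<noteq> 0}"
    by (auto simp: fscale_def)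
  then have "finite {j. fscale c x j \<noteq> 0}"
    by (rule finite_subset) (use x in \<open>auto simp: graded_space_def\<close>)
  then show ?thesis
    using x by (auto simp: graded_space_def fscale_def)
qed

lemma subspace_graded_space: "fun_vs.subspace (graded_space B)"
  by (rule fun_vs.subspaceI) (auto intro: graded_space_zero graded_space_add graded_space_scale)

lemma in_degree_graded_space:
  assumes "finite (B n)" "\<And>b. v b \<noteq> 0 \<Longrightarrow> b \<in> B n"
  shows "in_degree n v \<in> graded_space B"
proof -
  have "{j. in_degree n v j \<noteq> 0} \<subseteq> {n} \<times> B n"
    using assms(2) by (auto simp: in_degree_def split: if_splits)
  then have "finite {j. in_degree n v j \<noteq> 0}"
    by (rule finite_subset) (use assms(1) in auto)
  then show ?thesis
    using assms(2) by (auto simp: graded_space_def in_degree_def split: if_splits)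
qed

locale graded_poset =
  fixes B :: "nat \<Rightarrow> 'b set" and r :: "nat \<Rightarrow> ('b \<times> 'b) set"
  assumes degree: "\<And>n. finite_poset (B n) (r n)"
begin

sublocale deg: finite_poset "B n" "r n" for n
  by (rule degree)

abbreviation basis :: "nat \<times> 'b \<Rightarrow> nat \<times> 'b \<Rightarrow> 'k::field" where
  "basis \<equiv> \<lambda>(n, b). in_degree n (p_vec (r n) b)"

sublocale dual_family "SIGMA n:UNIV. B n" "basis :: _ \<Rightarrow> _ \<Rightarrow> 'k::field" "graded_coord r"
proof
  fix j and x y :: "nat \<times> 'b \<Rightarrow> 'k"
  have "curry (x + y) n = curry x n + curry y n" for n
    by auto
  then show "graded_coord r j (x + y) = graded_coord r j x + graded_coord r j y"
    by (simp only: graded_coord_def p_coord_add)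
next
  fix j c and x :: "nat \<times> 'b \<Rightarrow> 'k"
  have "curry (fscale c x) n = fscale c (curry x n)" for n
    by (auto simp: fscale_def)
  then show "graded_coord r j (fscale c x) = c * graded_coord r j x"
    by (simp only: graded_coord_def p_coord_scale)
next
  fix i j assume i: "i \<in> (SIGMA n:UNIV. B n)" and j: "j \<in> (SIGMA n:UNIV. B n)"
  obtain m a n b where ij: "i = (m, a)" "j = (n, b)"
    by (metis surj_pair)
  show "graded_coord r i (basis j) = (if i = j then 1 else 0 :: 'k)"
  proof (cases "m = n")
    case True
    then show ?thesis
      using i j by (simp add: ij graded_coord_def curry_in_degree deg.p_coord_p_vec)
  next
    case False
    then have "curry (basis j) m = (0 :: 'b \<Rightarrow> 'k)"
      by (simp add: ij curry_in_degree)
    then show ?thesis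
      using False by (simp add: graded_coord_def ij p_coord_def fun_eq_iff)
  qed
qed

lemma basis_in_graded_space: "j \<in> (SIGMA n:UNIV. B n) \<Longrightarrow> basis j \<in> graded_space B"
  using deg.p_vec_support deg.finite_carrier by (auto intro!: in_degree_graded_space)

lemma finite_coords:
  assumes "x \<in> graded_space B"
  shows "finite {j \<in> (SIGMA n:UNIV. B n). graded_coord r j x \<noteq> 0}"
    and "x = (\<Sum>j\<in>{j \<in> (SIGMA n:UNIV. B n). graded_coord r j x \<noteq> 0}. fscale (graded_coord r j x) (basis j))"
proof -
  define N where "N = fst ` {j. x j \<noteq> 0}"
  have N: "finite N"
    using assms by (simp add: N_def graded_space_def)
  have outside: "curry x n = 0" if "n \<notin> N" for n
  proof
    fix b show "curry x n b = 0 b"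
      using that image_eqI[of n fst "(n, b)" "{j. x j \<noteq> 0}"] by (auto simp: N_def)
  qed
  have F0: "finite (SIGMA n:N. B n)"
    using N deg.finite_carrier by auto
  have sub: "{j \<in> (SIGMA n:UNIV. B n). graded_coord r j x \<noteq> 0} \<subseteq> (SIGMA n:N. B n)"
  proof
    fix j assume j: "j \<in> {j \<in> (SIGMA n:UNIV. B n). graded_coord r j x \<noteq> 0}"
    have "fst j \<in> N"
    proof (rule ccontr)
      assume "fst j \<notin> N"
      then have "curry x (fst j) = 0"
        by (rule outside)
      then have "graded_coord r j x = 0"
        unfolding graded_coord_def by (metis p_coord_zero)
      then show False
        using j by simp
    qed
    then show "j \<in> (SIGMA n:N. B n)"
      using j by auto
  qed
  show "finite {j \<in> (SIGMA n:UNIV. B n). graded_coord r j x \<noteq> 0}"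
    using sub F0 by (rule finite_subset)
  have "x = (\<Sum>j\<in>(SIGMA n:N. B n). fscale (graded_coord r j x) (basis j))"
  proof
    fix j :: "nat \<times> 'b"
    obtain m b where j: "j = (m, b)"
      by force
    have "(\<Sum>j\<in>(SIGMA n:N. B n). fscale (graded_coord r j x) (basis j)) (m, b)
        = (\<Sum>n\<in>N. \<Sum>l\<in>B n. graded_coord r (n, l) x * in_degree n (p_vec (r n) l) (m, b))"
      by (simp add: sum_apply fscale_def sum.Sigma[OF N] deg.finite_carrier split_def)
    also have "\<dots> = (\<Sum>n\<in>N. if n = m then \<Sum>l\<in>B n. p_coord (r n) (curry x n) l * p_vec (r n) l b else 0)"
      by (auto simp: in_degree_apply graded_coord_def intro!: sum.cong)
    also have "\<dots> = x (m, b)"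
    proof (cases "m \<in> N")
      case True
      have "curry x m = (\<Sum>l\<in>B m. fscale (p_coord (r m) (curry x m) l) (p_vec (r m) l))"
        by (rule deg.p_expansion) (use assms in \<open>auto simp: graded_space_def\<close>)
      then have "curry x m b = (\<Sum>l\<in>B m. fscale (p_coord (r m) (curry x m) l) (p_vec (r m) l)) b"
        by simp
      then have "x (m, b) = (\<Sum>l\<in>B m. p_coord (r m) (curry x m) l * p_vec (r m) l b)"
        by (simp add: sum_apply fscale_def)
      then show ?thesis
        using True N by simp
    next
      case False
      then show ?thesis
        using N outside[OF False] by (auto simp: fun_eq_iff)
    qed
    finally show "x j = (\<Sum>j\<in>(SIGMA n:N. B n). fscale (graded_coord r j x) (basis j)) j"
      unfolding j by simp
  qed
  also have "\<dots> = (\<Sum>j\<in>{j \<in> (SIGMA n:UNIV. B n). graded_coord r j x \<noteq> 0}. fscale (graded_coord r j x) (basis j))"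
    using F0 sub by (intro sum.mono_neutral_right) (auto simp: fscale_def fun_eq_iff)
  finally show "x = (\<Sum>j\<in>{j \<in> (SIGMA n:UNIV. B n). graded_coord r j x \<noteq> 0}. fscale (graded_coord r j x) (basis j))" .
qed

lemma linear_ext_graded:
  fixes w :: "nat \<times> 'b \<Rightarrow> ('c \<Rightarrow> 'k::field)"
  assumes "x \<in> graded_space B" "finite F" "F \<subseteq> (SIGMA n:UNIV. B n)"
    and "\<And>j. j \<in> (SIGMA n:UNIV. B n) \<Longrightarrow> graded_coord r j x \<noteq> 0 \<Longrightarrow> j \<in> F"
  shows "linear_ext fscale (SIGMA n:UNIV. B n) basis w x
       = (\<Sum>j\<in>F. fscale (graded_coord r j x) (w j))"
proof -
  have "linear_ext fscale (SIGMA n:UNIV. B n) basis w x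
     = (\<Sum>j\<in>{j \<in> (SIGMA n:UNIV. B n). graded_coord r j x \<noteq> 0}. fscale (graded_coord r j x) (w j))"
    by (rule linear_ext_sum[OF fun_vs.vector_space_axioms finite_coords(2)[OF assms(1)]]) auto
  also have "\<dots> = (\<Sum>j\<in>F. fscale (graded_coord r j x) (w j))"
    using assms by (intro sum.mono_neutral_left) (auto simp: fscale_def fun_eq_iff)
  finally show ?thesis .
qed

lemma ex_with_coords:
  fixes c :: "nat \<times> 'b \<Rightarrow> 'k::field"
  assumes "finite F" "F \<subseteq> (SIGMA n:UNIV. B n)"
  obtains x where "x \<in> graded_space B"
    "\<And>j. j \<in> (SIGMA n:UNIV. B n) \<Longrightarrow> graded_coord r j x = (if j \<in> F then c j else 0)"
proof
  let ?x = "\<Sum>j\<in>F. fscale (c j) (basis j)"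
  show "?x \<in> graded_space B"
    using assms basis_in_graded_space
    by (intro fun_vs.subspace_sum[OF subspace_graded_space] graded_space_scale) auto
  fix j assume j: "j \<in> (SIGMA n:UNIV. B n)"
  have "graded_coord r j ?x = (\<Sum>i\<in>F. c i * graded_coord r j (basis i))"
    by (simp only: coord_sum coord_scale)
  also have "\<dots> = (\<Sum>i\<in>F. if i = j then c i else 0)"
  proof (rule sum.cong[OF refl])
    fix i assume "i \<in> F"
    then have "graded_coord r j (basis i) = (if j = i then 1 else 0 :: 'k)"
      using assms(2) j by (intro coord_basis) auto
    then show "c i * graded_coord r j (basis i) = (if i = j then c i else 0)"
      by simp
  qed
  also have "\<dots> = (if j \<in> F then c j else 0)"
    using assms(1) by (simp add: sum.delta)
  finally show "graded_coord r j ?x = (if j \<in> F then c j else 0)" .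
qed

lemma eq_if_graded_coord_eq:
  fixes x y :: "nat \<times> 'b \<Rightarrow> 'k::field"
  assumes "x \<in> graded_space B" "y \<in> graded_space B"
    and "\<And>j. j \<in> (SIGMA n:UNIV. B n) \<Longrightarrow> graded_coord r j x = graded_coord r j y"
  shows "x = y"
proof -
  have "curry x n = curry y n" for n
    using assms by (intro deg.eq_if_p_coord_eq) (auto simp: graded_space_def graded_coord_def)
  then show ?thesis
    by (auto simp: fun_eq_iff)
qed

end


lemma push_forward_apply:
  assumes "finite A" "inj_on g A" "\<And>b. x b \<noteq> 0 \<Longrightarrow> b \<in> A"
  shows "b \<in> A \<Longrightarrow> push_forward g x (g b) = x b"
    and "push_forward g x c \<noteq> 0 \<Longrightarrow> c \<in> g ` A"
proof -
  have fin: "finite {b. x b \<noteq> 0}"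
    by (rule finite_subset[OF _ assms(1)]) (use assms(3) in auto)
  have app: "push_forward g x c = (\<Sum>b | x b \<noteq> 0. if g b = c then x b else 0)" for c
    unfolding push_forward_def sum_apply by (rule sum.cong) (auto simp: fscale_def indicator_def)
  show "push_forward g x (g b) = x b" if "b \<in> A"
  proof -
    have "push_forward g x (g b) = (\<Sum>b' | x b' \<noteq> 0. if b' = b then x b' else 0)"
      unfolding app using that assms inj_onD[OF assms(2)] by (intro sum.cong) auto
    then show ?thesis
      using fin by (simp add: sum.delta)
  qed
  show "c \<in> g ` A" if "push_forward g x c \<noteq> 0"
  proof (rule ccontr)
    assume "c \<notin> g ` A"
    then have "push_forward g x c = 0"
      unfolding app using assms(3) by (intro sum.neutral) auto
    then show False
      using that by simp
  qed
qed

text \<open>An automorphism of the poset permutes the p-basis, as it maps upper sets to upper sets.\<close>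

lemma (in finite_poset) p_coord_push_forward:
  fixes x :: "'a \<Rightarrow> 'k::field"
  assumes g: "bij_betw g A A" "\<And>a b. a \<in> A \<Longrightarrow> b \<in> A \<Longrightarrow> (g a, g b) \<in> r \<longleftrightarrow> (a, b) \<in> r"
    and x: "\<And>b. x b \<noteq> 0 \<Longrightarrow> b \<in> A" and l: "l \<in> A"
  shows "p_coord r (push_forward g x) (g l) = p_coord r x l"
proof -
  have inj: "inj_on g A" and im: "g ` A = A"
    using g(1) by (auto simp: bij_betw_def)
  have up: "{l'. (g l, l') \<in> r} = g ` {l'. (l, l') \<in> r}"
  proof (intro set_eqI iffI)
    fix c assume c: "c \<in> {l'. (g l, l') \<in> r}"
    then obtain b where "b \<in> A" "c = g b"
      using im r_carrier by blast
    then show "c \<in> g ` {l'. (l, l') \<in> r}"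
      using c g(2) l by auto
  qed (use g(2) l r_carrier in auto)
  have "p_coord r (push_forward g x) (g l) = (\<Sum>l' | (l, l') \<in> r. push_forward g x (g l'))"
    unfolding p_coord_def up
    by (subst sum.reindex) (use inj r_carrier in \<open>auto intro: inj_on_subset\<close>)
  also have "\<dots> = p_coord r x l"
    unfolding p_coord_def
    by (intro sum.cong refl push_forward_apply(1)[OF finite_carrier inj x]) (auto dest: r_carrier)
  finally show ?thesis .
qed

lemma equiv_coinv_rel: "equiv (graded_space B) (coinv_rel B act :: ((_ \<Rightarrow> 'k::field) \<times> _) set)"
proof (rule equivI)
  show "coinv_rel B act \<subseteq> graded_space B \<times> graded_space B"
    by (auto simp: coinv_rel_def)
  show "refl_on (graded_space B) (coinv_rel B act :: ((_ \<Rightarrow> 'k) \<times> _) set)"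
    by (auto simp: refl_on_def coinv_rel_def coinv_relators_def fun_vs.span_zero
        simp del: func_zero zero_fun_def)
  show "sym (coinv_rel B act :: ((_ \<Rightarrow> 'k) \<times> _) set)"
    unfolding coinv_rel_def coinv_relators_def
    by (auto intro!: symI dest: fun_vs.span_neg)
  show "trans (coinv_rel B act :: ((_ \<Rightarrow> 'k) \<times> _) set)"
    unfolding coinv_rel_def coinv_relators_def
    by (auto intro!: transI dest: fun_vs.span_add)
qed

lemma coinvariants_cases:
  assumes "C \<in> coinvariants B act"
  obtains x where "x \<in> graded_space B" "C = coinv_rel B act `` {x}" "x \<in> C"
  using assms equiv_class_self[OF equiv_coinv_rel] by (auto simp: coinvariants_def elim!: quotientE)

lemma class_in_coinvariants: "x \<in> graded_space B \<Longrightarrow> coinv_rel B act `` {x} \<in> coinvariants B act"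
  by (simp add: coinvariants_def quotientI)

lemma class_self: "x \<in> graded_space B \<Longrightarrow> x \<in> coinv_rel B act `` {x}"
  by (rule equiv_class_self[OF equiv_coinv_rel])

text \<open>The maps on coinvariants are given by the common value of a lift at the elements of a class.\<close>

lemma the_elem_class:
  assumes "C \<in> coinvariants B act" "x \<in> C"
    and "\<And>x y. (x, y) \<in> coinv_rel B act \<Longrightarrow> \<phi> x = \<phi> y"
  shows "the_elem (\<phi> ` C) = \<phi> x"
proof -
  have "\<phi> y = \<phi> x" if "y \<in> C" for y
  proof (rule assms(3))
    show "(y, x) \<in> coinv_rel B act"
      using quotient_eq_iff[OF equiv_coinv_rel assms(1)[unfolded coinvariants_def]
          assms(1)[unfolded coinvariants_def] that assms(2)] by simp
  qed
  then have "\<phi> ` C = {\<phi> x}"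
    using assms(2) by blast
  then show ?thesis
    by simp
qed

locale graded_poset_action = graded_poset B r
  for B :: "nat \<Rightarrow> 'b set" and r +
  fixes act :: "(nat \<Rightarrow> nat) \<Rightarrow> 'b \<Rightarrow> 'b"
  assumes act_bij: "\<sigma> permutes {1..n} \<Longrightarrow> bij_betw (act \<sigma>) (B n) (B n)"
    and act_order: "\<sigma> permutes {1..n} \<Longrightarrow> a \<in> B n \<Longrightarrow> b \<in> B n
      \<Longrightarrow> (act \<sigma> a, act \<sigma> b) \<in> r n \<longleftrightarrow> (a, b) \<in> r n"
begin

lemma push_forward_support:
  fixes x :: "'b \<Rightarrow> 'k::field"
  assumes "\<sigma> permutes {1..n}" "\<And>b. x b \<noteq> 0 \<Longrightarrow> b \<in> B n" "push_forward (act \<sigma>) x b \<noteq> 0"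
  shows "b \<in> B n"
proof -
  have "inj_on (act \<sigma>) (B n)" "act \<sigma> ` B n = B n"
    using act_bij[OF assms(1)] by (auto simp: bij_betw_def)
  with push_forward_apply(2)[OF deg.finite_carrier this(1) assms(2,3)] show ?thesis
    by simp
qed

lemma relators_subset_graded_space: "coinv_relators B act \<subseteq> graded_space B"
  unfolding coinv_relators_def
proof (rule fun_vs.span_minimal[OF _ subspace_graded_space], safe)
  fix n \<sigma> and x :: "'b \<Rightarrow> 'k::field"
  assume \<sigma>: "\<sigma> permutes {1..n}" and x: "\<forall>b. x b \<noteq> 0 \<longrightarrow> b \<in> B n"
  show "in_degree n (x - push_forward (act \<sigma>) x) \<in> graded_space B"
  proof (rule in_degree_graded_space[OF deg.finite_carrier])
    fix b assume "(x - push_forward (act \<sigma>) x) b \<noteq> 0"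
    then have "x b \<noteq> 0 \<or> push_forward (act \<sigma>) x b \<noteq> 0"
      by auto
    then show "b \<in> B n"
      using x push_forward_support[OF \<sigma>, of x b] by auto
  qed
qed

text \<open>The action permutes the p-basis, so that \<open>x\<close> and its image under \<open>\<sigma>\<close> have the same coordinates up to
  reindexing by \<open>\<sigma>\<close>, which an invariant family \<open>w\<close> does not see.  This is why such a family defines a map on
  the coinvariants.\<close>

lemma linear_ext_relators:
  fixes w :: "nat \<times> 'b \<Rightarrow> ('c \<Rightarrow> 'k::field)"
  assumes inv: "\<And>n \<sigma> b. \<sigma> permutes {1..n} \<Longrightarrow> b \<in> B n \<Longrightarrow> w (n, act \<sigma> b) = w (n, b)"
    and y: "y \<in> coinv_relators B act"
  shows "linear_ext fscale (SIGMA n:UNIV. B n) basis w y = 0"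
proof -
  let ?\<phi> = "linear_ext fscale (SIGMA n:UNIV. B n) basis w"
  interpret \<phi>: Vector_Spaces.linear fscale fscale ?\<phi>
    by (rule linear_linear_ext[OF fun_vs.vector_space_axioms])
  have gen: "?\<phi> (in_degree n (x - push_forward (act \<sigma>) x)) = 0"
    if \<sigma>: "\<sigma> permutes {1..n}" and x: "\<forall>b. x b \<noteq> 0 \<longrightarrow> b \<in> B n" for n \<sigma> and x :: "'b \<Rightarrow> 'k"
  proof -
    let ?y = "in_degree n (x - push_forward (act \<sigma>) x)"
    have inj: "inj_on (act \<sigma>) (B n)" "act \<sigma> ` B n = B n"
      using act_bij[OF \<sigma>] by (auto simp: bij_betw_def)
    have "?y \<in> coinv_relators B act"
      unfolding coinv_relators_def using \<sigma> x by (intro fun_vs.span_base) auto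
    then have "?y \<in> graded_space B"
      using relators_subset_graded_space by auto
    then have "?\<phi> ?y = (\<Sum>j\<in>{n} \<times> B n. fscale (graded_coord r j ?y) (w j))"
      by (rule linear_ext_graded)
        (use deg.finite_carrier in \<open>auto simp: graded_coord_def curry_in_degree split: if_splits\<close>)
    also have "\<dots> = (\<Sum>b\<in>B n. fscale (p_coord (r n) x b - p_coord (r n) (push_forward (act \<sigma>) x) b) (w (n, b)))"
    proof -
      have "{n} \<times> B n = Pair n ` B n"
        by auto
      then show ?thesis
        by (simp add: sum.reindex inj_on_def graded_coord_def curry_in_degree p_coord_diff)
    qed
    also have "\<dots> = (\<Sum>b\<in>B n. fscale (p_coord (r n) x b) (w (n, b)))
        - (\<Sum>b\<in>B n. fscale (p_coord (r n) (push_forward (act \<sigma>) x) b) (w (n, b)))"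
      by (simp only: fun_vs.scale_left_diff_distrib sum_subtractf)
    also have "(\<Sum>b\<in>B n. fscale (p_coord (r n) (push_forward (act \<sigma>) x) b) (w (n, b)))
        = (\<Sum>b\<in>B n. fscale (p_coord (r n) (push_forward (act \<sigma>) x) (act \<sigma> b)) (w (n, act \<sigma> b)))"
      using sum.reindex[OF inj(1), of "\<lambda>b. fscale (p_coord (r n) (push_forward (act \<sigma>) x) b) (w (n, b))"]
      by (simp add: inj(2))
    also have "\<dots> = (\<Sum>b\<in>B n. fscale (p_coord (r n) x b) (w (n, b)))"
      using x by (intro sum.cong refl)
        (simp add: inv[OF \<sigma>] deg.p_coord_push_forward[OF act_bij[OF \<sigma>] act_order[OF \<sigma>]])
    finally show ?thesis
      by (simp only: diff_self)
  qed
  show ?thesis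
    using y unfolding coinv_relators_def
  proof (induction rule: fun_vs.span_induct)
    show "fun_vs.subspace {a. ?\<phi> a = 0}"
      by (rule fun_vs.subspaceI) (simp_all only: mem_Collect_eq \<phi>.zero \<phi>.add \<phi>.scale fun_vs.scale_zero_right add_0_left)
    fix a assume "a \<in> {in_degree n (x - push_forward (act \<sigma>) x) | n \<sigma> (x :: 'b \<Rightarrow> 'k).
      \<sigma> permutes {1..n} \<and> (\<forall>b. x b \<noteq> 0 \<longrightarrow> b \<in> B n)}"
    then obtain n \<sigma> and x :: "'b \<Rightarrow> 'k" where
      "a = in_degree n (x - push_forward (act \<sigma>) x)" "\<sigma> permutes {1..n}" "\<forall>b. x b \<noteq> 0 \<longrightarrow> b \<in> B n"
      by blast
    then show "?\<phi> a = 0"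
      using gen by (simp only:)
  qed
qed

lemma linear_ext_class:
  fixes w :: "nat \<times> 'b \<Rightarrow> ('c \<Rightarrow> 'k::field)"
  assumes inv: "\<And>n \<sigma> b. \<sigma> permutes {1..n} \<Longrightarrow> b \<in> B n \<Longrightarrow> w (n, act \<sigma> b) = w (n, b)"
    and C: "C \<in> coinvariants B act" "x \<in> C"
  shows "the_elem (linear_ext fscale (SIGMA n:UNIV. B n) basis w ` C)
       = linear_ext fscale (SIGMA n:UNIV. B n) basis w x"
proof (rule the_elem_class[OF C])
  let ?\<phi> = "linear_ext fscale (SIGMA n:UNIV. B n) basis w"
  interpret \<phi>: Vector_Spaces.linear fscale fscale ?\<phi>
    by (rule linear_linear_ext[OF fun_vs.vector_space_axioms])
  fix x y :: "nat \<times> 'b \<Rightarrow> 'k" assume "(x, y) \<in> coinv_rel B act"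
  then have xy: "x - y \<in> coinv_relators B act"
    unfolding coinv_rel_def by blast
  have "?\<phi> (x - y) = 0"
  proof (rule linear_ext_relators[where w = w])
    show "w (n, act \<sigma> b) = w (n, b)" if "\<sigma> permutes {1..n}" "b \<in> B n" for n \<sigma> b
      using that by (rule inv)
  qed (rule xy)
  then have "?\<phi> x - ?\<phi> y = 0"
    unfolding \<phi>.diff .
  then show "?\<phi> x = ?\<phi> y"
    by (rule eq_iff_diff_eq_0[THEN iffD2])
qed

end


section \<open>Restriction of permutations\<close>

text \<open>\<open>first_hit \<sigma> S x y\<close>: the first element of \<open>\<sigma> x, \<sigma> (\<sigma> x), \<dots>\<close> that lies in \<open>S\<close> is \<open>y\<close>.  The
  inductive form replaces reasoning about least exponents by rule induction.\<close>

inductive first_hit :: "('a \<Rightarrow> 'a) \<Rightarrow> 'a set \<Rightarrow> 'a \<Rightarrow> 'a \<Rightarrow> bool" for \<sigma> S where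
  hit: "\<sigma> x \<in> S \<Longrightarrow> first_hit \<sigma> S x (\<sigma> x)"
| skip: "\<sigma> x \<notin> S \<Longrightarrow> first_hit \<sigma> S (\<sigma> x) y \<Longrightarrow> first_hit \<sigma> S x y"

lemma first_hit_in: "first_hit \<sigma> S x y \<Longrightarrow> y \<in> S"
  by (induction rule: first_hit.induct)

lemma first_hit_unique: "first_hit \<sigma> S x y \<Longrightarrow> first_hit \<sigma> S x z \<Longrightarrow> y = z"
  by (induction rule: first_hit.induct) (auto elim: first_hit.cases)

lemma first_hit_orbit: "first_hit \<sigma> S x y \<Longrightarrow> y \<in> orbit \<sigma> x"
  by (induction rule: first_hit.induct) (auto intro: orbit.base orbit_subset)

lemma first_hit_funpow:
  assumes "(\<sigma> ^^ k) x \<in> S" "1 \<le> k" "\<And>j. 1 \<le> j \<Longrightarrow> j < k \<Longrightarrow> (\<sigma> ^^ j) x \<notin> S"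
  shows "first_hit \<sigma> S x ((\<sigma> ^^ k) x)"
  using assms
proof (induction k arbitrary: x)
  case (Suc k)
  show ?case
  proof (cases "k = 0")
    case True
    then show ?thesis
      using Suc.prems by (auto intro: hit)
  next
    case False
    have "first_hit \<sigma> S (\<sigma> x) ((\<sigma> ^^ k) (\<sigma> x))"
    proof (rule Suc.IH)
      show "(\<sigma> ^^ j) (\<sigma> x) \<notin> S" if "1 \<le> j" "j < k" for j
        using Suc.prems(3)[of "Suc j"] that by (simp add: funpow_swap1)
    qed (use Suc.prems False in \<open>auto simp: funpow_swap1\<close>)
    moreover have "\<sigma> x \<notin> S"
      using Suc.prems(3)[of 1] False by auto
    ultimately show ?thesis
      by (auto simp: funpow_swap1 intro: skip)
  qed
qed auto

lemma first_hit_perm_restr: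
  assumes "finite I" "\<sigma> permutes I" "x \<in> S"
  shows "first_hit \<sigma> S x (perm_restr \<sigma> S x)"
proof -
  let ?P = "\<lambda>k. 1 \<le> k \<and> (\<sigma> ^^ k) x \<in> S"
  have "x \<in> orbit \<sigma> x"
    using assms by (intro permutation_self_in_orbit) (auto simp: permutation_permutes)
  then obtain k where "?P k"
    using assms(3) by (auto simp: orbit_altdef Suc_le_eq intro: that)
  then have least: "?P (LEAST k. ?P k)" "\<And>j. j < (LEAST k. ?P k) \<Longrightarrow> \<not> ?P j"
    by (rule LeastI, use not_less_Least in blast)
  have "first_hit \<sigma> S x ((\<sigma> ^^ (LEAST k. ?P k)) x)"
    using least by (intro first_hit_funpow) auto
  then show ?thesis
    using assms(3) by (simp add: perm_restr_def)
qed

lemma perm_restr_eqI: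
  assumes "finite I" "\<sigma> permutes I" "x \<in> S" "first_hit \<sigma> S x y"
  shows "perm_restr \<sigma> S x = y"
  using first_hit_perm_restr[OF assms(1-3)] assms(4) by (rule first_hit_unique)

lemma perm_restr_outside: "x \<notin> S \<Longrightarrow> perm_restr \<sigma> S x = x"
  by (simp add: perm_restr_def)

lemma perm_restr_step:
  assumes "finite I" "\<sigma> permutes I" "x \<in> S" "\<sigma> x \<in> S"
  shows "perm_restr \<sigma> S x = \<sigma> x"
  using assms by (intro perm_restr_eqI) (auto intro: hit)

text \<open>If two elements of \<open>S\<close> reach the same \<open>z\<close>, then the walk that needs more steps passes through the starting
  point of the other one, hence would have stopped there.\<close>

lemma first_hit_inj:
  assumes "inj \<sigma>" "first_hit \<sigma> S x z" "first_hit \<sigma> S y z" "x \<in> S" "y \<in> S"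
  shows "x = y"
proof -
  have last: "\<exists>j. (\<sigma> ^^ Suc j) x = z \<and> (\<forall>i. 1 \<le> i \<and> i \<le> j \<longrightarrow> (\<sigma> ^^ i) x \<notin> S)"
    if "first_hit \<sigma> S x z" for x z
    using that
  proof induction
    case (hit x)
    show ?case
      by (rule exI[of _ 0]) auto
  next
    case (skip x y)
    then obtain j where j: "(\<sigma> ^^ Suc j) (\<sigma> x) = y" "\<forall>i. 1 \<le> i \<and> i \<le> j \<longrightarrow> (\<sigma> ^^ i) (\<sigma> x) \<notin> S"
      by blast
    have "(\<sigma> ^^ i) x \<notin> S" if "1 \<le> i" "i \<le> Suc j" for i
    proof (cases i)
      case (Suc i')
      then show ?thesis
        using skip.hyps(1) j(2) that by (cases "i' = 0") (auto simp: funpow_swap1)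
    qed (use that in auto)
    then show ?case
      using j(1) by (intro exI[of _ "Suc j"]) (auto simp: funpow_swap1)
  qed
  have main: "x = y" if xy: "(\<sigma> ^^ Suc j) x = z" "(\<sigma> ^^ Suc k) y = z" "j \<le> k"
    "\<forall>i. 1 \<le> i \<and> i \<le> k \<longrightarrow> (\<sigma> ^^ i) y \<notin> S" "x \<in> S" for x y j k
  proof -
    have "(\<sigma> ^^ Suc j) ((\<sigma> ^^ (k - j)) y) = (\<sigma> ^^ Suc j) x"
    proof -
      have "Suc k = Suc j + (k - j)"
        using xy(3) by simp
      then have "(\<sigma> ^^ Suc k) y = (\<sigma> ^^ Suc j) ((\<sigma> ^^ (k - j)) y)"
        by (simp only: funpow_add comp_apply)
      then show ?thesis
        using xy(1,2) by simp
    qed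
    then have "(\<sigma> ^^ (k - j)) y = x"
      using inj_fn[OF assms(1), of "Suc j"] by (simp only: inj_eq)
    then show ?thesis
      using xy(3-5) by (cases "k = j") auto
  qed
  obtain j k where "(\<sigma> ^^ Suc j) x = z" "\<forall>i. 1 \<le> i \<and> i \<le> j \<longrightarrow> (\<sigma> ^^ i) x \<notin> S"
    "(\<sigma> ^^ Suc k) y = z" "\<forall>i. 1 \<le> i \<and> i \<le> k \<longrightarrow> (\<sigma> ^^ i) y \<notin> S"
    using last[OF assms(2)] last[OF assms(3)] by blast
  then show ?thesis
    using main[of j x k y] main[of k y j x] assms(4,5) by (cases "j \<le> k") auto
qed

lemma perm_restr_permutes:
  assumes "finite I" "\<sigma> permutes I" "finite S"
  shows "perm_restr \<sigma> S permutes S"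
proof (rule bij_imp_permutes)
  have "inj_on (perm_restr \<sigma> S) S"
  proof (rule inj_onI)
    fix x y assume "x \<in> S" "y \<in> S" "perm_restr \<sigma> S x = perm_restr \<sigma> S y"
    then show "x = y"
      using first_hit_inj[of \<sigma> S x _ y] first_hit_perm_restr[OF assms(1,2)] permutes_inj[OF assms(2)]
      by metis
  qed
  moreover have "perm_restr \<sigma> S ` S \<subseteq> S"
    using first_hit_in[OF first_hit_perm_restr[OF assms(1,2)]] by auto
  ultimately show "bij_betw (perm_restr \<sigma> S) S S"
    using assms(3) by (simp add: bij_betw_def endo_inj_surj)
qed (simp add: perm_restr_outside)

lemma perm_restr_orbit:
  assumes "finite I" "\<sigma> permutes I" "x \<in> S"
  shows "perm_restr \<sigma> S x \<in> orbit \<sigma> x"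
  using first_hit_orbit[OF first_hit_perm_restr[OF assms]] .

text \<open>The walk from \<open>x\<close> to its first element of \<open>A\<close> visits \<open>B\<close> on its way, and from the first visit on it
  is traced by the restriction to \<open>B\<close>.  This yields transitivity of restriction.\<close>

lemma first_hit_via:
  assumes "finite I" "\<sigma> permutes I" "A \<subseteq> B" "first_hit \<sigma> A x y"
  shows "\<exists>z. first_hit \<sigma> B x z \<and> (z = y \<or> z \<notin> A \<and> first_hit (perm_restr \<sigma> B) A z y)"
  using assms(4)
proof induction
  case (hit x)
  then show ?case
    using assms(3) by (intro exI[of _ "\<sigma> x"]) (auto intro: first_hit.hit)
next
  case (skip x y)
  then obtain z where z: "first_hit \<sigma> B (\<sigma> x) z"
    "z = y \<or> z \<notin> A \<and> first_hit (perm_restr \<sigma> B) A z y"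
    by blast
  show ?case
  proof (cases "\<sigma> x \<in> B")
    case True
    have "perm_restr \<sigma> B (\<sigma> x) = z"
      using z(1) True assms by (intro perm_restr_eqI) auto
    moreover have "y \<in> A"
      using skip.hyps(2) by (rule first_hit_in)
    ultimately have "first_hit (perm_restr \<sigma> B) A (\<sigma> x) y"
      using z(2) first_hit.hit[of "perm_restr \<sigma> B" "\<sigma> x" A] first_hit.skip[of "perm_restr \<sigma> B" "\<sigma> x" A]
      by auto
    then show ?thesis
      using True skip.hyps(1) by (intro exI[of _ "\<sigma> x"]) (auto intro: first_hit.hit)
  next
    case False
    then show ?thesis
      using z by (intro exI[of _ z]) (auto intro: first_hit.skip)
  qed
qed

lemma perm_restr_perm_restr:
  assumes "finite I" "\<sigma> permutes I" "A \<subseteq> B" "finite B"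
  shows "perm_restr (perm_restr \<sigma> B) A = perm_restr \<sigma> A"
proof
  fix x
  show "perm_restr (perm_restr \<sigma> B) A x = perm_restr \<sigma> A x"
  proof (cases "x \<in> A")
    case True
    let ?y = "perm_restr \<sigma> A x"
    have fh: "first_hit \<sigma> A x ?y"
      using assms True by (intro first_hit_perm_restr)
    obtain z where z: "first_hit \<sigma> B x z" "z = ?y \<or> z \<notin> A \<and> first_hit (perm_restr \<sigma> B) A z ?y"
      using first_hit_via[OF assms(1-3) fh] by blast
    have "perm_restr \<sigma> B x = z"
      using z(1) True assms by (intro perm_restr_eqI) auto
    then have "first_hit (perm_restr \<sigma> B) A x ?y"
      using z(2) first_hit_in[OF fh] first_hit.hit[of "perm_restr \<sigma> B" x A]
        first_hit.skip[of "perm_restr \<sigma> B" x A] by auto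
    then show ?thesis
      using True assms perm_restr_permutes[OF assms(1,2,4)] by (intro perm_restr_eqI)
  qed (simp add: perm_restr_outside)
qed

text \<open>A walk that starts in an invariant set \<open>C\<close> stays there, so that it only sees the permutation on \<open>C\<close> and the
  part of \<open>X\<close> in \<open>C\<close>.\<close>

lemma first_hit_invariant:
  assumes "first_hit \<rho> X x y" "x \<in> C" "\<And>x. x \<in> C \<Longrightarrow> \<rho> x = \<rho>' x \<and> \<rho> x \<in> C"
  shows "first_hit \<rho>' (X \<inter> C) x y"
  using assms(1,2)
proof induction
  case (hit x)
  then show ?case
    using assms(3)[of x] first_hit.hit[of \<rho>' x "X \<inter> C"] by auto
next
  case (skip x y)
  then show ?case
    using assms(3)[of x] first_hit.skip[of \<rho>' x "X \<inter> C"] by auto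
qed

lemma perm_restr_invariant:
  assumes "finite I" "\<rho> permutes I" "finite I'" "\<rho>' permutes I'"
    and "\<And>x. x \<in> C \<Longrightarrow> \<rho> x = \<rho>' x \<and> \<rho> x \<in> C" and "x \<in> X" "x \<in> C"
  shows "perm_restr \<rho> X x = perm_restr \<rho>' (X \<inter> C) x"
proof (rule perm_restr_eqI[symmetric, OF assms(3,4)])
  show "first_hit \<rho>' (X \<inter> C) x (perm_restr \<rho> X x)"
    by (rule first_hit_invariant[OF first_hit_perm_restr[OF assms(1,2,6)] assms(7,5)])
qed (use assms(6,7) in auto)

lemma perm_union_permutes:
  assumes "\<alpha> permutes S" "\<beta> permutes T" "S \<inter> T = {}"
  shows "perm_union S \<alpha> \<beta> permutes (S \<union> T)"
proof -
  have "\<alpha> \<circ> \<beta> permutes (S \<union> T)"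
    using assms by (intro permutes_compose) (auto intro: permutes_subset)
  moreover have "perm_union S \<alpha> \<beta> x = (\<alpha> \<circ> \<beta>) x" for x
  proof (cases "x \<in> S")
    case True
    then have "\<beta> x = x"
      using assms by (intro permutes_not_in) auto
    then show ?thesis
      using True by (simp add: perm_union_def)
  next
    case False
    have "\<beta> x \<notin> S"
      using False assms permutes_in_image[OF assms(2), of x] permutes_not_in[OF assms(2), of x]
      by (cases "x \<in> T") auto
    then show ?thesis
      using False permutes_not_in[OF assms(1)] by (simp add: perm_union_def)
  qed
  then have "perm_union S \<alpha> \<beta> = \<alpha> \<circ> \<beta>"
    by (rule ext)
  ultimately show ?thesis
    by simp
qed


section \<open>The order on permutations\<close>

definition split_step :: "'a set \<Rightarrow> (('a \<Rightarrow> 'a) \<times> ('a \<Rightarrow> 'a)) set" where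
  "split_step I = {(perm_union S (perm_restr \<sigma> S) (perm_restr \<sigma> T), \<sigma>) | \<sigma> S T.
                \<sigma> permutes I \<and> S \<union> T = I \<and> S \<inter> T = {}}"

lemma perm_order_altdef: "perm_order I = {(\<tau>, \<sigma>). \<tau> permutes I \<and> \<sigma> permutes I \<and> (\<tau>, \<sigma>) \<in> (split_step I)\<^sup>*}"
  by (simp add: perm_order_def split_step_def)

lemma split_step_permutes:
  assumes "finite I" "(\<tau>, \<sigma>) \<in> split_step I"
  shows "\<tau> permutes I" "\<sigma> permutes I"
proof -
  obtain S T where *: "\<tau> = perm_union S (perm_restr \<sigma> S) (perm_restr \<sigma> T)" "\<sigma> permutes I" "S \<union> T = I" "S \<inter> T = {}"
    using assms(2) by (auto simp: split_step_def)
  have "finite S" "finite T"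
    using *(3) assms(1) by auto
  then show "\<tau> permutes I" "\<sigma> permutes I"
    using * perm_union_permutes[of "perm_restr \<sigma> S" S "perm_restr \<sigma> T" T]
      perm_restr_permutes[OF assms(1) *(2)] by auto
qed

lemma perm_orderI:
  assumes "finite I" "\<sigma> permutes I" "(\<tau>, \<sigma>) \<in> (split_step I)\<^sup>*"
  shows "(\<tau>, \<sigma>) \<in> perm_order I"
proof -
  have "\<tau> permutes I"
    using assms(3,2) by (induction rule: converse_rtrancl_induct) (auto dest: split_step_permutes[OF assms(1)])
  then show ?thesis
    using assms by (simp add: perm_order_altdef)
qed

lemma perm_order_refl: "\<sigma> permutes I \<Longrightarrow> (\<sigma>, \<sigma>) \<in> perm_order I"
  by (simp add: perm_order_altdef)

lemma perm_order_trans: "(\<rho>, \<sigma>) \<in> perm_order I \<Longrightarrow> (\<sigma>, \<tau>) \<in> perm_order I \<Longrightarrow> (\<rho>, \<tau>) \<in> perm_order I"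
  by (auto simp: perm_order_altdef)

lemma perm_order_permutes: "(\<tau>, \<sigma>) \<in> perm_order I \<Longrightarrow> \<tau> permutes I" "(\<tau>, \<sigma>) \<in> perm_order I \<Longrightarrow> \<sigma> permutes I"
  by (auto simp: perm_order_altdef)

lemma perm_order_split:
  assumes "finite I" "\<sigma> permutes I" "S \<union> T = I" "S \<inter> T = {}"
  shows "(perm_union S (perm_restr \<sigma> S) (perm_restr \<sigma> T), \<sigma>) \<in> perm_order I"
  using assms by (intro perm_orderI r_into_rtrancl) (auto simp: split_step_def)

text \<open>Induction along a chain of splittings, downwards from \<open>\<sigma>\<close>.\<close>

lemma perm_order_induct [consumes 2, case_names refl split]:
  assumes "finite I" "(\<tau>, \<sigma>) \<in> perm_order I"
    and "P \<sigma>"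
    and "\<And>\<rho> S T. (\<rho>, \<sigma>) \<in> perm_order I \<Longrightarrow> \<rho> permutes I \<Longrightarrow> S \<union> T = I \<Longrightarrow> S \<inter> T = {} \<Longrightarrow> P \<rho>
      \<Longrightarrow> P (perm_union S (perm_restr \<rho> S) (perm_restr \<rho> T))"
  shows "P \<tau>"
proof -
  have "(\<tau>, \<sigma>) \<in> (split_step I)\<^sup>*" and \<sigma>: "\<sigma> permutes I"
    using assms(2) by (auto simp: perm_order_altdef)
  then show ?thesis
  proof (induction rule: converse_rtrancl_induct)
    case (step \<tau> \<rho>)
    have "(\<rho>, \<sigma>) \<in> perm_order I"
      using perm_orderI[OF assms(1) \<sigma>] step.hyps by simp
    then show ?case
      using step assms(4)[of \<rho>] by (auto simp: split_step_def)
  qed (rule assms(3))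
qed

lemma orbit_subset_if_step_in_orbit:
  assumes "\<And>x. \<tau> x \<in> orbit \<rho> x"
  shows "orbit \<tau> x \<subseteq> orbit \<rho> x"
proof
  fix y assume "y \<in> orbit \<tau> x"
  then show "y \<in> orbit \<rho> x"
    by induction (use assms orbit_trans in fast)+
qed

lemma self_in_orbit: "finite I \<Longrightarrow> \<sigma> permutes I \<Longrightarrow> x \<in> orbit \<sigma> x"
  by (intro permutation_self_in_orbit) (auto simp: permutation_permutes)

lemma split_orbit:
  assumes "finite I" "\<rho> permutes I" "S \<union> T = I" "S \<inter> T = {}"
  shows "orbit (perm_union S (perm_restr \<rho> S) (perm_restr \<rho> T)) x \<subseteq> orbit \<rho> x"
proof (rule orbit_subset_if_step_in_orbit)
  fix x
  show "perm_union S (perm_restr \<rho> S) (perm_restr \<rho> T) x \<in> orbit \<rho> x"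
    using perm_restr_orbit[OF assms(1,2)] perm_restr_outside[of x T \<rho>] self_in_orbit[OF assms(1,2), of x]
    by (cases "x \<in> T") (auto simp: perm_union_def)
qed

lemma perm_order_orbit:
  assumes "finite I" "(\<tau>, \<sigma>) \<in> perm_order I"
  shows "orbit \<tau> x \<subseteq> orbit \<sigma> x"
  using assms
proof (induction rule: perm_order_induct)
  case (split \<rho> S T)
  then show ?case
    using split_orbit[OF assms(1) split(2-4), of x] by auto
qed auto

text \<open>The splitting preserves \<open>S\<close> and \<open>T\<close>.  If it keeps the orbits, then \<open>\<rho>\<close> preserves \<open>S\<close> and \<open>T\<close> as well, and
  the first return to \<open>S\<close> or \<open>T\<close> takes a single step.  So a proper splitting strictly refines the orbits, which
  is the reason for antisymmetry.\<close>

lemma split_same_orbits: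
  assumes "finite I" "\<rho> permutes I" "S \<union> T = I" "S \<inter> T = {}"
    and orb: "\<And>x. orbit \<rho> x \<subseteq> orbit (perm_union S (perm_restr \<rho> S) (perm_restr \<rho> T)) x"
  shows "perm_union S (perm_restr \<rho> S) (perm_restr \<rho> T) = \<rho>" (is "?\<tau> = \<rho>")
proof
  fix x
  have fin: "finite S" "finite T"
    using assms by auto
  have pS: "perm_restr \<rho> S permutes S" and pT: "perm_restr \<rho> T permutes T"
    using perm_restr_permutes[OF assms(1,2)] fin by auto
  have closedS: "orbit ?\<tau> x \<subseteq> S" if "x \<in> S" for x
  proof
    fix y assume "y \<in> orbit ?\<tau> x"
    then show "y \<in> S"
      by induction (use that permutes_in_image[OF pS] in \<open>auto simp: perm_union_def\<close>)
  qed
  have closedT: "orbit ?\<tau> x \<subseteq> T" if "x \<in> T" for x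
  proof
    fix y assume "y \<in> orbit ?\<tau> x"
    then show "y \<in> T"
      by induction (use that permutes_in_image[OF pT] assms(4) in \<open>auto simp: perm_union_def\<close>)
  qed
  have mem: "\<rho> x \<in> orbit ?\<tau> x"
    using orb[of x] orbit.base[of \<rho> x] by (rule subsetD)
  show "?\<tau> x = \<rho> x"
  proof (cases "x \<in> S")
    case True
    then have "\<rho> x \<in> S"
      using mem closedS by auto
    then show ?thesis
      using True perm_restr_step[OF assms(1,2)] by (simp add: perm_union_def)
  next
    case False
    show ?thesis
    proof (cases "x \<in> T")
      case True
      then have "\<rho> x \<in> T"
        using mem closedT by auto
      then show ?thesis
        using True False perm_restr_step[OF assms(1,2)] by (simp add: perm_union_def)
    next
      case False
      then show ?thesis
        using \<open>x \<notin> S\<close> assms(2,3) permutes_not_in[OF assms(2), of x]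
        by (auto simp: perm_union_def perm_restr_outside)
    qed
  qed
qed

lemma perm_order_same_orbits:
  assumes "finite I" "(\<tau>, \<sigma>) \<in> perm_order I" "\<And>x. orbit \<sigma> x \<subseteq> orbit \<tau> x"
  shows "\<tau> = \<sigma>"
proof -
  have "(\<forall>x. orbit \<sigma> x \<subseteq> orbit \<tau> x) \<longrightarrow> \<tau> = \<sigma>"
    using assms(1,2)
  proof (induction rule: perm_order_induct)
    case (split \<rho> S T)
    let ?\<tau> = "perm_union S (perm_restr \<rho> S) (perm_restr \<rho> T)"
    show ?case
    proof
      assume orb: "\<forall>x. orbit \<sigma> x \<subseteq> orbit ?\<tau> x"
      moreover have sub: "orbit ?\<tau> x \<subseteq> orbit \<rho> x" for x
        using split_orbit[OF assms(1) split(2-4)] .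
      ultimately have "\<rho> = \<sigma>"
        using split.IH by blast
      moreover have "?\<tau> = \<rho>"
        using split_same_orbits[OF assms(1) split(2-4)] orb \<open>\<rho> = \<sigma>\<close> by blast
      ultimately show "?\<tau> = \<sigma>"
        by simp
    qed
  qed auto
  then show ?thesis
    using assms(3) by blast
qed

lemma partial_order_on_perm_order:
  assumes "finite I"
  shows "partial_order_on {\<sigma>. \<sigma> permutes I} (perm_order I)"
proof -
  have "antisym (perm_order I)"
  proof (rule antisymI)
    fix \<sigma> \<tau> assume *: "(\<sigma>, \<tau>) \<in> perm_order I" "(\<tau>, \<sigma>) \<in> perm_order I"
    show "\<sigma> = \<tau>"
      using perm_order_same_orbits[OF assms *(1)] perm_order_orbit[OF assms *(2)] by blast
  qed
  moreover have "trans (perm_order I)"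
    by (rule transI) (rule perm_order_trans)
  moreover have "refl_on {\<sigma>. \<sigma> permutes I} (perm_order I)"
    by (auto simp: refl_on_def perm_order_refl)
  ultimately show ?thesis
    using perm_order_permutes by (auto simp: partial_order_on_def preorder_on_def)
qed


section \<open>Restriction and gluing are compatible with the order\<close>

text \<open>Restriction to \<open>B\<close> maps the splitting along \<open>S\<close> and \<open>T\<close> to the splitting along \<open>B \<inter> S\<close> and \<open>B \<inter> T\<close>.\<close>

lemma perm_order_restr:
  assumes "finite I" "(\<tau>, \<sigma>) \<in> perm_order I" "B \<subseteq> I"
  shows "(perm_restr \<tau> B, perm_restr \<sigma> B) \<in> perm_order B"
proof -
  have finB: "finite B"
    using assms finite_subset by auto
  have "\<sigma> permutes I"
    using assms(2) by (rule perm_order_permutes)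
  show ?thesis
    using assms(1,2)
  proof (induction rule: perm_order_induct)
    case refl
    show ?case
      using perm_restr_permutes[OF assms(1) \<open>\<sigma> permutes I\<close> finB] by (rule perm_order_refl)
  next
    case (split \<rho> S T)
    let ?\<tau> = "perm_union S (perm_restr \<rho> S) (perm_restr \<rho> T)"
    have fin: "finite S" "finite T"
      using split(3) assms(1) by auto
    have pS: "perm_restr \<rho> S permutes S" and pT: "perm_restr \<rho> T permutes T"
      using perm_restr_permutes[OF assms(1) split(2)] fin by auto
    have p\<tau>: "?\<tau> permutes I"
      using perm_union_permutes[OF pS pT split(4)] split(3) by simp
    have pB: "perm_restr \<rho> B permutes B"
      using perm_restr_permutes[OF assms(1) split(2) finB] .
    have eq: "perm_restr ?\<tau> B = perm_union (B \<inter> S) (perm_restr (perm_restr \<rho> B) (B \<inter> S))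
        (perm_restr (perm_restr \<rho> B) (B \<inter> T))"
    proof
      fix x
      have inS: "perm_restr ?\<tau> B x = perm_restr (perm_restr \<rho> S) (B \<inter> S) x" if "x \<in> B" "x \<in> S"
        by (rule perm_restr_invariant[OF assms(1) p\<tau> fin(1) pS])
          (use that permutes_in_image[OF pS] in \<open>auto simp: perm_union_def\<close>)
      have inT: "perm_restr ?\<tau> B x = perm_restr (perm_restr \<rho> T) (B \<inter> T) x" if "x \<in> B" "x \<in> T"
        by (rule perm_restr_invariant[OF assms(1) p\<tau> fin(2) pT])
          (use that permutes_in_image[OF pT] split(4) in \<open>auto simp: perm_union_def\<close>)
      show "perm_restr ?\<tau> B x = perm_union (B \<inter> S) (perm_restr (perm_restr \<rho> B) (B \<inter> S))
        (perm_restr (perm_restr \<rho> B) (B \<inter> T)) x"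
        using inS inT assms(3) split(3) fin finB perm_restr_perm_restr[OF assms(1) split(2)]
        by (cases "x \<in> B"; cases "x \<in> S") (auto simp: perm_union_def perm_restr_outside)
    qed
    have "(perm_restr ?\<tau> B, perm_restr \<rho> B) \<in> perm_order B"
      unfolding eq using split(3,4) assms(3) by (intro perm_order_split[OF finB pB]) auto
    then show ?case
      using split.IH by (rule perm_order_trans)
  qed
qed

lemma perm_union_commute:
  assumes "\<alpha> permutes S" "\<beta> permutes T" "S \<inter> T = {}"
  shows "perm_union S \<alpha> \<beta> = perm_union T \<beta> \<alpha>"
  using assms permutes_not_in[OF assms(1)] permutes_not_in[OF assms(2)]
  by (auto simp: perm_union_def fun_eq_iff)

text \<open>A splitting of the first part along \<open>S1\<close> and \<open>T1\<close> is the splitting of the whole along \<open>S1\<close> and \<open>T1 \<union> T\<close>.\<close>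

lemma perm_order_union_mono_left:
  assumes "finite S" "finite T" "S \<inter> T = {}" "(\<alpha>, \<alpha>') \<in> perm_order S" "\<beta> permutes T"
  shows "(perm_union S \<alpha> \<beta>, perm_union S \<alpha>' \<beta>) \<in> perm_order (S \<union> T)"
  using assms(1,4)
proof (induction rule: perm_order_induct)
  case refl
  show ?case
    using perm_union_permutes[OF perm_order_permutes(2)[OF assms(4)] assms(5,3)] by (rule perm_order_refl)
next
  case (split \<rho> S1 T1)
  let ?R = "perm_union S \<rho> \<beta>"
  have fin: "finite (S \<union> T)"
    using assms by simp
  have R: "?R permutes (S \<union> T)"
    using perm_union_permutes[OF split(2) assms(5,3)] .
  have eq: "perm_union S (perm_union S1 (perm_restr \<rho> S1) (perm_restr \<rho> T1)) \<beta>
      = perm_union S1 (perm_restr ?R S1) (perm_restr ?R (T1 \<union> T))"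
  proof
    fix x
    have inS: "perm_restr ?R X x = perm_restr \<rho> (X \<inter> S) x" if "x \<in> X" "x \<in> S" for X
      by (rule perm_restr_invariant[OF fin R assms(1) split(2)])
        (use that permutes_in_image[OF split(2)] in \<open>auto simp: perm_union_def\<close>)
    have inT: "perm_restr ?R (T1 \<union> T) x = \<beta> x" if "x \<in> T"
    proof -
      have "?R x = \<beta> x" "\<beta> x \<in> T"
        using that assms(3) permutes_in_image[OF assms(5)] by (auto simp: perm_union_def)
      then show ?thesis
        using that perm_restr_step[OF fin R, of x "T1 \<union> T"] by simp
    qed
    have sets: "S1 \<inter> S = S1" "(T1 \<union> T) \<inter> S = T1"
      using split(3,4) assms(3) by auto
    consider "x \<in> S1" | "x \<in> T1" | "x \<in> T" | "x \<notin> S1" "x \<notin> T1" "x \<notin> T"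
      by blast
    then show "perm_union S (perm_union S1 (perm_restr \<rho> S1) (perm_restr \<rho> T1)) \<beta> x
        = perm_union S1 (perm_restr ?R S1) (perm_restr ?R (T1 \<union> T)) x"
    proof cases
      case 1
      then show ?thesis
        using inS[of S1] split(3) sets by (auto simp: perm_union_def)
    next
      case 2
      then show ?thesis
        using inS[of "T1 \<union> T"] split(3,4) sets by (auto simp: perm_union_def)
    next
      case 3
      then show ?thesis
        using inT split(3,4) assms(3) by (auto simp: perm_union_def)
    next
      case 4
      then show ?thesis
        using split(3) permutes_not_in[OF assms(5)] by (auto simp: perm_union_def perm_restr_outside)
    qed
  qed
  have "(perm_union S (perm_union S1 (perm_restr \<rho> S1) (perm_restr \<rho> T1)) \<beta>, ?R)
      \<in> perm_order (S \<union> T)"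
    unfolding eq using split(3,4) assms(3) by (intro perm_order_split[OF fin R]) auto
  then show ?case
    using split.IH by (rule perm_order_trans)
qed

lemma perm_order_glue:
  assumes fin: "finite I" and \<sigma>: "\<sigma> permutes I" and I: "S \<union> T = I" "S \<inter> T = {}"
    and \<alpha>: "(\<alpha>, perm_restr \<sigma> S) \<in> perm_order S" and \<beta>: "(\<beta>, perm_restr \<sigma> T) \<in> perm_order T"
  shows "(perm_union S \<alpha> \<beta>, \<sigma>) \<in> perm_order I"
proof -
  have finS: "finite S" and finT: "finite T"
    using fin I by auto
  have "(perm_union S \<alpha> \<beta>, perm_union S (perm_restr \<sigma> S) \<beta>) \<in> perm_order I"
    using perm_order_union_mono_left[OF finS finT I(2) \<alpha> perm_order_permutes(1)[OF \<beta>]] I(1) by simp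
  moreover have "(perm_union T \<beta> (perm_restr \<sigma> S), perm_union T (perm_restr \<sigma> T) (perm_restr \<sigma> S))
      \<in> perm_order I"
    using perm_order_union_mono_left[OF finT finS _ \<beta> perm_order_permutes(2)[OF \<alpha>]] I
    by (simp add: Int_commute Un_commute)
  then have "(perm_union S (perm_restr \<sigma> S) \<beta>, perm_union S (perm_restr \<sigma> S) (perm_restr \<sigma> T))
      \<in> perm_order I"
    using perm_union_commute[OF perm_order_permutes(2)[OF \<alpha>] perm_order_permutes(1)[OF \<beta>] I(2)]
      perm_union_commute[OF perm_order_permutes(2)[OF \<alpha>] perm_order_permutes(2)[OF \<beta>] I(2)] by simp
  ultimately show ?thesis
    using perm_order_split[OF fin \<sigma> I] by (blast intro: perm_order_trans)
qed

lemma perm_restr_invariant_block: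
  assumes "finite I" "\<tau> permutes I" "\<tau> ` B \<subseteq> B"
  shows "perm_restr \<tau> B x = (if x \<in> B then \<tau> x else x)"
  using assms perm_restr_step[OF assms(1,2), of x B] by (auto simp: perm_restr_outside)

text \<open>The blocks are glued one after the other with \<open>perm_order_glue\<close>.\<close>

lemma perm_order_if_blockwise:
  assumes "finite P" "finite I" "partition_on I P" "\<sigma> permutes I" "\<tau> permutes I"
    and "\<And>B. B \<in> P \<Longrightarrow> \<tau> ` B \<subseteq> B"
    and "\<And>B. B \<in> P \<Longrightarrow> (perm_restr \<tau> B, perm_restr \<sigma> B) \<in> perm_order B"
  shows "(\<tau>, \<sigma>) \<in> perm_order I"
  using assms
proof (induction P arbitrary: I \<sigma> \<tau> rule: finite_induct)
  case empty
  then have "I = {}"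
    by (auto simp: partition_on_def)
  then have "\<tau> = \<sigma>"
    using empty by (simp add: permutes_empty)
  then show ?case
    using empty by (simp add: perm_order_refl)
next
  case (insert B P)
  let ?I = "I - B"
  have part: "partition_on ?I P" and B: "B \<subseteq> I"
    using insert.prems(2) insert.hyps(2)
    by (auto simp: partition_on_def disjoint_def)
  have fin: "finite ?I" "finite B"
    using insert.prems(1) B finite_subset by auto
  note sub = partition_onD1[OF part]
  have pres: "\<tau> ` ?I \<subseteq> ?I"
    using insert.prems(5) sub by auto
  have "(perm_restr \<tau> ?I, perm_restr \<sigma> ?I) \<in> perm_order ?I"
  proof (rule insert.IH[OF fin(1) part])
    show "perm_restr \<sigma> ?I permutes ?I" "perm_restr \<tau> ?I permutes ?I"
      using insert.prems fin by (auto intro: perm_restr_permutes)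
    fix C assume C: "C \<in> P"
    then have CI: "C \<subseteq> ?I"
      using sub by auto
    show "perm_restr \<tau> ?I ` C \<subseteq> C"
      using C CI insert.prems(5)[of C] pres
      by (auto simp: perm_restr_invariant_block[OF insert.prems(1,4)])
    show "(perm_restr (perm_restr \<tau> ?I) C, perm_restr (perm_restr \<sigma> ?I) C) \<in> perm_order C"
      using insert.prems(6)[of C] C CI fin insert.prems(1,3,4) by (simp add: perm_restr_perm_restr)
  qed
  then have "(perm_union B (perm_restr \<tau> B) (perm_restr \<tau> ?I), \<sigma>) \<in> perm_order I"
    using insert.prems B by (intro perm_order_glue) auto
  moreover have "perm_union B (perm_restr \<tau> B) (perm_restr \<tau> ?I) = \<tau>"
    using pres insert.prems(5)[of B] permutes_not_in[OF insert.prems(4)]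
    by (auto simp: fun_eq_iff perm_union_def perm_restr_invariant_block[OF insert.prems(1,4)])
  ultimately show ?case
    by simp
qed

lemma partition_on_block_unique:
  assumes "partition_on I P" "B \<in> P" "C \<in> P" "x \<in> B" "x \<in> C"
  shows "B = C"
  using partition_onD2[OF assms(1)] assms(2-5) by (auto simp: disjoint_def)

lemma glue_blocks:
  assumes "finite I" "partition_on I P" "\<And>B. B \<in> P \<Longrightarrow> f B permutes B"
  obtains \<tau> where "\<tau> permutes I" "\<And>B x. B \<in> P \<Longrightarrow> x \<in> B \<Longrightarrow> \<tau> x = f B x"
proof
  define \<tau> where "\<tau> x = (if x \<in> I then f (THE B. B \<in> P \<and> x \<in> B) x else x)" for x
  show on: "\<tau> x = f B x" if "B \<in> P" "x \<in> B" for B x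
  proof -
    have "(THE B. B \<in> P \<and> x \<in> B) = B"
      using that partition_on_block_unique[OF assms(2)] by (intro the_equality) auto
    moreover have "x \<in> I"
      using that partition_onD1[OF assms(2)] by auto
    ultimately show ?thesis
      by (simp add: \<tau>_def)
  qed
  have im: "\<tau> x \<in> B" if "B \<in> P" "x \<in> B" for B x
    using that on permutes_in_image[OF assms(3)[OF that(1)]] by simp
  have "inj_on \<tau> I"
  proof (rule inj_onI)
    fix x y assume xy: "x \<in> I" "y \<in> I" "\<tau> x = \<tau> y"
    obtain B C where BC: "B \<in> P" "x \<in> B" "C \<in> P" "y \<in> C"
      using xy partition_onD1[OF assms(2)] by auto
    then have "B = C"
      using im xy(3) partition_on_block_unique[OF assms(2), of B C "\<tau> x"] by force
    then show "x = y"
      using BC xy(3) on injD[OF permutes_inj[OF assms(3)[OF BC(1)]]] by force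
  qed
  moreover have "\<tau> ` I \<subseteq> I"
    using im partition_onD1[OF assms(2)] by blast
  ultimately have "bij_betw \<tau> I I"
    using assms(1) by (simp add: bij_betw_def endo_inj_surj)
  then show "\<tau> permutes I"
    by (rule bij_imp_permutes) (simp add: \<tau>_def)
qed

text \<open>An element below \<open>\<sigma>\<close> that preserves all blocks of \<open>P\<close> is an independent choice of elements below the
  restrictions of \<open>\<sigma>\<close>: monotonicity of restriction gives one direction and gluing the other.\<close>

lemma card_perm_order_blocks:
  assumes "finite I" "partition_on I P" "\<sigma> permutes I"
  shows "card {\<tau>. (\<tau>, \<sigma>) \<in> perm_order I \<and> (\<forall>B\<in>P. \<tau> ` B \<subseteq> B)}
       = (\<Prod>B\<in>P. card {\<tau>. (\<tau>, perm_restr \<sigma> B) \<in> perm_order B})"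
proof -
  let ?A = "{\<tau>. (\<tau>, \<sigma>) \<in> perm_order I \<and> (\<forall>B\<in>P. \<tau> ` B \<subseteq> B)}"
  let ?g = "\<lambda>\<tau>. \<lambda>B\<in>P. perm_restr \<tau> B"
  let ?X = "PiE P (\<lambda>B. {\<tau>. (\<tau>, perm_restr \<sigma> B) \<in> perm_order B})"
  have finP: "finite P"
    using assms(1,2) by (rule finite_elements)
  have sub: "B \<subseteq> I" if "B \<in> P" for B
    using that partition_onD1[OF assms(2)] by auto
  have "inj_on ?g ?A"
  proof (rule inj_onI, rule ext)
    fix \<tau> \<tau>' x assume \<tau>: "\<tau> \<in> ?A" "\<tau>' \<in> ?A" and eq: "?g \<tau> = ?g \<tau>'"
    have perm: "\<tau> permutes I" "\<tau>' permutes I"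
      using \<tau> perm_order_permutes by auto
    show "\<tau> x = \<tau>' x"
    proof (cases "x \<in> I")
      case True
      then obtain B where B: "B \<in> P" "x \<in> B"
        using partition_onD1[OF assms(2)] by auto
      have "perm_restr \<tau> B x = perm_restr \<tau>' B x"
        using fun_cong[OF eq, of B] B by simp
      then show ?thesis
        using B \<tau> by (simp add: perm_restr_invariant_block[OF assms(1) perm(1)]
            perm_restr_invariant_block[OF assms(1) perm(2)])
    next
      case False
      then show ?thesis
        using perm by (simp add: permutes_not_in)
    qed
  qed
  moreover have "?g ` ?A = ?X"
  proof (intro equalityI subsetI)
    fix f assume "f \<in> ?g ` ?A"
    then show "f \<in> ?X"
      using perm_order_restr[OF assms(1)] sub by auto
  next
    fix f assume f: "f \<in> ?X"
    then have perm: "f B permutes B" if "B \<in> P" for B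
      using that perm_order_permutes(1) by (auto simp: PiE_iff)
    obtain \<tau> where \<tau>: "\<tau> permutes I" "\<And>B x. B \<in> P \<Longrightarrow> x \<in> B \<Longrightarrow> \<tau> x = f B x"
      using glue_blocks[OF assms(1,2) perm] by blast
    have pres: "\<tau> ` B \<subseteq> B" if "B \<in> P" for B
      using \<tau>(2)[OF that] permutes_in_image[OF perm[OF that]] by auto
    have restr: "perm_restr \<tau> B = f B" if "B \<in> P" for B
      using \<tau>(2)[OF that] permutes_not_in[OF perm[OF that]]
      by (auto simp: fun_eq_iff perm_restr_invariant_block[OF assms(1) \<tau>(1) pres[OF that]])
    have "(\<tau>, \<sigma>) \<in> perm_order I"
      using f restr pres by (intro perm_order_if_blockwise[OF finP assms(1-3) \<tau>(1)]) (auto simp: PiE_iff)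
    moreover have "?g \<tau> = f"
    proof
      fix B show "?g \<tau> B = f B"
        using restr PiE_arb[OF f, of B] by auto
    qed
    ultimately show "f \<in> ?g ` ?A"
      using pres by (intro image_eqI[of _ _ \<tau>]) auto
  qed
  ultimately have "card ?A = card ?X"
    using card_image by fastforce
  then show ?thesis
    by (simp add: card_PiE[OF finP])
qed


section \<open>Orbit partitions\<close>

lemma partition_on_orbits:
  assumes "finite I" "\<sigma> permutes I"
  shows "partition_on I (orbit \<sigma> ` I)"
proof (rule partition_onI)
  show "\<Union> (orbit \<sigma> ` I) = I"
    using self_in_orbit[OF assms] permutes_orbit_subset[OF assms(2)] by blast
  show "{} \<notin> orbit \<sigma> ` I"
    using orbit_nonempty[of \<sigma>] by auto
  fix p q assume pq: "p \<in> orbit \<sigma> ` I" "q \<in> orbit \<sigma> ` I" "p \<noteq> q"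
  show "disjnt p q"
  proof (rule ccontr)
    assume "\<not> disjnt p q"
    then obtain z where "z \<in> p" "z \<in> q"
      by (auto simp: disjnt_def)
    then have "orbit \<sigma> z = p" "orbit \<sigma> z = q"
      using pq orbit_cyclic_eq3[OF cyclic_on_orbit[OF assms(2,1)]] by auto
    then show False
      using pq(3) by simp
  qed
qed

lemma preserves_blocks_iff_refines:
  assumes "finite I" "\<tau> permutes I" "partition_on I P"
  shows "(\<forall>B\<in>P. \<tau> ` B \<subseteq> B) \<longleftrightarrow> refines I (orbit \<tau> ` I) P"
proof
  assume pres: "\<forall>B\<in>P. \<tau> ` B \<subseteq> B"
  have "\<exists>B\<in>P. orbit \<tau> x \<subseteq> B" if x: "x \<in> I" for x
  proof -
    obtain B where B: "B \<in> P" "x \<in> B"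
      using x partition_onD1[OF assms(3)] by auto
    have "y \<in> B" if "y \<in> orbit \<tau> x" for y
      using that by induction (use B pres in blast)+
    then show ?thesis
      using B by blast
  qed
  then show "refines I (orbit \<tau> ` I) P"
    using partition_on_orbits[OF assms(1,2)] assms(3) by (auto simp: refines_def)
next
  assume ref: "refines I (orbit \<tau> ` I) P"
  show "\<forall>B\<in>P. \<tau> ` B \<subseteq> B"
  proof (intro ballI subsetI)
    fix B y assume "B \<in> P" "y \<in> \<tau> ` B"
    then obtain x where x: "x \<in> B" "y = \<tau> x"
      by auto
    have "x \<in> I"
      using \<open>B \<in> P\<close> x(1) partition_onD1[OF assms(3)] by auto
    then obtain C where C: "C \<in> P" "orbit \<tau> x \<subseteq> C"
      using ref by (auto simp: refines_def)
    have "x \<in> C" "y \<in> C"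
      using C(2) self_in_orbit[OF assms(1,2), of x] orbit.base[of \<tau> x] x by auto
    then show "y \<in> B"
      using partition_on_block_unique[OF assms(3) \<open>B \<in> P\<close> C(1) x(1)] by simp
  qed
qed

lemma ex_cyclic_permutation:
  assumes "finite B" "B \<noteq> {}"
  shows "\<exists>\<sigma>. \<sigma> permutes B \<and> (\<forall>x\<in>B. orbit \<sigma> x = B)"
  using assms
proof (induction rule: finite_ne_induct)
  case (singleton x)
  show ?case
    by (rule exI[of _ id]) (auto simp: permutes_id orbit_eq_singleton_iff)
next
  case (insert x F)
  then obtain \<sigma> where \<sigma>: "\<sigma> permutes F" "\<forall>x\<in>F. orbit \<sigma> x = F"
    by blast
  obtain b where b: "b \<in> F"
    using insert.hyps by auto
  let ?\<tau> = "\<sigma> \<circ> Transposition.transpose x b"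
  have perm: "?\<tau> permutes insert x F"
    using b \<sigma>(1) by (intro permutes_compose permutes_swap_id permutes_subset[OF \<sigma>(1)]) auto
  have x: "\<sigma> x = x" "x \<noteq> b"
    using \<sigma>(1) insert.hyps b by (auto simp: permutes_not_in)
  have "?\<tau> y \<in> orbit ?\<tau> y" for y
    by (rule orbit.base)
  \<comment> \<open>The new permutation follows \<open>\<sigma>\<close>, with a detour over \<open>x\<close> after \<open>b\<close>.\<close>
  have step: "\<sigma> y \<in> orbit ?\<tau> y" if "y \<in> F" for y
  proof (cases "y = b")
    case True
    have "?\<tau> b = x" "?\<tau> x = \<sigma> b"
      using x by auto
    then show ?thesis
      using True orbit.step[OF orbit.base, of ?\<tau> b] by simp
  next
    case False
    then have "?\<tau> y = \<sigma> y"
      using that insert.hyps by (auto simp: Transposition.transpose_def)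
    then show ?thesis
      using orbit.base[of ?\<tau> y] by simp
  qed
  have F: "F \<subseteq> orbit ?\<tau> b"
  proof
    fix y assume "y \<in> F"
    then have "y \<in> orbit \<sigma> b"
      using \<sigma>(2) b by blast
    then show "y \<in> orbit ?\<tau> b"
    proof induction
      case base
      then show ?case
        using step b by blast
    next
      case (step y)
      have "y \<in> F"
        using step.hyps \<sigma>(2) b by blast
      then show ?case
        using \<open>y \<in> F \<Longrightarrow> \<sigma> y \<in> orbit ?\<tau> y\<close> step.IH orbit_trans by fast
    qed
  qed
  moreover have "x \<in> orbit ?\<tau> b"
    using orbit.base[of ?\<tau> b] x by simp
  ultimately have "insert x F \<subseteq> orbit ?\<tau> b"
    by blast
  then have all: "orbit ?\<tau> b = insert x F"
    using permutes_orbit_subset[OF perm] b by blast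
  have "orbit ?\<tau> y = insert x F" if "y \<in> insert x F" for y
    using orbit_cyclic_eq3[OF cyclic_on_orbit[OF perm], of y b] insert.hyps that all by simp
  then show ?case
    using perm by blast
qed

text \<open>One glues a cycle on each block.  This makes Psi surjective, and it reduces statements about set partitions of
  the same type to permutations of the same cycle type.\<close>

lemma ex_permutation_with_orbits:
  assumes "finite I" "partition_on I P"
  shows "\<exists>\<sigma>. \<sigma> permutes I \<and> orbit \<sigma> ` I = P"
proof -
  have "\<exists>\<sigma>. \<sigma> permutes B \<and> (\<forall>x\<in>B. orbit \<sigma> x = B)" if "B \<in> P" for B
    using that assms partition_onD1[OF assms(2)] partition_onD3[OF assms(2)]
    by (intro ex_cyclic_permutation) (auto intro: finite_subset)
  then obtain f where f: "\<And>B. B \<in> P \<Longrightarrow> f B permutes B" "\<And>B x. B \<in> P \<Longrightarrow> x \<in> B \<Longrightarrow> orbit (f B) x = B"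
    by metis
  obtain \<sigma> where \<sigma>: "\<sigma> permutes I" "\<And>B x. B \<in> P \<Longrightarrow> x \<in> B \<Longrightarrow> \<sigma> x = f B x"
    using glue_blocks[OF assms f(1)] by blast
  have orb: "orbit \<sigma> x = B" if "B \<in> P" "x \<in> B" for B x
  proof -
    have "orbit (f B) x = orbit \<sigma> x"
      using that \<sigma>(2)[OF that(1)] permutes_in_image[OF f(1)[OF that(1)]] by (intro orbit_cong0[of x B]) auto
    then show ?thesis
      using f(2)[OF that] by simp
  qed
  have "orbit \<sigma> ` I = P"
  proof (intro equalityI subsetI)
    fix C assume "C \<in> orbit \<sigma> ` I"
    then obtain x B where "C = orbit \<sigma> x" "x \<in> B" "B \<in> P"
      using partition_onD1[OF assms(2)] by auto
    then show "C \<in> P"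
      using orb by simp
  next
    fix B assume B: "B \<in> P"
    then obtain x where "x \<in> B"
      using partition_onD3[OF assms(2)] by (metis ex_in_conv)
    then show "B \<in> orbit \<sigma> ` I"
      using B orb partition_onD1[OF assms(2)] by blast
  qed
  then show ?thesis
    using \<sigma>(1) by blast
qed


section \<open>Conjugation\<close>

lemma perm_act_apply: "bij \<pi> \<Longrightarrow> perm_act \<pi> \<sigma> (\<pi> x) = \<pi> (\<sigma> x)"
  by (simp add: perm_act_def bij_is_inj)

lemma perm_act_permutes:
  assumes "\<pi> permutes I" "\<sigma> permutes I"
  shows "perm_act \<pi> \<sigma> permutes I"
  unfolding perm_act_def using assms by (intro permutes_compose permutes_inv)

lemma perm_act_inv:
  assumes "bij \<pi>"
  shows "perm_act (inv \<pi>) (perm_act \<pi> \<sigma>) = \<sigma>" "perm_act \<pi> (perm_act (inv \<pi>) \<sigma>) = \<sigma>"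
  using assms by (auto simp: perm_act_def fun_eq_iff inv_inv_eq bij_is_inj bij_is_surj surj_f_inv_f)

lemma perm_act_comp:
  assumes "bij \<pi>" "bij \<pi>'"
  shows "perm_act (\<pi> \<circ> \<pi>') \<sigma> = perm_act \<pi> (perm_act \<pi>' \<sigma>)"
  using assms by (simp add: perm_act_def o_inv_distrib comp_assoc)

lemma perm_act_orbit:
  assumes "bij \<pi>" "x \<in> orbit \<sigma> x"
  shows "orbit (perm_act \<pi> \<sigma>) (\<pi> x) = \<pi> ` orbit \<sigma> x"
  using assms by (intro orbit_inverse[symmetric]) (auto simp: perm_act_apply)

lemma perm_act_orbits:
  assumes "finite I" "\<pi> permutes I" "\<sigma> permutes I"
  shows "orbit (perm_act \<pi> \<sigma>) ` I = (`) \<pi> ` (orbit \<sigma> ` I)"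
proof -
  have "orbit (perm_act \<pi> \<sigma>) ` (\<pi> ` I) = (`) \<pi> ` (orbit \<sigma> ` I)"
    unfolding image_image
    using perm_act_orbit[OF permutes_bij[OF assms(2)] self_in_orbit[OF assms(1,3)]]
    by (intro image_cong) auto
  then show ?thesis
    by (simp add: permutes_image[OF assms(2)])
qed

lemma perm_act_restr:
  assumes "finite I" "\<pi> permutes I" "\<sigma> permutes I" "S \<subseteq> I"
  shows "perm_restr (perm_act \<pi> \<sigma>) (\<pi> ` S) = perm_act \<pi> (perm_restr \<sigma> S)"
proof
  fix y
  have bij: "bij \<pi>"
    using assms(2) by (rule permutes_bij)
  then obtain x where y: "y = \<pi> x"
    by (metis bij_pointE)
  have mem: "\<pi> z \<in> \<pi> ` S \<longleftrightarrow> z \<in> S" for z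
    using bij by (auto dest: bij_is_inj injD)
  have fh: "first_hit (perm_act \<pi> \<sigma>) (\<pi> ` S) (\<pi> x) (\<pi> z)" if "first_hit \<sigma> S x z" for x z
    using that
  proof induction
    case (hit x)
    then show ?case
      using first_hit.hit[of "perm_act \<pi> \<sigma>" "\<pi> x" "\<pi> ` S"] by (simp add: perm_act_apply[OF bij] mem)
  next
    case (skip x z)
    then show ?case
      using first_hit.skip[of "perm_act \<pi> \<sigma>" "\<pi> x" "\<pi> ` S"] by (simp add: perm_act_apply[OF bij] mem)
  qed
  show "perm_restr (perm_act \<pi> \<sigma>) (\<pi> ` S) y = perm_act \<pi> (perm_restr \<sigma> S) y"
  proof (cases "x \<in> S")
    case True
    then show ?thesis
      unfolding y perm_act_apply[OF bij]
      using assms mem first_hit_perm_restr[OF assms(1,3) True]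
      by (intro perm_restr_eqI[OF assms(1) perm_act_permutes[OF assms(2,3)]] fh) auto
  next
    case False
    then show ?thesis
      unfolding y perm_act_apply[OF bij] by (simp add: perm_restr_outside mem)
  qed
qed

lemma perm_act_union:
  assumes "bij \<pi>"
  shows "perm_act \<pi> (perm_union S \<alpha> \<beta>) = perm_union (\<pi> ` S) (perm_act \<pi> \<alpha>) (perm_act \<pi> \<beta>)"
proof
  fix y
  obtain x where y: "y = \<pi> x"
    using assms by (metis bij_pointE)
  have "\<pi> x \<in> \<pi> ` S \<longleftrightarrow> x \<in> S"
    using assms by (auto dest: bij_is_inj injD)
  then show "perm_act \<pi> (perm_union S \<alpha> \<beta>) y = perm_union (\<pi> ` S) (perm_act \<pi> \<alpha>) (perm_act \<pi> \<beta>) y"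
    unfolding y using assms by (simp add: perm_act_apply perm_union_def)
qed

lemma perm_act_mono:
  assumes "finite I" "\<pi> permutes I" "(\<tau>, \<sigma>) \<in> perm_order I"
  shows "(perm_act \<pi> \<tau>, perm_act \<pi> \<sigma>) \<in> perm_order I"
  using assms(1,3)
proof (induction rule: perm_order_induct)
  case refl
  show ?case
    using perm_act_permutes[OF assms(2) perm_order_permutes(2)[OF assms(3)]] by (rule perm_order_refl)
next
  case (split \<rho> S T)
  have bij: "bij \<pi>"
    using assms(2) by (rule permutes_bij)
  have "\<pi> ` S \<union> \<pi> ` T = I" "\<pi> ` S \<inter> \<pi> ` T = {}"
    using split(3,4) permutes_image[OF assms(2)] bij_is_inj[OF bij]
    by (simp_all flip: image_Un image_Int)
  then have "(perm_union (\<pi> ` S) (perm_restr (perm_act \<pi> \<rho>) (\<pi> ` S)) (perm_restr (perm_act \<pi> \<rho>) (\<pi> ` T)),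
      perm_act \<pi> \<rho>) \<in> perm_order I"
    by (rule perm_order_split[OF assms(1) perm_act_permutes[OF assms(2) split(2)]])
  moreover have "S \<subseteq> I" "T \<subseteq> I"
    using split(3) by auto
  ultimately have "(perm_act \<pi> (perm_union S (perm_restr \<rho> S) (perm_restr \<rho> T)), perm_act \<pi> \<rho>) \<in> perm_order I"
    by (simp add: perm_act_union[OF bij] perm_act_restr[OF assms(1,2) split(2)])
  then show ?case
    using split.IH by (rule perm_order_trans)
qed

lemma perm_act_order_iff:
  assumes "finite I" "\<pi> permutes I"
  shows "(perm_act \<pi> \<tau>, perm_act \<pi> \<sigma>) \<in> perm_order I \<longleftrightarrow> (\<tau>, \<sigma>) \<in> perm_order I"
  using perm_act_mono[OF assms, of \<tau> \<sigma>]
    perm_act_mono[OF assms(1) permutes_inv[OF assms(2)], of "perm_act \<pi> \<tau>" "perm_act \<pi> \<sigma>"]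
  by (auto simp: perm_act_inv[OF permutes_bij[OF assms(2)]])

lemma perm_act_bij_betw:
  assumes "\<pi> permutes I"
  shows "bij_betw (perm_act \<pi>) {\<sigma>. \<sigma> permutes I} {\<sigma>. \<sigma> permutes I}"
  by (rule bij_betw_byWitness[where f' = "perm_act (inv \<pi>)"])
    (use assms perm_act_inv[OF permutes_bij[OF assms]] in \<open>auto intro: perm_act_permutes permutes_inv\<close>)


lemma ex_bij_betw_if_image_mset_eq:
  assumes "finite P" "finite Q" "image_mset f (mset_set P) = image_mset h (mset_set Q)"
  shows "\<exists>g. bij_betw g P Q \<and> (\<forall>x\<in>P. h (g x) = f x)"
  using assms
proof (induction P arbitrary: Q rule: finite_induct)
  case empty
  then have "Q = {}"
    by (simp add: mset_set_empty_iff)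
  then show ?case
    by (simp add: bij_betw_def)
next
  case (insert x P)
  have "f x \<in># image_mset h (mset_set Q)"
    unfolding insert.prems(2)[symmetric] using insert.hyps by simp
  then obtain y where y: "y \<in> Q" "h y = f x"
    using insert.prems(1) elem_mset_set[of Q] by auto
  have "mset_set Q = add_mset y (mset_set (Q - {y}))"
    using y(1) insert.prems(1) by (metis mset_set.remove)
  then have "image_mset f (mset_set P) = image_mset h (mset_set (Q - {y}))"
    using insert.prems(2) insert.hyps y(2) by simp
  then obtain g where g: "bij_betw g P (Q - {y})" "\<forall>x\<in>P. h (g x) = f x"
    using insert.IH[of "Q - {y}"] insert.prems(1) by auto
  let ?g = "g(x := y)"
  have "bij_betw ?g (insert x P) (insert y (Q - {y}))"
    using g(1) insert.hyps by (simp add: bij_betw_def inj_on_def image_def) (auto simp: fun_upd_def)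
  then show ?case
    using g(2) y insert.hyps
    by (intro exI[of _ ?g]) (metis fun_upd_apply insert_Diff insert_iff)
qed

lemma orbit_enumeration:
  assumes "x \<in> orbit f x"
  shows "bij_betw (\<lambda>i. (f ^^ i) x) {..<card (orbit f x)} (orbit f x)" "(f ^^ card (orbit f x)) x = x"
proof -
  let ?m = "funpow_dist1 f x x"
  have "inj_on (\<lambda>i. (f ^^ i) x) {0..<?m}"
    using assms by (rule inj_on_funpow_dist1)
  moreover have "(\<lambda>i. (f ^^ i) x) ` {0..<?m} = orbit f x"
    using orbit_conv_funpow_dist1[OF assms] by simp
  ultimately have bij: "bij_betw (\<lambda>i. (f ^^ i) x) {0..<?m} (orbit f x)"
    by (simp add: bij_betw_def)
  then have "card (orbit f x) = ?m"
    using bij_betw_same_card by fastforce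
  then show "bij_betw (\<lambda>i. (f ^^ i) x) {..<card (orbit f x)} (orbit f x)" "(f ^^ card (orbit f x)) x = x"
    using bij funpow_dist1_prop[OF assms] by (simp_all add: atLeast0LessThan)
qed

lemma ex_orbit_isomorphism:
  assumes "c \<in> orbit \<sigma> c" "d \<in> orbit \<tau> d" "card (orbit \<sigma> c) = card (orbit \<tau> d)"
  shows "\<exists>\<theta>. bij_betw \<theta> (orbit \<sigma> c) (orbit \<tau> d) \<and> (\<forall>x\<in>orbit \<sigma> c. \<theta> (\<sigma> x) = \<tau> (\<theta> x))"
proof -
  define m where "m = card (orbit \<sigma> c)"
  let ?s = "\<lambda>i. (\<sigma> ^^ i) c" and ?t = "\<lambda>i. (\<tau> ^^ i) d"
  have s: "bij_betw ?s {..<m} (orbit \<sigma> c)" "?s m = c"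
    using orbit_enumeration[OF assms(1)] by (simp_all add: m_def)
  have t: "bij_betw ?t {..<m} (orbit \<tau> d)" "?t m = d"
    using orbit_enumeration[OF assms(2)] by (simp_all add: m_def assms(3))
  let ?\<theta> = "?t \<circ> inv_into {..<m} ?s"
  have \<theta>: "?\<theta> (?s i) = ?t i" if "i < m" for i
    using s(1) that bij_betw_imp_inj_on[OF s(1)] by (simp add: inv_into_f_f[where f = ?s])
  have "?\<theta> (\<sigma> x) = \<tau> (?\<theta> x)" if "x \<in> orbit \<sigma> c" for x
  proof -
    have "x \<in> ?s ` {..<m}"
      unfolding bij_betw_imp_surj_on[OF s(1)] by (rule that)
    then obtain i where i: "i < m" "x = ?s i"
      by (elim imageE) simp
    show ?thesis
    proof (cases "Suc i = m")
      case True
      have "\<sigma> x = ?s (Suc i)" "\<tau> (?t i) = ?t (Suc i)"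
        using i(2) by simp_all
      then have "\<sigma> x = c" "\<tau> (?t i) = d"
        unfolding True using s(2) t(2) by simp_all
      then have "?\<theta> (\<sigma> x) = ?\<theta> (?s 0)"
        by simp
      also have "\<dots> = ?t 0"
        using i(1) by (intro \<theta>) simp
      also have "\<dots> = \<tau> (?t i)"
        using \<open>\<tau> (?t i) = d\<close> by simp
      finally show ?thesis
        using \<theta>[OF i(1)] i(2) by simp
    next
      case False
      then show ?thesis
        using \<theta>[of "Suc i"] \<theta>[of i] i by simp
    qed
  qed
  moreover have "bij_betw ?\<theta> (orbit \<sigma> c) (orbit \<tau> d)"
    using bij_betw_trans[OF bij_betw_inv_into[OF s(1)] t(1)] .
  ultimately show ?thesis
    by blast
qed

text \<open>The orbits of \<open>\<sigma>\<close> are matched with orbits of \<open>\<tau>\<close> of the same size, and matched orbits are identified by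
  running through both with the two permutations.\<close>

lemma conjugate_if_same_orbit_sizes:
  assumes "finite I" "\<sigma> permutes I" "\<tau> permutes I"
    and "image_mset card (mset_set (orbit \<sigma> ` I)) = image_mset card (mset_set (orbit \<tau> ` I))"
  shows "\<exists>\<pi>. \<pi> permutes I \<and> perm_act \<pi> \<sigma> = \<tau>"
proof -
  note self\<sigma> = self_in_orbit[OF assms(1,2)] and self\<tau> = self_in_orbit[OF assms(1,3)]
  have cyc\<sigma>: "orbit \<sigma> y = orbit \<sigma> x" if "y \<in> orbit \<sigma> x" for x y
    using orbit_cyclic_eq3[OF cyclic_on_orbit[OF assms(2,1)] that] .
  have cyc\<tau>: "orbit \<tau> y = orbit \<tau> x" if "y \<in> orbit \<tau> x" for x y
    using orbit_cyclic_eq3[OF cyclic_on_orbit[OF assms(3,1)] that] .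
  obtain g where g: "bij_betw g (orbit \<sigma> ` I) (orbit \<tau> ` I)" "\<And>C. C \<in> orbit \<sigma> ` I \<Longrightarrow> card (g C) = card C"
    using ex_bij_betw_if_image_mset_eq[OF _ _ assms(4)] assms(1) by blast
  have "\<exists>\<theta>. bij_betw \<theta> C (g C) \<and> (\<forall>x\<in>C. \<theta> (\<sigma> x) = \<tau> (\<theta> x))" if C: "C \<in> orbit \<sigma> ` I" for C
  proof -
    obtain c where c: "C = orbit \<sigma> c"
      using C by auto
    have "g C \<in> orbit \<tau> ` I"
      using g(1) C by (auto simp: bij_betw_def)
    then obtain d where d: "g C = orbit \<tau> d"
      by auto
    show ?thesis
      using ex_orbit_isomorphism[OF self\<sigma>[of c] self\<tau>[of d]] g(2)[OF C] c d by simp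
  qed
  then obtain \<theta> where \<theta>: "\<And>C. C \<in> orbit \<sigma> ` I \<Longrightarrow> bij_betw (\<theta> C) C (g C)"
    "\<And>C x. C \<in> orbit \<sigma> ` I \<Longrightarrow> x \<in> C \<Longrightarrow> \<theta> C (\<sigma> x) = \<tau> (\<theta> C x)"
    by metis
  define \<pi> where "\<pi> x = (if x \<in> I then \<theta> (orbit \<sigma> x) x else x)" for x
  have mem: "\<pi> x \<in> g (orbit \<sigma> x)" if "x \<in> I" for x
    using \<theta>(1)[of "orbit \<sigma> x"] self\<sigma>[of x] that by (auto simp: \<pi>_def bij_betw_def)
  have gI: "g (orbit \<sigma> x) \<in> orbit \<tau> ` I" if "x \<in> I" for x
    using g(1) that by (auto simp: bij_betw_def)
  have "inj_on \<pi> I"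
  proof (rule inj_onI)
    fix x y assume xy: "x \<in> I" "y \<in> I" "\<pi> x = \<pi> y"
    have "g (orbit \<sigma> x) = g (orbit \<sigma> y)"
      using partition_on_block_unique[OF partition_on_orbits[OF assms(1,3)] gI[OF xy(1)] gI[OF xy(2)] mem[OF xy(1)]]
        mem[OF xy(2)] xy(3) by simp
    then have same: "orbit \<sigma> x = orbit \<sigma> y"
      using g(1) xy by (auto simp: bij_betw_def inj_on_def)
    then have "\<theta> (orbit \<sigma> x) x = \<theta> (orbit \<sigma> x) y"
      using xy by (simp add: \<pi>_def)
    moreover have "inj_on (\<theta> (orbit \<sigma> x)) (orbit \<sigma> x)"
      using \<theta>(1)[of "orbit \<sigma> x"] xy by (auto simp: bij_betw_def)
    ultimately show "x = y"
      using self\<sigma>[of x] self\<sigma>[of y] same by (auto simp: inj_on_def)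
  qed
  moreover have "\<pi> ` I \<subseteq> I"
  proof
    fix y assume "y \<in> \<pi> ` I"
    then obtain x where x: "x \<in> I" "y = \<pi> x"
      by auto
    obtain d where "d \<in> I" "g (orbit \<sigma> x) = orbit \<tau> d"
      using gI[OF x(1)] by auto
    then show "y \<in> I"
      using mem[OF x(1)] x(2) permutes_orbit_subset[OF assms(3)] by auto
  qed
  ultimately have bij: "bij_betw \<pi> I I"
    using assms(1) by (simp add: bij_betw_def endo_inj_surj)
  then have \<pi>: "\<pi> permutes I"
    by (rule bij_imp_permutes) (simp add: \<pi>_def)
  have "perm_act \<pi> \<sigma> y = \<tau> y" for y
  proof (cases "y \<in> I")
    case True
    then obtain x where x: "x \<in> I" "y = \<pi> x"
      using bij by (auto simp: bij_betw_def)
    have "orbit \<sigma> (\<sigma> x) = orbit \<sigma> x"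
      by (rule cyc\<sigma>) (rule orbit.base)
    then have "\<pi> (\<sigma> x) = \<theta> (orbit \<sigma> x) (\<sigma> x)"
      using x(1) permutes_in_image[OF assms(2)] by (simp add: \<pi>_def)
    also have "\<dots> = \<tau> (\<pi> x)"
      using \<theta>(2)[of "orbit \<sigma> x" x] x(1) self\<sigma>[of x] by (simp add: \<pi>_def)
    finally show ?thesis
      using x(2) perm_act_apply[OF permutes_bij[OF \<pi>]] by simp
  next
    case False
    then show ?thesis
      using perm_act_permutes[OF \<pi> assms(2)] assms(3) by (simp add: permutes_not_in)
  qed
  then show ?thesis
    using \<pi> by blast
qed


section \<open>Set partitions\<close>

lemma finite_poset_setparts:
  assumes "finite I"
  shows "finite_poset {P. partition_on I P} (setpart_order I)"
proof
  show "finite {P. partition_on I P}"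
    using assms by (rule finitely_many_partition_on)
  show "partial_order_on {P. partition_on I P} (setpart_order I)"
    unfolding partial_order_on_def preorder_on_def
  proof (intro conjI transI antisymI)
    show "setpart_order I \<subseteq> {P. partition_on I P} \<times> {P. partition_on I P}"
      by (auto simp: setpart_order_def refines_def)
    show "refl_on {P. partition_on I P} (setpart_order I)"
      by (auto simp: refl_on_def setpart_order_def refines_refl)
  qed (use refines_trans refines_asym in \<open>unfold setpart_order_def, blast+\<close>)
qed

lemma finite_poset_perms:
  assumes "finite I"
  shows "finite_poset {\<sigma>. \<sigma> permutes I} (perm_order I)"
  using assms by (intro finite_poset.intro finite_permutations partial_order_on_perm_order)

lemma setpart_act_partition_on:
  assumes "\<pi> permutes I" "partition_on I P"
  shows "partition_on I (setpart_act \<pi> P)"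
proof -
  have "partition_on (\<pi> ` I) ((`) \<pi> ` P - {{}})"
    using assms by (intro partition_on_inj_image) (auto intro: permutes_inj_on)
  moreover have "{} \<notin> (`) \<pi> ` P"
    using partition_onD3[OF assms(2)] by auto
  ultimately show ?thesis
    by (simp add: setpart_act_def permutes_image[OF assms(1)])
qed

lemma setpart_act_inv:
  assumes "bij \<pi>"
  shows "setpart_act (inv \<pi>) (setpart_act \<pi> P) = P" "setpart_act \<pi> (setpart_act (inv \<pi>) P) = P"
  unfolding setpart_act_def image_comp
  using assms by (simp_all add: image_image bij_is_inj surj_f_inv_f[OF bij_is_surj])

lemma setpart_act_comp: "setpart_act (\<pi> \<circ> \<pi>') P = setpart_act \<pi> (setpart_act \<pi>' P)"
  by (simp add: setpart_act_def image_image image_comp)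

lemma setpart_act_bij_betw:
  assumes "\<pi> permutes I"
  shows "bij_betw (setpart_act \<pi>) {P. partition_on I P} {P. partition_on I P}"
  by (rule bij_betw_byWitness[where f' = "setpart_act (inv \<pi>)"])
    (use assms setpart_act_inv[OF permutes_bij[OF assms]] in
      \<open>auto intro: setpart_act_partition_on permutes_inv\<close>)

lemma setpart_act_mono:
  assumes "\<pi> permutes I" "(P, Q) \<in> setpart_order I"
  shows "(setpart_act \<pi> P, setpart_act \<pi> Q) \<in> setpart_order I"
proof -
  have "partition_on I (setpart_act \<pi> P)" "partition_on I (setpart_act \<pi> Q)"
    using assms by (auto simp: setpart_order_def refines_def intro: setpart_act_partition_on)
  then show ?thesis
    using assms(2) unfolding setpart_order_def refines_def setpart_act_def by (auto dest!: bspec intro!: image_mono)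
qed

lemma setpart_act_order_iff:
  assumes "\<pi> permutes I"
  shows "(setpart_act \<pi> P, setpart_act \<pi> Q) \<in> setpart_order I \<longleftrightarrow> (P, Q) \<in> setpart_order I"
  using setpart_act_mono[OF assms, of P Q]
    setpart_act_mono[OF permutes_inv[OF assms], of "setpart_act \<pi> P" "setpart_act \<pi> Q"]
  by (auto simp: setpart_act_inv[OF permutes_bij[OF assms]])

lemma perm_act_orbits_setpart:
  assumes "finite I" "\<pi> permutes I" "\<sigma> permutes I"
  shows "orbit (perm_act \<pi> \<sigma>) ` I = setpart_act \<pi> (orbit \<sigma> ` I)"
  using perm_act_orbits[OF assms] by (simp add: setpart_act_def)

lemma setpart_type_act:
  assumes "bij \<pi>"
  shows "setpart_type (setpart_act \<pi> P) = setpart_type P"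
proof -
  have inj: "inj ((`) \<pi>)"
    using bij_is_inj[OF assms] by (intro injI) (simp only: inj_image_eq_iff)
  have "image_mset card (mset_set (setpart_act \<pi> P)) = image_mset card (image_mset ((`) \<pi>) (mset_set P))"
    unfolding setpart_act_def by (subst image_mset_mset_set) (auto intro: inj_on_subset[OF inj])
  also have "\<dots> = image_mset card (mset_set P)"
    using card_image[OF inj_on_subset[OF bij_is_inj[OF assms] subset_UNIV]]
    by (simp add: multiset.map_comp comp_def)
  finally show ?thesis
    by (simp add: setpart_type_def)
qed

lemma mset_setpart_type: "mset (setpart_type P) = image_mset card (mset_set P)"
  by (simp add: setpart_type_def)

lemma setpart_type_eq_iff:
  "setpart_type P = setpart_type Q \<longleftrightarrow> image_mset card (mset_set P) = image_mset card (mset_set Q)"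
  by (metis mset_setpart_type setpart_type_def)


section \<open>The map Psi in p-coordinates\<close>

lemma (in finite_poset) p_coord_m_vec:
  assumes "Q \<in> A"
  shows "p_coord r (m_vec r P) Q = (if (P, Q) \<in> r then of_int (mobius r P Q) else 0 :: 'k::field)"
proof -
  have "p_coord r (m_vec r P) Q = (\<Sum>P' | (P, P') \<in> r. of_int (mobius r P P') * p_coord r (p_vec r P') Q :: 'k)"
    unfolding m_vec_def by (simp only: p_coord_sum p_coord_scale)
  also have "\<dots> = (\<Sum>P' | (P, P') \<in> r. if P' = Q then of_int (mobius r P Q) else 0)"
    using assms by (intro sum.cong refl) (auto simp: p_coord_p_vec dest: r_carrier)
  finally show ?thesis
    using finite_up by (simp add: sum.delta)
qed

lemma (in finite_poset) m_vec_support: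
  assumes "(m_vec r P a :: 'k::field) \<noteq> 0"
  shows "a \<in> A"
proof (rule ccontr)
  assume "a \<notin> A"
  then have "(m_vec r P a :: 'k) = 0"
    unfolding m_vec_def sum_apply using p_vec_support
    by (intro sum.neutral) (auto simp: fscale_def)
  then show False
    using assms by simp
qed

text \<open>The basis vector at \<open>\<sigma>\<close> is the sum of the p-basis vectors at all \<open>\<tau> \<preceq> \<sigma>\<close>, and zeta is 1 on each of them.\<close>

lemma zeta_indicator:
  fixes I :: "'a set"
  assumes "finite I" "\<sigma> permutes I"
  shows "(zeta I (indicator {\<sigma>}) :: 'k::field) = of_nat (card {\<tau>. (\<tau>, \<sigma>) \<in> perm_order I})"
proof -
  interpret perms: finite_poset "{\<sigma>. \<sigma> permutes I}" "perm_order I"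
    using assms(1) by (rule finite_poset_perms)
  interpret dual_family "{\<sigma>. \<sigma> permutes I}" "p_vec (perm_order I) :: _ \<Rightarrow> _ \<Rightarrow> 'k"
    "\<lambda>l x. p_coord (perm_order I) x l"
    by unfold_locales (simp_all only: p_coord_add p_coord_scale perms.p_coord_p_vec mem_Collect_eq)
  have vs: "vector_space ((*) :: 'k \<Rightarrow> 'k \<Rightarrow> 'k)"
    by unfold_locales (simp_all add: algebra_simps)
  let ?x = "indicator {\<sigma>} :: _ \<Rightarrow> 'k"
  have "?x = (\<Sum>l\<in>{\<sigma>. \<sigma> permutes I}. fscale (p_coord (perm_order I) ?x l) (p_vec (perm_order I) l))"
    using assms(2) by (intro perms.p_expansion) (auto simp: indicator_def split: if_splits)
  then have "zeta I ?x = (\<Sum>l\<in>{\<sigma>. \<sigma> permutes I}. p_coord (perm_order I) ?x l * 1)"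
    unfolding zeta_def by (rule linear_ext_sum[OF vs]) simp
  also have "\<dots> = (\<Sum>l\<in>{\<sigma>. \<sigma> permutes I}. if (l, \<sigma>) \<in> perm_order I then 1 else 0)"
    using perms.finite_up
    by (intro sum.cong refl) (simp add: p_coord_def indicator_def sum.delta if_distrib cong: if_cong)
  also have "\<dots> = of_nat (card {l \<in> {\<sigma>. \<sigma> permutes I}. (l, \<sigma>) \<in> perm_order I})"
    using perms.finite_carrier by (simp add: sum.inter_filter[symmetric])
  also have "{l \<in> {\<sigma>. \<sigma> permutes I}. (l, \<sigma>) \<in> perm_order I} = {\<tau>. (\<tau>, \<sigma>) \<in> perm_order I}"
    using perm_order_permutes by auto
  finally show ?thesis .
qed

lemma prod_zeta:
  assumes "finite I" "\<sigma> permutes I" "partition_on I P"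
  shows "(\<Prod>B\<in>P. zeta B (indicator {perm_restr \<sigma> B}))
       = (of_nat (card {\<tau>. (\<tau>, \<sigma>) \<in> perm_order I \<and> refines I (orbit \<tau> ` I) P}) :: 'k::field)"
proof -
  have fin: "finite B" if "B \<in> P" for B
    using that partition_onD1[OF assms(3)] assms(1) by (auto intro: finite_subset)
  have "(\<Prod>B\<in>P. zeta B (indicator {perm_restr \<sigma> B}))
      = (of_nat (\<Prod>B\<in>P. card {\<tau>. (\<tau>, perm_restr \<sigma> B) \<in> perm_order B}) :: 'k)"
    unfolding of_nat_prod
    by (intro prod.cong refl zeta_indicator perm_restr_permutes[OF assms(1,2)] fin)
  also have "(\<Prod>B\<in>P. card {\<tau>. (\<tau>, perm_restr \<sigma> B) \<in> perm_order B})
      = card {\<tau>. (\<tau>, \<sigma>) \<in> perm_order I \<and> (\<forall>B\<in>P. \<tau> ` B \<subseteq> B)}"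
    using card_perm_order_blocks[OF assms(1,3,2)] by simp
  also have "{\<tau>. (\<tau>, \<sigma>) \<in> perm_order I \<and> (\<forall>B\<in>P. \<tau> ` B \<subseteq> B)}
      = {\<tau>. (\<tau>, \<sigma>) \<in> perm_order I \<and> refines I (orbit \<tau> ` I) P}"
    using preserves_blocks_iff_refines[OF assms(1) perm_order_permutes(1) assms(3)] by blast
  finally show ?thesis .
qed

text \<open>In terms of p-bases, Psi maps the vector of a permutation to the vector of its orbit partition.  By
  \<open>prod_zeta\<close>, the coefficient of \<open>m\<^sub>P\<close> in the image of \<open>\<sigma>\<close> counts the elements below \<open>\<sigma>\<close> whose orbits refine
  \<open>P\<close>; the Moebius function in the definition of \<open>m\<^sub>P\<close> sifts out those whose orbit partition is \<open>Q\<close>.\<close>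

lemma p_coord_Psi:
  fixes x :: "('a \<Rightarrow> 'a) \<Rightarrow> 'k::field"
  assumes "finite I" "partition_on I Q"
  shows "p_coord (setpart_order I) (Psi I x) Q
       = (\<Sum>\<tau> | \<tau> permutes I \<and> orbit \<tau> ` I = Q. p_coord (perm_order I) x \<tau>)"
proof -
  interpret parts: finite_poset "{P. partition_on I P}" "setpart_order I"
    using assms(1) by (rule finite_poset_setparts)
  interpret perms: finite_poset "{\<sigma>. \<sigma> permutes I}" "perm_order I"
    using assms(1) by (rule finite_poset_perms)
  let ?r = "setpart_order I" and ?b = "\<lambda>\<sigma> R. {\<tau>. (\<tau>, \<sigma>) \<in> perm_order I \<and> orbit \<tau> ` I = R}"
  have coeff: "(\<Sum>P | partition_on I P. of_nat (card {\<tau>. (\<tau>, \<sigma>) \<in> perm_order I \<and> refines I (orbit \<tau> ` I) P})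
        * p_coord ?r (m_vec ?r P) Q) = (of_nat (card (?b \<sigma> Q)) :: 'k)" for \<sigma>
  proof -
    have fb: "finite (?b \<sigma> R)" for R
      by (rule finite_subset[OF _ perms.finite_down[of \<sigma>]]) auto
    have split: "card {\<tau>. (\<tau>, \<sigma>) \<in> perm_order I \<and> refines I (orbit \<tau> ` I) P}
        = (\<Sum>R | (R, P) \<in> ?r. card (?b \<sigma> R))" for P
    proof -
      have "{\<tau>. (\<tau>, \<sigma>) \<in> perm_order I \<and> refines I (orbit \<tau> ` I) P} = (\<Union>R\<in>{R. (R, P) \<in> ?r}. ?b \<sigma> R)"
        by (auto simp: setpart_order_def)
      also have "card \<dots> = (\<Sum>R | (R, P) \<in> ?r. card (?b \<sigma> R))"
        using parts.finite_down fb by (intro card_UN_disjoint) auto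
      finally show ?thesis .
    qed
    have "(\<Sum>P | partition_on I P. of_nat (card {\<tau>. (\<tau>, \<sigma>) \<in> perm_order I \<and> refines I (orbit \<tau> ` I) P})
          * p_coord ?r (m_vec ?r P) Q)
        = (\<Sum>P | (P, Q) \<in> ?r. \<Sum>R | (R, P) \<in> ?r. of_int (mobius ?r P Q) * of_nat (card (?b \<sigma> R)) :: 'k)"
    proof (rule sum.mono_neutral_cong_right[OF parts.finite_carrier])
      have coord: "p_coord ?r (m_vec ?r P) Q = (if (P, Q) \<in> ?r then of_int (mobius ?r P Q) else 0 :: 'k)" for P
        using assms(2) by (intro parts.p_coord_m_vec) simp
      show "\<forall>P\<in>{P. partition_on I P} - {P. (P, Q) \<in> ?r}.
          of_nat (card {\<tau>. (\<tau>, \<sigma>) \<in> perm_order I \<and> refines I (orbit \<tau> ` I) P}) * p_coord ?r (m_vec ?r P) Q = (0 :: 'k)"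
        by (simp add: coord)
      show "of_nat (card {\<tau>. (\<tau>, \<sigma>) \<in> perm_order I \<and> refines I (orbit \<tau> ` I) P}) * p_coord ?r (m_vec ?r P) Q
          = (\<Sum>R | (R, P) \<in> ?r. of_int (mobius ?r P Q) * of_nat (card (?b \<sigma> R)) :: 'k)"
        if "P \<in> {P. (P, Q) \<in> ?r}" for P
        using that unfolding split coord by (simp add: sum_distrib_left mult.commute)
    qed (use parts.r_carrier(1) in blast)
    also have "\<dots> = of_nat (card (?b \<sigma> Q))"
    proof (rule parts.sum_below_collapse)
      show "(\<Sum>P | (R, P) \<in> ?r \<and> (P, Q) \<in> ?r. of_int (mobius ?r P Q)) = (if R = Q then 1 else 0 :: 'k)"
        if "(R, Q) \<in> ?r" for R
        using arg_cong[OF parts.sum_mobius_below[OF that], of "of_int :: int \<Rightarrow> 'k"] by simp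
    qed (use assms(2) in simp)
    finally show ?thesis .
  qed
  have "p_coord ?r (Psi I x) Q = (\<Sum>\<sigma> | \<sigma> permutes I. x \<sigma> * (\<Sum>P | partition_on I P.
        (\<Prod>B\<in>P. zeta B (indicator {perm_restr \<sigma> B})) * p_coord ?r (m_vec ?r P) Q))"
    unfolding Psi_def by (simp only: p_coord_sum p_coord_scale)
  also have "\<dots> = (\<Sum>\<sigma> | \<sigma> permutes I. x \<sigma> * of_nat (card (?b \<sigma> Q)))"
  proof (rule sum.cong[OF refl])
    fix \<sigma> assume "\<sigma> \<in> {\<sigma>. \<sigma> permutes I}"
    then show "x \<sigma> * (\<Sum>P | partition_on I P.
        (\<Prod>B\<in>P. zeta B (indicator {perm_restr \<sigma> B})) * p_coord ?r (m_vec ?r P) Q)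
      = x \<sigma> * of_nat (card (?b \<sigma> Q))"
      unfolding coeff[symmetric] by (simp add: prod_zeta[OF assms(1)])
  qed
  also have "\<dots> = (\<Sum>\<sigma> | \<sigma> permutes I. \<Sum>\<tau> | \<tau> permutes I \<and> orbit \<tau> ` I = Q.
      if (\<tau>, \<sigma>) \<in> perm_order I then x \<sigma> else 0)"
  proof (rule sum.cong[OF refl])
    fix \<sigma> assume "\<sigma> \<in> {\<sigma>. \<sigma> permutes I}"
    have "?b \<sigma> Q = {\<tau> \<in> {\<tau>. \<tau> permutes I \<and> orbit \<tau> ` I = Q}. (\<tau>, \<sigma>) \<in> perm_order I}"
      using perm_order_permutes by auto
    moreover have "finite {\<tau>. \<tau> permutes I \<and> orbit \<tau> ` I = Q}"
      by (rule finite_subset[OF _ perms.finite_carrier]) auto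
    ultimately show "x \<sigma> * of_nat (card (?b \<sigma> Q)) = (\<Sum>\<tau> | \<tau> permutes I \<and> orbit \<tau> ` I = Q.
      if (\<tau>, \<sigma>) \<in> perm_order I then x \<sigma> else 0)"
      by (simp add: sum.inter_filter[symmetric] mult.commute)
  qed
  also have "\<dots> = (\<Sum>\<tau> | \<tau> permutes I \<and> orbit \<tau> ` I = Q. \<Sum>\<sigma> | \<sigma> permutes I.
      if (\<tau>, \<sigma>) \<in> perm_order I then x \<sigma> else 0)"
    by (rule sum.swap)
  also have "\<dots> = (\<Sum>\<tau> | \<tau> permutes I \<and> orbit \<tau> ` I = Q. p_coord (perm_order I) x \<tau>)"
  proof (rule sum.cong[OF refl])
    fix \<tau>
    have "{\<sigma> \<in> {\<sigma>. \<sigma> permutes I}. (\<tau>, \<sigma>) \<in> perm_order I} = {\<sigma>. (\<tau>, \<sigma>) \<in> perm_order I}"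
      using perm_order_permutes(2) by auto
    then show "(\<Sum>\<sigma> | \<sigma> permutes I. if (\<tau>, \<sigma>) \<in> perm_order I then x \<sigma> else 0)
        = p_coord (perm_order I) x \<tau>"
      unfolding p_coord_def sum.inter_filter[OF perms.finite_carrier, symmetric] by simp
  qed
  finally show ?thesis .
qed

lemma Psi_support:
  assumes "finite I" "Psi I x P \<noteq> 0"
  shows "partition_on I P"
proof (rule ccontr)
  interpret parts: finite_poset "{P. partition_on I P}" "setpart_order I"
    using assms(1) by (rule finite_poset_setparts)
  assume "\<not> partition_on I P"
  then have "m_vec (setpart_order I) R P = (0 :: 'b)" for R
    using parts.m_vec_support[of R P] by auto
  then have "Psi I x P = 0"
    unfolding Psi_def sum_apply fscale_def by (simp add: sum_apply)
  then show False
    using assms(2) by simp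
qed

interpretation Pi: graded_poset_action setparts "\<lambda>n. setpart_order {1..n}" setpart_act
proof
  fix n
  interpret parts: finite_poset "setparts n" "setpart_order {1..n}"
    unfolding setparts_def by (rule finite_poset_setparts) simp
  show "finite (setparts n)" "partial_order_on (setparts n) (setpart_order {1..n})"
    by (rule parts.finite_carrier parts.order)+
next
  fix \<sigma> :: "nat \<Rightarrow> nat" and n a b assume \<sigma>: "\<sigma> permutes {1..n}"
  show "bij_betw (setpart_act \<sigma>) (setparts n) (setparts n)"
    unfolding setparts_def using \<sigma> by (rule setpart_act_bij_betw)
  show "(setpart_act \<sigma> a, setpart_act \<sigma> b) \<in> setpart_order {1..n} \<longleftrightarrow> (a, b) \<in> setpart_order {1..n}"
    using \<sigma> by (rule setpart_act_order_iff)
qed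

interpretation S: graded_poset_action perms "\<lambda>n. perm_order {1..n}" perm_act
proof
  fix n
  interpret perms: finite_poset "perms n" "perm_order {1..n}"
    unfolding perms_def by (rule finite_poset_perms) simp
  show "finite (perms n)" "partial_order_on (perms n) (perm_order {1..n})"
    by (rule perms.finite_carrier perms.order)+
next
  fix \<sigma> :: "nat \<Rightarrow> nat" and n a b assume \<sigma>: "\<sigma> permutes {1..n}"
  show "bij_betw (perm_act \<sigma>) (perms n) (perms n)"
    unfolding perms_def using \<sigma> by (rule perm_act_bij_betw)
  show "(perm_act \<sigma> a, perm_act \<sigma> b) \<in> perm_order {1..n} \<longleftrightarrow> (a, b) \<in> perm_order {1..n}"
    using \<sigma> by (intro perm_act_order_iff) auto
qed

abbreviation coord_Pi :: "nat \<times> nat set set \<Rightarrow> (nat \<times> nat set set \<Rightarrow> 'k::field) \<Rightarrow> 'k" where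
  "coord_Pi \<equiv> graded_coord (\<lambda>n. setpart_order {1..n})"

abbreviation coord_S :: "nat \<times> (nat \<Rightarrow> nat) \<Rightarrow> (nat \<times> (nat \<Rightarrow> nat) \<Rightarrow> 'k::field) \<Rightarrow> 'k" where
  "coord_S \<equiv> graded_coord (\<lambda>n. perm_order {1..n})"

lemma curry_K_Psi: "curry (K_Psi x) n = Psi {1..n} (curry x n)"
  by (simp add: K_Psi_def fun_eq_iff)

lemma coord_K_Psi:
  assumes "Q \<in> setparts n"
  shows "coord_Pi (n, Q) (K_Psi x) = (\<Sum>\<tau> | \<tau> \<in> perms n \<and> orbit \<tau> ` {1..n} = Q. coord_S (n, \<tau>) x)"
  using p_coord_Psi[of "{1..n}" Q "curry x n"] assms
  by (simp add: graded_coord_def curry_K_Psi setparts_def perms_def del: curry_conv)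

lemma K_Psi_graded_space:
  assumes "x \<in> graded_space perms"
  shows "K_Psi x \<in> graded_space setparts"
proof -
  define N where "N = fst ` {j. x j \<noteq> 0}"
  have "K_Psi x (n, P) = 0" if "n \<notin> N" for n P
  proof -
    have "x (n, \<sigma>) = 0" for \<sigma>
      using that image_eqI[of n fst "(n, \<sigma>)" "{j. x j \<noteq> 0}"] by (auto simp: N_def)
    then have "Psi {1..n} (curry x n) P = 0"
      by (simp add: Psi_def sum_apply fscale_def)
    then show ?thesis
      by (simp add: K_Psi_def)
  qed
  moreover have part: "P \<in> setparts n" if "K_Psi x (n, P) \<noteq> 0" for n P
    using that Psi_support[of "{1..n}" "curry x n" P] by (simp add: K_Psi_def setparts_def)
  ultimately have "{j. K_Psi x j \<noteq> 0} \<subseteq> (SIGMA n:N. setparts n)"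
    by auto
  moreover have "finite (SIGMA n:N. setparts n)"
    using assms Pi.deg.finite_carrier by (auto simp: N_def graded_space_def)
  ultimately have "finite {j. K_Psi x j \<noteq> 0}"
    by (rule finite_subset)
  then show ?thesis
    using part by (auto simp: graded_space_def)
qed


section \<open>Words and multisets\<close>

text \<open>For a word with entries \<open>M\<close>, this is the number of permutations of its positions that fix the word.\<close>

definition mult_fact :: "'a multiset \<Rightarrow> nat" where
  "mult_fact M = (\<Prod>x\<in>set_mset M. fact (count M x))"

lemma mult_fact_superset:
  assumes "finite X" "set_mset M \<subseteq> X"
  shows "mult_fact M = (\<Prod>x\<in>X. fact (count M x))"
  unfolding mult_fact_def using assms by (intro prod.mono_neutral_left) (auto simp: not_in_iff)

lemma mult_fact_empty [simp]: "mult_fact {#} = 1"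
  by (simp add: mult_fact_def)

lemma mult_fact_add_mset: "mult_fact (add_mset x M) = Suc (count M x) * mult_fact M"
proof -
  let ?X = "insert x (set_mset M)"
  have "mult_fact (add_mset x M) = (\<Prod>y\<in>?X. fact (count (add_mset x M) y))"
    by (rule mult_fact_superset) auto
  also have "\<dots> = fact (Suc (count M x)) * (\<Prod>y\<in>?X - {x}. fact (count M y))"
    by (subst prod.remove[of _ x]) (auto intro!: prod.cong split: if_splits)
  also have "\<dots> = Suc (count M x) * (\<Prod>y\<in>?X. fact (count M y))"
    by (subst (2) prod.remove[of _ x]) (auto simp: algebra_simps)
  also have "(\<Prod>y\<in>?X. fact (count M y)) = mult_fact M"
    by (rule mult_fact_superset[symmetric]) auto
  finally show ?thesis .
qed

lemma mult_fact_pos: "mult_fact M > 0"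
  by (simp add: mult_fact_def prod_pos)

lemma mult_fact_image_inj: "inj f \<Longrightarrow> mult_fact (image_mset f M) = mult_fact M"
proof (induction M)
  case (add x M)
  have "count (image_mset f M) (f x) = count M x"
    using add.prems by (induction M) (auto dest: injD)
  then show ?case
    using add by (simp add: mult_fact_add_mset)
qed simp

text \<open>If \<open>w\<close> gives the letter at each position, this is the commutative image of the subword at the positions
  in \<open>B\<close>.\<close>

abbreviation content :: "('b \<Rightarrow> 'a) \<Rightarrow> 'b set \<Rightarrow> 'a multiset" where
  "content w B \<equiv> image_mset w (mset_set B)"

lemma content_insert: "finite B \<Longrightarrow> b \<notin> B \<Longrightarrow> content w (insert b B) = add_mset (w b) (content w B)"
  by simp

lemma content_mono: "finite S \<Longrightarrow> T \<subseteq> S \<Longrightarrow> content w T \<subseteq># content w S"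
  by (intro image_mset_subseteq_mono) (simp add: subset_imp_msubset_mset_set)

lemma content_Diff: "finite S \<Longrightarrow> T \<subseteq> S \<Longrightarrow> content w (S - T) = content w S - content w T"
  by (simp add: mset_set_Diff image_mset_Diff subset_imp_msubset_mset_set)

text \<open>For every letter one chooses which of its positions belong to \<open>T\<close>, so that the number of subsets is a product
  of binomial coefficients, stated here without division.\<close>

lemma card_subsets_with_content:
  assumes "finite S" "A \<subseteq># content w S"
  shows "card {T. T \<subseteq> S \<and> content w T = A} * (mult_fact A * mult_fact (content w S - A))
       = mult_fact (content w S)"
  using assms
proof (induction S arbitrary: A rule: finite_induct)
  case empty
  have "{T. T \<subseteq> {} \<and> content w T = A} = {{}}"
    using empty by auto
  then show ?case
    using empty by simp
next
  case (insert s S)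
  let ?a = "w s" and ?M = "content w S"
  let ?X = "\<lambda>A. {T. T \<subseteq> S \<and> content w T = A}"
  have M: "content w (insert s S) = add_mset ?a ?M"
    using insert.hyps by simp
  have fin: "finite T" if "T \<subseteq> S" for T
    using that insert.hyps finite_subset by auto
  have cont: "content w (insert s T) = add_mset ?a (content w T)" if "T \<subseteq> S" for T
    using that insert.hyps fin by (intro content_insert) auto
  have finX: "finite (?X A)" for A
    using insert.hyps by (intro finite_subset[of "?X A" "Pow S"]) auto
  have "{T. T \<subseteq> insert s S \<and> content w T = A} = ?X A \<union> insert s ` {T. T \<subseteq> S \<and> add_mset ?a (content w T) = A}"
  proof (intro equalityI subsetI)
    fix T assume T: "T \<in> {T. T \<subseteq> insert s S \<and> content w T = A}"
    show "T \<in> ?X A \<union> insert s ` {T. T \<subseteq> S \<and> add_mset ?a (content w T) = A}"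
    proof (cases "s \<in> T")
      case True
      then have "T = insert s (T - {s})" "T - {s} \<subseteq> S"
        using T by auto
      then show ?thesis
        using T cont[of "T - {s}"] by (intro UnI2 image_eqI[of _ _ "T - {s}"]) auto
    qed (use T in auto)
  qed (use cont in auto)
  moreover have "inj_on (insert s) {T. T \<subseteq> S \<and> add_mset ?a (content w T) = A}"
    using insert.hyps by (intro inj_onI) (auto dest: insert_ident[THEN iffD1, rotated -1])
  moreover have "finite {T. T \<subseteq> S \<and> add_mset ?a (content w T) = A}"
    by (rule finite_subset[of _ "Pow S"]) (use insert.hyps in auto)
  moreover have "?X A \<inter> insert s ` {T. T \<subseteq> S \<and> add_mset ?a (content w T) = A} = {}"
    using insert.hyps by auto
  ultimately have card: "card {T. T \<subseteq> insert s S \<and> content w T = A}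
      = card (?X A) + card {T. T \<subseteq> S \<and> add_mset ?a (content w T) = A}"
    using finX by (simp add: card_Un_disjoint card_image)
  show ?case
  proof (cases "?a \<in># A")
    case False
    then have A: "A \<subseteq># ?M"
      using insert.prems insert.hyps
      by (simp add: subset_eq_diff_conv) (metis diff_single_trivial subset_eq_diff_conv add_mset_add_single)
    have "{T. T \<subseteq> S \<and> add_mset ?a (content w T) = A} = {}"
      using False by auto
    then have "card {T. T \<subseteq> insert s S \<and> content w T = A} = card (?X A)"
      unfolding card by (simp only: card.empty add_0_right)
    moreover have "add_mset ?a ?M - A = add_mset ?a (?M - A)"
      using False by (rule diff_add_mset_swap)
    moreover have "count (?M - A) ?a = count ?M ?a"
      using False by (simp add: not_in_iff)
    ultimately show ?thesis
      using insert.IH[OF A] unfolding M by (simp add: mult_fact_add_mset algebra_simps)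
  next
    case True
    then obtain A' where A': "A = add_mset ?a A'"
      by (meson mset_add)
    have sub: "A' \<subseteq># ?M"
      using insert.prems unfolding M A' by simp
    have "{T. T \<subseteq> S \<and> add_mset ?a (content w T) = A} = ?X A'"
      by (auto simp: A')
    then have card: "card {T. T \<subseteq> insert s S \<and> content w T = A} = card (?X A) + card (?X A')"
      unfolding card by simp
    have IH': "card (?X A') * (mult_fact A' * mult_fact (?M - A')) = mult_fact ?M"
      using insert.IH[OF sub] .
    have diff: "add_mset ?a ?M - A = ?M - A'"
      by (simp add: A')
    have part': "card (?X A') * (mult_fact A * mult_fact (?M - A')) = Suc (count A' ?a) * mult_fact ?M"
      unfolding IH'[symmetric] A' mult_fact_add_mset by (simp only: mult.assoc mult.left_commute)
    show ?thesis
    proof (cases "A \<subseteq># ?M")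
      case A: True
      have eq: "?M - A' = add_mset ?a (?M - A)"
      proof -
        obtain D where "?M = A + D"
          using A by (auto simp: mset_subset_eq_exists_conv)
        then show ?thesis
          by (simp add: A')
      qed
      have "card (?X A) * (mult_fact A * mult_fact (?M - A')) = Suc (count (?M - A) ?a) * mult_fact ?M"
        unfolding insert.IH[OF A, symmetric] eq mult_fact_add_mset by (simp only: mult.assoc mult.left_commute)
      moreover have "Suc (count (?M - A) ?a) + Suc (count A' ?a) = Suc (count ?M ?a)"
        using mset_subset_eq_count[OF A, of ?a] by (simp add: A')
      ultimately show ?thesis
        unfolding M card diff mult_fact_add_mset add_mult_distrib part' by (metis add_mult_distrib)
    next
      case nA: False
      then have "?X A = {}"
        using content_mono[OF insert.hyps(1)] by auto
      then have "card (?X A) = 0"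
        by (simp only: card.empty)
      moreover have "count A' ?a = count ?M ?a"
      proof (rule ccontr)
        assume "count A' ?a \<noteq> count ?M ?a"
        then have "count A' ?a < count ?M ?a"
          using mset_subset_eq_count[OF sub, of ?a] by simp
        then have "A \<subseteq># ?M"
          using sub by (auto simp: A' subseteq_mset_def)
        then show False
          using nA by simp
      qed
      ultimately show ?thesis
        unfolding M card diff mult_fact_add_mset using part' by simp
    qed
  qed
qed


lemma subset_of_content:
  assumes "finite S" "A \<subseteq># content w S"
  shows "A \<in> content w ` Pow S"
proof -
  have "card {T. T \<subseteq> S \<and> content w T = A} \<noteq> 0"
    using card_subsets_with_content[OF assms] mult_fact_pos[of "content w S"] by (metis mult_0 less_irrefl)
  then have "{T. T \<subseteq> S \<and> content w T = A} \<noteq> {}"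
    by (metis card.empty)
  then show ?thesis
    by auto
qed


section \<open>Products of symmetric functions and set partitions\<close>

text \<open>A block \<open>T\<close> of size \<open>k\<close> together with a partition of the other elements amounts to a partition of \<open>S\<close> with a
  marked block of size \<open>k\<close>, and \<open>Suc (count L k)\<close> blocks can be marked.  Iterating this produces the factor
  \<open>mult_fact\<close> of the multiset of block sizes.\<close>

lemma sum_partitions_with_block:
  fixes F :: "'a set \<Rightarrow> 'k::comm_semiring_1"
  assumes "finite S" "0 < k"
  shows "(\<Sum>T | T \<subseteq> S \<and> card T = k. F T *
        (\<Sum>P | partition_on (S - T) P \<and> image_mset card (mset_set P) = L. \<Prod>B\<in>P. F B))
      = of_nat (Suc (count L k)) *
        (\<Sum>P | partition_on S P \<and> image_mset card (mset_set P) = add_mset k L. \<Prod>B\<in>P. F B)"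
proof -
  let ?A = "{T. T \<subseteq> S \<and> card T = k}"
  let ?Q = "\<lambda>S L. {P. partition_on S P \<and> image_mset card (mset_set P) = L}"
  have finQ: "finite (?Q X L)" if "X \<subseteq> S" for X L
    by (rule finite_subset[OF _ finitely_many_partition_on[of X]]) (use that assms finite_subset in auto)
  have finP: "finite P" if "partition_on X P" "X \<subseteq> S" for X P
    using that assms(1) finite_elements finite_subset by metis
  have disj: "T \<notin> P" if "T \<subseteq> S" "card T = k" "partition_on (S - T) P" for T P
  proof
    assume "T \<in> P"
    then have "T \<subseteq> S - T"
      using partition_onD1[OF that(3)] by auto
    then show False
      using that(2) assms(2) by (cases "T = {}") auto
  qed
  have insert_block: "insert T P \<in> ?Q S (add_mset k L) \<and> insert T P - {T} = P"
    if T: "T \<subseteq> S" "card T = k" and P: "P \<in> ?Q (S - T) L" for T P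
  proof -
    have part: "partition_on (S - T) P" and new: "T \<notin> P"
      using P disj[OF T] by auto
    have "partition_on S (insert T P)"
      using T assms(2) part partition_onD1[OF part]
      by (subst partition_on_insert) (auto simp: disjnt_def)
    moreover have "image_mset card (mset_set (insert T P)) = add_mset k L"
      using finP[OF part] new T P by simp
    ultimately show ?thesis
      using new by auto
  qed
  have remove_block: "T \<subseteq> S \<and> P - {T} \<in> ?Q (S - T) L"
    if P: "P \<in> ?Q S (add_mset k L)" and T: "T \<in> P" "card T = k" for P T
  proof -
    have part: "partition_on S P" and type: "image_mset card (mset_set P) = add_mset k L"
      using P by auto
    have ins: "insert T (P - {T}) = P"
      using T by auto
    have "disjnt T (\<Union>(P - {T}))"
      using partition_onD2[OF part] T(1) by (auto simp: disjoint_def disjnt_def)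
    then have "partition_on (S - T) (P - {T})" "T \<subseteq> S"
      using partition_on_insert[of T "P - {T}" S] part unfolding ins by auto
    moreover have "image_mset card (mset_set (P - {T})) = L"
      using type finP[OF part] T by (simp add: mset_set_Diff image_mset_Diff)
    ultimately show ?thesis
      by auto
  qed
  have "(\<Sum>T\<in>?A. F T * (\<Sum>P\<in>?Q (S - T) L. \<Prod>B\<in>P. F B))
      = (\<Sum>T\<in>?A. \<Sum>P\<in>?Q (S - T) L. \<Prod>B\<in>insert T P. F B)"
    unfolding sum_distrib_left using finP disj
    by (intro sum.cong refl) (auto simp: prod.insert)
  also have "\<dots> = (\<Sum>(T, P)\<in>Sigma ?A (\<lambda>T. ?Q (S - T) L). \<Prod>B\<in>insert T P. F B)"
    using assms(1) finQ by (intro sum.Sigma) auto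
  also have "\<dots> = (\<Sum>(P, T)\<in>Sigma (?Q S (add_mset k L)) (\<lambda>P. {T \<in> P. card T = k}). \<Prod>B\<in>P. F B)"
  proof (rule sum.reindex_bij_witness[where i = "\<lambda>(P, T). (T, P - {T})" and j = "\<lambda>(T, P). (insert T P, T)"])
    fix a assume "a \<in> Sigma ?A (\<lambda>T. ?Q (S - T) L)"
    then obtain T P where a: "a = (T, P)" "T \<subseteq> S" "card T = k" "P \<in> ?Q (S - T) L"
      by auto
    then show "(case case a of (T, P) \<Rightarrow> (insert T P, T) of (P, T) \<Rightarrow> (T, P - {T})) = a"
      "(case a of (T, P) \<Rightarrow> (insert T P, T)) \<in> Sigma (?Q S (add_mset k L)) (\<lambda>P. {T \<in> P. card T = k})"
      "(case case a of (T, P) \<Rightarrow> (insert T P, T) of (P, T) \<Rightarrow> \<Prod>B\<in>P. F B) = (case a of (T, P) \<Rightarrow> \<Prod>B\<in>insert T P. F B)"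
      using insert_block[of T P] by auto
  next
    fix b assume "b \<in> Sigma (?Q S (add_mset k L)) (\<lambda>P. {T \<in> P. card T = k})"
    then obtain P T where b: "b = (P, T)" "P \<in> ?Q S (add_mset k L)" "T \<in> P" "card T = k"
      by auto
    then show "(case case b of (P, T) \<Rightarrow> (T, P - {T}) of (T, P) \<Rightarrow> (insert T P, T)) = b"
      "(case b of (P, T) \<Rightarrow> (T, P - {T})) \<in> Sigma ?A (\<lambda>T. ?Q (S - T) L)"
      using remove_block[of P T] by (auto simp: insert_absorb)
  qed
  also have "\<dots> = (\<Sum>P\<in>?Q S (add_mset k L). \<Sum>T\<in>{T \<in> P. card T = k}. \<Prod>B\<in>P. F B)"
    using finQ finP by (intro sum.Sigma[symmetric]) auto
  also have "\<dots> = (\<Sum>P\<in>?Q S (add_mset k L). of_nat (Suc (count L k)) * (\<Prod>B\<in>P. F B))"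
  proof (rule sum.cong[OF refl])
    fix P assume P: "P \<in> ?Q S (add_mset k L)"
    have "finite P"
      using finP P by blast
    then have "count (image_mset card (mset_set P)) k = (\<Sum>T\<in>{T \<in> P. card T = k}. 1)"
      unfolding count_image_mset' by (intro sum.cong) auto
    then have "card {T \<in> P. card T = k} = count (image_mset card (mset_set P)) k"
      by simp
    also have "\<dots> = Suc (count L k)"
      using P by simp
    finally show "(\<Sum>T\<in>{T \<in> P. card T = k}. \<Prod>B\<in>P. F B) = of_nat (Suc (count L k)) * (\<Prod>B\<in>P. F B)"
      by simp
  qed
  finally show ?thesis
    by (simp only: sum_distrib_left)
qed

text \<open>Since \<open>mult_fact M\<close> is \<open>mult_fact A * mult_fact (M - A)\<close> times the number of sets of positions with content
  \<open>A\<close>, the sum over the submultisets \<open>A\<close> in a product of power series becomes a sum over sets of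
  positions.  The positions that go to the various factors form a set partition whose blocks are labelled by
  factors of the right degree, and \<open>mult_fact (mset l)\<close> counts the labellings.\<close>

lemma product_over_set_partitions:
  fixes g :: "nat \<Rightarrow> nat multiset \<Rightarrow> 'k::field"
  assumes degree: "\<And>k M. g k M \<noteq> 0 \<Longrightarrow> size M = k"
    and "finite S" "\<And>k. k \<in> set l \<Longrightarrow> 0 < k"
  shows "of_nat (mult_fact (content w S)) * foldr ps_mult (map g l) ps_one (content w S)
    = of_nat (mult_fact (mset l)) *
      (\<Sum>P | partition_on S P \<and> image_mset card (mset_set P) = mset l.
         \<Prod>B\<in>P. of_nat (mult_fact (content w B)) * g (card B) (content w B))"
  using assms(2,3)
proof (induction l arbitrary: S)
  case Nil
  have "{P. partition_on S P \<and> image_mset card (mset_set P) = {#}} = (if S = {} then {{}} else {})"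
    using Nil(1) finite_elements[OF Nil(1)] by (auto simp: mset_set_empty_iff partition_on_def)
  then show ?case
    using Nil by (auto simp: ps_one_def mset_set_empty_iff)
next
  case (Cons k l)
  let ?G = "foldr ps_mult (map g l) ps_one" and ?M = "content w S"
  let ?F = "\<lambda>B. of_nat (mult_fact (content w B)) * g (card B) (content w B)"
  let ?\<Sigma> = "\<lambda>S. \<Sum>P | partition_on S P \<and> image_mset card (mset_set P) = mset l. \<Prod>B\<in>P. ?F B"
  have subsets: "finite {A. A \<subseteq># ?M}"
    by (rule finite_subset[of _ "content w ` Pow S"])
      (use Cons.prems(1) in \<open>auto intro: subset_of_content\<close>)
  have "of_nat (mult_fact ?M) * foldr ps_mult (map g (k # l)) ps_one ?M
      = (\<Sum>A | A \<subseteq># ?M. of_nat (mult_fact ?M) * (g k A * ?G (?M - A)))"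
    by (simp add: ps_mult_def sum_distrib_left)
  also have "\<dots> = (\<Sum>A | A \<subseteq># ?M. \<Sum>T | T \<subseteq> S \<and> content w T = A.
      of_nat (mult_fact A * mult_fact (?M - A)) * (g k A * ?G (?M - A)))"
  proof (rule sum.cong[OF refl])
    fix A assume "A \<in> {A. A \<subseteq># ?M}"
    then have "mult_fact ?M = card {T. T \<subseteq> S \<and> content w T = A} * (mult_fact A * mult_fact (?M - A))"
      using card_subsets_with_content[OF Cons.prems(1), of A w] by simp
    then show "of_nat (mult_fact ?M) * (g k A * ?G (?M - A)) = (\<Sum>T | T \<subseteq> S \<and> content w T = A.
      of_nat (mult_fact A * mult_fact (?M - A)) * (g k A * ?G (?M - A)))"
      by (simp add: mult.assoc)
  qed
  also have "\<dots> = (\<Sum>A\<in>{A. A \<subseteq># ?M}. \<Sum>T\<in>{T \<in> Pow S. content w T = A}.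
      of_nat (mult_fact (content w T)) * g k (content w T) *
      (of_nat (mult_fact (content w (S - T))) * ?G (content w (S - T))))"
    by (intro sum.cong refl) (auto simp: content_Diff[OF Cons.prems(1)] algebra_simps)
  also have "\<dots> = (\<Sum>T\<in>Pow S. of_nat (mult_fact (content w T)) * g k (content w T) *
      (of_nat (mult_fact (content w (S - T))) * ?G (content w (S - T))))"
    using Cons.prems(1) subsets content_mono[OF Cons.prems(1)] by (intro sum.group) auto
  also have "\<dots> = (\<Sum>T | T \<subseteq> S \<and> card T = k. of_nat (mult_fact (content w T)) * g k (content w T) *
      (of_nat (mult_fact (content w (S - T))) * ?G (content w (S - T))))"
  proof (rule sum.mono_neutral_right)
    show "\<forall>T\<in>Pow S - {T. T \<subseteq> S \<and> card T = k}. of_nat (mult_fact (content w T)) * g k (content w T) *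
      (of_nat (mult_fact (content w (S - T))) * ?G (content w (S - T))) = 0"
      using degree[of k] by fastforce
  qed (use Cons.prems(1) in auto)
  also have "\<dots> = (\<Sum>T | T \<subseteq> S \<and> card T = k. of_nat (mult_fact (mset l)) * (?F T * ?\<Sigma> (S - T)))"
  proof (rule sum.cong[OF refl])
    fix T assume T: "T \<in> {T. T \<subseteq> S \<and> card T = k}"
    have "of_nat (mult_fact (content w (S - T))) * ?G (content w (S - T))
        = of_nat (mult_fact (mset l)) * ?\<Sigma> (S - T)"
      by (rule Cons.IH) (use Cons.prems in auto)
    then show "of_nat (mult_fact (content w T)) * g k (content w T) *
      (of_nat (mult_fact (content w (S - T))) * ?G (content w (S - T)))
        = of_nat (mult_fact (mset l)) * (?F T * ?\<Sigma> (S - T))"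
      using T by (simp add: mult_ac)
  qed
  also have "\<dots> = of_nat (mult_fact (mset l)) * (\<Sum>T | T \<subseteq> S \<and> card T = k. ?F T * ?\<Sigma> (S - T))"
    by (simp only: sum_distrib_left)
  also have "(\<Sum>T | T \<subseteq> S \<and> card T = k. ?F T * ?\<Sigma> (S - T)) = of_nat (Suc (count (mset l) k)) *
      (\<Sum>P | partition_on S P \<and> image_mset card (mset_set P) = add_mset k (mset l). \<Prod>B\<in>P. ?F B)"
    using Cons.prems by (intro sum_partitions_with_block) auto
  finally show ?case
    by (simp only: mset.simps mult_fact_add_mset of_nat_mult mult.assoc mult.left_commute mult.commute)
qed


lemma content_letters:
  assumes "length w = n"
  shows "content (letter w) {1..n} = mset w"
proof -
  have "{1..n} = Suc ` {..<n}"
    by (auto simp: image_iff) (metis Suc_le_D Suc_le_eq lessThan_iff)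
  then have "mset_set {1..n} = image_mset Suc (mset_set {..<n})"
    by (simp add: image_mset_mset_set)
  then have "content (letter w) {1..n} = image_mset (\<lambda>i. w ! i) (mset [0..<n])"
    by (simp add: multiset.map_comp comp_def letter_def lessThan_atLeast0)
  also have "\<dots> = mset (map (\<lambda>i. w ! i) [0..<n])"
    by simp
  also have "\<dots> = mset w"
    using assms map_nth[of w] by simp
  finally show ?thesis .
qed

text \<open>The closed form of the composition in the theorem: a monomial of degree \<open>n\<close> is mapped to the sum over all
  \<open>n!\<close> orders of its \<open>n\<close> factors.\<close>

definition lift :: "(nat multiset \<Rightarrow> 'k::field) \<Rightarrow> (nat list \<Rightarrow> 'k)" where
  "lift f w = of_nat (mult_fact (mset w)) * f (mset w)"

lemma ps_mult_nonzero:
  assumes "ps_mult f g M \<noteq> 0"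
  obtains A where "A \<subseteq># M" "f A \<noteq> 0" "g (M - A) \<noteq> 0"
proof -
  obtain A where "A \<in> {A. A \<subseteq># M}" "f A * g (M - A) \<noteq> 0"
    using assms unfolding ps_mult_def by (rule sum.not_neutral_contains_not_neutral)
  then show ?thesis
    using that by auto
qed

lemma product_support:
  assumes "\<And>k M. g k M \<noteq> 0 \<Longrightarrow> set_mset M \<subseteq> {1..} \<and> size M = k"
    and "foldr ps_mult (map g l) ps_one M \<noteq> 0"
  shows "set_mset M \<subseteq> {1..} \<and> size M = sum_list l"
  using assms(2)
proof (induction l arbitrary: M)
  case Nil
  then show ?case
    by (auto simp: ps_one_def indicator_def split: if_splits)
next
  case (Cons k l)
  then obtain A where A: "A \<subseteq># M" "g k A \<noteq> 0" "foldr ps_mult (map g l) ps_one (M - A) \<noteq> 0"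
    by (auto elim: ps_mult_nonzero)
  then obtain D where D: "M = A + D"
    by (auto simp: mset_subset_eq_exists_conv)
  then show ?case
    using assms(1)[OF A(2)] Cons.IH[OF A(3)] by auto
qed

lemma setpart_type_eq_iff_mset:
  assumes "int_partition n l"
  shows "setpart_type P = l \<longleftrightarrow> image_mset card (mset_set P) = mset l"
proof
  assume "image_mset card (mset_set P) = mset l"
  moreover have "sort l = rev l"
    using assms by (intro properties_for_sort) (auto simp: int_partition_def sorted_wrt_rev)
  ultimately show "setpart_type P = l"
    by (simp add: setpart_type_def)
qed (use mset_setpart_type[of P] in simp)

lemma mults_fact_eq:
  assumes "int_partition n l"
  shows "mults_fact l = mult_fact (mset l)"
proof -
  have "set_mset (mset l) \<subseteq> {1..sum_list l}"
    using assms member_le_sum_list[of _ l] by (auto simp: int_partition_def Suc_le_eq)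
  then show ?thesis
    unfolding mults_fact_def by (subst mult_fact_superset[of "{1..sum_list l}"]) (auto simp: count_mset)
qed

text \<open>For the products \<open>p\<^sub>\<lambda>\<close>, \<open>e\<^sub>\<lambda>\<close> and \<open>h\<^sub>\<lambda>\<close> it remains to evaluate the lift of a single factor at the
  subwords given by the blocks of a set partition.\<close>

lemma lift_product:
  fixes g :: "nat \<Rightarrow> nat multiset \<Rightarrow> 'k::field" and nc :: "nat set set \<Rightarrow> nat list \<Rightarrow> 'k"
  assumes g: "\<And>k M. g k M \<noteq> 0 \<Longrightarrow> set_mset M \<subseteq> {1..} \<and> size M = k"
    and l: "int_partition n l"
    and nc: "\<And>P w. w \<notin> nc_words n \<Longrightarrow> nc P w = 0"
    and blocks: "\<And>P w. w \<in> nc_words n \<Longrightarrow> partition_on {1..n} P \<Longrightarrow> setpart_type P = l \<Longrightarrow>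
      (\<Prod>B\<in>P. of_nat (mult_fact (content (letter w) B)) * g (card B) (content (letter w) B)) = c * nc P w"
  shows "lift (foldr ps_mult (map g l) ps_one) = fscale (c * of_nat (mults_fact l))
    (\<Sum>P | partition_on {1..n} P \<and> setpart_type P = l. nc P)"
proof
  fix w
  let ?X = "{P. partition_on {1..n} P \<and> setpart_type P = l}"
  have "lift (foldr ps_mult (map g l) ps_one) w = c * of_nat (mults_fact l) * (\<Sum>P\<in>?X. nc P w)"
  proof (cases "w \<in> nc_words n")
    case True
    then have w: "content (letter w) {1..n} = mset w"
      by (intro content_letters) (simp add: nc_words_def)
    have "0 < k" if "k \<in> set l" for k
      using l that by (simp add: int_partition_def)
    then have "lift (foldr ps_mult (map g l) ps_one) w = of_nat (mults_fact l) *
        (\<Sum>P\<in>?X. \<Prod>B\<in>P. of_nat (mult_fact (content (letter w) B)) * g (card B) (content (letter w) B))"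
      using product_over_set_partitions[of g "{1..n}" l "letter w"] g
      unfolding w by (simp add: lift_def setpart_type_eq_iff_mset[OF l] mults_fact_eq[OF l])
    also have "(\<Sum>P\<in>?X. \<Prod>B\<in>P. of_nat (mult_fact (content (letter w) B)) * g (card B) (content (letter w) B))
        = (\<Sum>P\<in>?X. c * nc P w)"
      by (intro sum.cong refl blocks[OF True]) auto
    finally show ?thesis
      by (simp only: sum_distrib_left mult.assoc mult.left_commute)
  next
    case False
    have "foldr ps_mult (map g l) ps_one (mset w) = 0"
    proof (rule ccontr)
      assume "foldr ps_mult (map g l) ps_one (mset w) \<noteq> 0"
      then have "set_mset (mset w) \<subseteq> {1..} \<and> size (mset w) = sum_list l"
        by (rule product_support[rotated]) (rule g)
      then show False
        using False l by (auto simp: nc_words_def int_partition_def)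
    qed
    then show ?thesis
      by (simp add: lift_def nc[OF False])
  qed
  then show "lift (foldr ps_mult (map g l) ps_one) w = fscale (c * of_nat (mults_fact l)) (\<Sum>P\<in>?X. nc P) w"
    by (simp only: fscale_def sum_apply)
qed

lemma prod_if_one_zero:
  assumes "finite P"
  shows "(\<Prod>x\<in>P. if Q x then 1 else 0) = (if \<forall>x\<in>P. Q x then 1 else 0 :: 'k::comm_semiring_1)"
  using assms by (induction rule: finite_induct) auto

lemma letter_pos:
  assumes "w \<in> nc_words n" "j \<in> {1..n}"
  shows "1 \<le> letter w j"
proof -
  have "w ! (j - 1) \<in> set w"
    using assms by (intro nth_mem) (auto simp: nc_words_def)
  then show ?thesis
    using assms(1) by (auto simp: nc_words_def letter_def)
qed

lemma count_content: "finite B \<Longrightarrow> count (content w B) i = card {j \<in> B. w j = i}"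
proof -
  assume "finite B"
  then have "count (content w B) i = (\<Sum>j\<in>{j \<in> B. w j = i}. 1)"
    unfolding count_image_mset' by (intro sum.cong) auto
  then show ?thesis
    by simp
qed

lemma mult_fact_replicate: "mult_fact (replicate_mset k i) = fact k"
  by (induction k) (auto simp: mult_fact_add_mset)

lemma partition_block_facts:
  assumes "partition_on {1..n::nat} P" "B \<in> P"
  shows "finite B" "B \<noteq> {}" "B \<subseteq> {1..n}"
proof -
  show "B \<subseteq> {1..n}"
    using assms partition_onD1 by blast
  then show "finite B"
    by (rule finite_subset) simp
  show "B \<noteq> {}"
    using assms partition_onD3 by blast
qed

lemma same_block_iff:
  assumes "partition_on {1..n::nat} P"
  shows "(\<forall>j\<in>{1..n}. \<forall>k\<in>{1..n}. (\<exists>B\<in>P. j \<in> B \<and> k \<in> B) \<longrightarrow> R j k) \<longleftrightarrow> (\<forall>B\<in>P. \<forall>j\<in>B. \<forall>k\<in>B. R j k)"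
  using partition_block_facts(3)[OF assms] by blast

lemma nc_p_eq_prod:
  assumes "w \<in> nc_words n" "partition_on {1..n} P"
  shows "(nc_p n P w :: 'k::field) = (\<Prod>B\<in>P. if \<forall>j\<in>B. \<forall>k\<in>B. letter w j = letter w k then 1 else 0)"
  unfolding prod_if_one_zero[OF finite_elements[OF _ assms(2)], simplified]
    same_block_iff[OF assms(2), symmetric]
  using assms(1) by (simp add: nc_p_def indicator_def)

lemma nc_e_eq_prod:
  assumes "w \<in> nc_words n" "partition_on {1..n} P"
  shows "(nc_e n P w :: 'k::field) = (\<Prod>B\<in>P. if inj_on (letter w) B then 1 else 0)"
proof -
  have "(\<forall>j\<in>{1..n}. \<forall>k\<in>{1..n}. j \<noteq> k \<and> (\<exists>B\<in>P. j \<in> B \<and> k \<in> B) \<longrightarrow> letter w j \<noteq> letter w k)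
      \<longleftrightarrow> (\<forall>B\<in>P. inj_on (letter w) B)"
    using same_block_iff[OF assms(2), of "\<lambda>j k. j \<noteq> k \<longrightarrow> letter w j \<noteq> letter w k"]
    unfolding inj_on_def by blast
  then show ?thesis
    using assms(1) finite_elements[OF _ assms(2)] by (simp add: nc_e_def indicator_def prod_if_one_zero)
qed

lemma parts_fact_eq:
  assumes "image_mset card (mset_set P) = mset l" 
  shows "parts_fact l = (\<Prod>B\<in>P. fact (card B))"
proof -
  have "parts_fact l = prod_mset (image_mset fact (mset l))"
    by (simp add: parts_fact_def prod_mset_prod_list flip: mset_map)
  then show ?thesis
    by (simp add: assms[symmetric] multiset.map_comp comp_def prod_unfold_prod_mset)
qed

lemma nc_outside:
  assumes "w \<notin> nc_words n"
  shows "nc_m n P w = 0" "nc_p n P w = 0" "nc_e n P w = 0" "nc_h n P w = 0"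
  using assms by (auto simp: nc_m_def nc_p_def nc_e_def nc_h_def)

lemma sum_partitions_apply:
  fixes F :: "nat set set \<Rightarrow> nat list \<Rightarrow> 'k::field"
  shows "fscale c (\<Sum>P\<in>X. F P) w = c * (\<Sum>P\<in>X. F P w)"
  by (simp add: fscale_def sum_apply)

lemma lift_sym_p:
  assumes l: "int_partition n l"
  shows "lift (sym_p l) = fscale (of_nat (parts_fact l * mults_fact l))
    (\<Sum>P | partition_on {1..n} P \<and> setpart_type P = l. nc_p n P :: _ \<Rightarrow> 'k::field)"
  unfolding sym_p_def of_nat_mult
proof (rule lift_product[OF _ l])
  let ?g = "\<lambda>k. indicator {replicate_mset k i | i. 1 \<le> i} :: nat multiset \<Rightarrow> 'k"
  show "set_mset M \<subseteq> {1..} \<and> size M = k" if "?g k M \<noteq> 0" for k M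
    using that by (auto simp: indicator_def split: if_splits)
  fix P w assume w: "w \<in> nc_words n" and P: "partition_on {1..n} P" "setpart_type P = l"
  show "(\<Prod>B\<in>P. of_nat (mult_fact (content (letter w) B)) * ?g (card B) (content (letter w) B))
      = of_nat (parts_fact l) * nc_p n P w"
  proof -
    have "of_nat (mult_fact (content (letter w) B)) * ?g (card B) (content (letter w) B)
        = of_nat (fact (card B)) * (if \<forall>j\<in>B. \<forall>k\<in>B. letter w j = letter w k then 1 else 0)"
      if B: "B \<in> P" for B
    proof (cases "\<forall>j\<in>B. \<forall>k\<in>B. letter w j = letter w k")
      case True
      obtain b where b: "b \<in> B"
        using partition_block_facts(2)[OF P(1) B] by auto
      have "content (letter w) B = image_mset (\<lambda>_. letter w b) (mset_set B)"
      proof (rule image_mset_cong)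
        fix j assume "j \<in># mset_set B"
        then have "j \<in> B"
          using partition_block_facts(1)[OF P(1) B] by simp
        then show "letter w j = letter w b"
          using True b by blast
      qed
      then have "content (letter w) B = replicate_mset (card B) (letter w b)"
        by (simp add: image_mset_const_eq)
      moreover have "1 \<le> letter w b"
        using letter_pos[OF w] partition_block_facts(3)[OF P(1) B] b by auto
      ultimately show ?thesis
        unfolding if_P[OF True] by (auto simp: mult_fact_replicate indicator_def)
    next
      case False
      have "content (letter w) B \<noteq> replicate_mset (card B) i" for i
      proof
        assume eq: "content (letter w) B = replicate_mset (card B) i"
        have "letter w j = i" if "j \<in> B" for j
        proof -
          have "letter w j \<in># content (letter w) B"
            using that partition_block_facts(1)[OF P(1) B] by simp
          then show ?thesis
            unfolding eq by (simp split: if_splits)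
        qed
        then show False
          using False by auto
      qed
      then show ?thesis
        using False by (auto simp: indicator_def)
    qed
    then show ?thesis
      unfolding nc_p_eq_prod[OF w P(1)] parts_fact_eq[OF P(2)[unfolded setpart_type_eq_iff_mset[OF l]]]
      by (simp add: prod.distrib)
  qed
qed (rule nc_outside)

lemma lift_sym_e:
  assumes l: "int_partition n l"
  shows "lift (sym_e l) = fscale (of_nat (mults_fact l))
    (\<Sum>P | partition_on {1..n} P \<and> setpart_type P = l. nc_e n P :: _ \<Rightarrow> 'k::field)"
  unfolding sym_e_def
proof (rule lift_product[OF _ l, where c = 1, unfolded mult_1_left])
  let ?g = "\<lambda>k. indicator {M. set_mset M \<subseteq> {1..} \<and> size M = k \<and> (\<forall>i. count M i \<le> 1)} :: nat multiset \<Rightarrow> 'k"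
  show "set_mset M \<subseteq> {1..} \<and> size M = k" if "?g k M \<noteq> 0" for k M
    using that by (auto simp: indicator_def split: if_splits)
  fix P w assume w: "w \<in> nc_words n" and P: "partition_on {1..n} P"
  show "(\<Prod>B\<in>P. of_nat (mult_fact (content (letter w) B)) * ?g (card B) (content (letter w) B)) = nc_e n P w"
    unfolding nc_e_eq_prod[OF w P]
  proof (rule prod.cong[OF refl])
    fix B assume B: "B \<in> P"
    note B' = partition_block_facts[OF P B]
    have set: "set_mset (content (letter w) B) \<subseteq> {1..}"
      using letter_pos[OF w] B' by auto
    have counts: "(\<forall>i. count (content (letter w) B) i \<le> 1) \<longleftrightarrow> inj_on (letter w) B"
    proof
      assume le: "\<forall>i. count (content (letter w) B) i \<le> 1"
      show "inj_on (letter w) B"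
      proof (rule inj_onI)
        fix j k assume jk: "j \<in> B" "k \<in> B" "letter w j = letter w k"
        have "card {j' \<in> B. letter w j' = letter w j} \<le> Suc 0"
          using le[rule_format, of "letter w j"] B'(1) by (simp add: count_content)
        then show "j = k"
          using jk B'(1) card_le_Suc0_iff_eq[of "{j' \<in> B. letter w j' = letter w j}"] by auto
      qed
    next
      assume inj: "inj_on (letter w) B"
      show "\<forall>i. count (content (letter w) B) i \<le> 1"
      proof
        fix i
        have "card {j \<in> B. letter w j = i} \<le> Suc 0"
          using inj B'(1) by (subst card_le_Suc0_iff_eq) (auto dest: inj_onD)
        then show "count (content (letter w) B) i \<le> 1"
          using B'(1) by (simp add: count_content)
      qed
    qed
    have "mult_fact M = 1" if "\<forall>i. count M i \<le> 1" for M :: "nat multiset"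
      unfolding mult_fact_def
    proof (rule prod.neutral, rule ballI)
      fix x assume "x \<in># M"
      then have "count M x = 1"
        using that[rule_format, of x] by (simp add: le_antisym Suc_le_eq)
      then show "fact (count M x) = 1"
        by simp
    qed
    then show "of_nat (mult_fact (content (letter w) B)) * ?g (card B) (content (letter w) B)
        = (if inj_on (letter w) B then 1 else 0)"
      using set counts by (auto simp: indicator_def)
  qed
qed (rule nc_outside)


section \<open>Complete homogeneous functions and linear orders\<close>

text \<open>The largest element is a minimal element of the converse order, which is well-founded.\<close>

lemma linear_order_on_max:
  assumes "finite A" "A \<noteq> {}" "linear_order_on A r"
  shows "\<exists>x\<in>A. \<forall>y\<in>A. (y, x) \<in> r"
proof -
  have r: "partial_order_on A r" "r \<subseteq> A \<times> A" "total_on A r" "refl_on A r"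
    using assms(3) by (auto simp: order_on_defs)
  have "finite (r\<inverse>)" "partial_order_on A (r\<inverse>)"
    using r assms(1) finite_subset[OF r(2)] by auto
  then have "wf (r\<inverse> - Id)"
    by (rule partial_order_on_well_order_on)
  then obtain x where x: "x \<in> A" "\<And>y. (y, x) \<in> r\<inverse> - Id \<Longrightarrow> y \<notin> A"
    using assms(2) by (meson all_not_in_conv wfE_min)
  have "(y, x) \<in> r" if "y \<in> A" for y
    using x that r(3,4) by (cases "y = x") (auto simp: total_on_def refl_on_def)
  then show ?thesis
    using x(1) by blast
qed

text \<open>By induction over the choice of the largest element.\<close>

lemma card_linear_orders:
  assumes "finite A"
  shows "card {r. linear_order_on A r} = fact (card A)"
  using assms
proof (induction "card A" arbitrary: A)
  case 0
  then have "{r. linear_order_on A r} = {{}}"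
    by (auto simp: order_on_defs)
  then show ?case
    using 0 by simp
next
  case (Suc n)
  let ?M = "\<lambda>x. {r. linear_order_on A r \<and> (\<forall>y\<in>A. (y, x) \<in> r)}"
  have fin: "finite {r. linear_order_on A r}"
    by (rule finite_subset[of _ "Pow (A \<times> A)"]) (use Suc.prems in \<open>auto simp: order_on_defs\<close>)
  have "{r. linear_order_on A r} = (\<Union>x\<in>A. ?M x)"
    using linear_order_on_max[OF Suc.prems] Suc.hyps(2) by fastforce
  also have "card \<dots> = (\<Sum>x\<in>A. card (?M x))"
  proof (intro card_UN_disjoint ballI impI)
    fix x y assume "x \<in> A" "y \<in> A" "x \<noteq> y"
    then show "?M x \<inter> ?M y = {}"
      by (auto simp: order_on_defs dest: antisymD)
  qed (use Suc.prems fin in \<open>auto intro: finite_subset[OF _ fin]\<close>)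
  also have "\<dots> = (\<Sum>x\<in>A. fact n)"
  proof (rule sum.cong[OF refl])
    fix x assume x: "x \<in> A"
    have "bij_betw (\<lambda>r. r \<union> A \<times> {x}) {r. linear_order_on (A - {x}) r} (?M x)"
    proof (rule bij_betw_byWitness[where f' = "\<lambda>r. r \<inter> (A - {x}) \<times> (A - {x})"])
      show "\<forall>r\<in>{r. linear_order_on (A - {x}) r}. (r \<union> A \<times> {x}) \<inter> (A - {x}) \<times> (A - {x}) = r"
        by (auto simp: order_on_defs)
      show "\<forall>r\<in>?M x. r \<inter> (A - {x}) \<times> (A - {x}) \<union> A \<times> {x} = r"
        using x by (auto simp: order_on_defs dest: antisymD)
      show "(\<lambda>r. r \<union> A \<times> {x}) ` {r. linear_order_on (A - {x}) r} \<subseteq> ?M x"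
      proof (intro subsetI, elim imageE, clarify)
        fix r assume r: "linear_order_on (A - {x}) r"
        have "trans (r \<union> A \<times> {x})"
          using r by (intro transI) (auto simp: order_on_defs dest: transD)
        moreover have "antisym (r \<union> A \<times> {x})"
          using r by (intro antisymI) (auto simp: order_on_defs dest: antisymD)
        ultimately show "linear_order_on A (r \<union> A \<times> {x}) \<and> (\<forall>y\<in>A. (y, x) \<in> r \<union> A \<times> {x})"
          using r x by (auto simp: order_on_defs refl_on_def total_on_def)
      qed
      show "(\<lambda>r. r \<inter> (A - {x}) \<times> (A - {x})) ` ?M x \<subseteq> {r. linear_order_on (A - {x}) r}"
      proof (intro subsetI, elim imageE, clarify)
        fix r assume r: "linear_order_on A r"
        have "trans (r \<inter> (A - {x}) \<times> (A - {x}))"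
          using r by (intro transI) (auto simp: order_on_defs dest: transD)
        moreover have "antisym (r \<inter> (A - {x}) \<times> (A - {x}))"
          using r by (intro antisymI) (auto simp: order_on_defs dest: antisymD)
        ultimately show "linear_order_on (A - {x}) (r \<inter> (A - {x}) \<times> (A - {x}))"
          using r by (auto simp: order_on_defs refl_on_def total_on_def)
      qed
    qed
    then have "card (?M x) = card {r. linear_order_on (A - {x}) r}"
      by (simp add: bij_betw_same_card)
    also have "\<dots> = fact n"
      using Suc.hyps(1)[of "A - {x}"] Suc.hyps(2)[symmetric] Suc.prems x by simp
    finally show "card (?M x) = fact n" .
  qed
  also have "\<dots> = fact (card A)"
    by (simp flip: Suc.hyps(2))
  finally show ?case .
qed

text \<open>The orderings in the definition of \<open>nc_h\<close> are indexed by all positive integers; for letters that do not occur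
  in the word there is a single, empty, ordering.\<close>

lemma card_PiE_singletons:
  assumes "J \<subseteq> I" "\<And>i. i \<in> I - J \<Longrightarrow> F i = {c}"
  shows "card (PiE I F) = card (PiE J F)"
proof -
  have "bij_betw (\<lambda>f. restrict f J) (PiE I F) (PiE J F)"
  proof (rule bij_betw_byWitness[where f' = "\<lambda>f. \<lambda>i\<in>I. if i \<in> J then f i else c"])
    show "\<forall>f\<in>PiE I F. (\<lambda>i\<in>I. if i \<in> J then restrict f J i else c) = f"
    proof
      fix f assume f: "f \<in> PiE I F"
      show "(\<lambda>i\<in>I. if i \<in> J then restrict f J i else c) = f"
      proof
        fix i show "(\<lambda>i\<in>I. if i \<in> J then restrict f J i else c) i = f i"
          using PiE_mem[OF f, of i] PiE_arb[OF f, of i] assms(2)[of i]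
          by (cases "i \<in> I"; cases "i \<in> J") (simp_all add: restrict_apply)
      qed
    qed
    show "\<forall>f\<in>PiE J F. restrict (\<lambda>i\<in>I. if i \<in> J then f i else c) J = f"
    proof
      fix f assume f: "f \<in> PiE J F"
      show "restrict (\<lambda>i\<in>I. if i \<in> J then f i else c) J = f"
      proof
        fix i show "restrict (\<lambda>i\<in>I. if i \<in> J then f i else c) J i = f i"
          using PiE_arb[OF f, of i] assms(1) by (cases "i \<in> J") (auto simp: restrict_apply)
      qed
    qed
    show "(\<lambda>f. restrict f J) ` PiE I F \<subseteq> PiE J F"
      using assms(1) by auto
    show "(\<lambda>f. \<lambda>i\<in>I. if i \<in> J then f i else c) ` PiE J F \<subseteq> PiE I F"
    proof (intro subsetI, elim imageE)
      fix h f assume "h = (\<lambda>i\<in>I. if i \<in> J then f i else c)" "f \<in> PiE J F"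
      then show "h \<in> PiE I F"
        using assms(2) PiE_mem[of f J F] by auto
    qed
  qed
  then show ?thesis
    by (rule bij_betw_same_card)
qed

lemma nc_h_eq_prod:
  assumes w: "w \<in> nc_words n" and P: "partition_on {1..n} P"
  shows "(nc_h n P w :: 'k::field) = (\<Prod>B\<in>P. of_nat (mult_fact (content (letter w) B)))"
proof -
  let ?F = "\<lambda>(i, B). {r. linear_order_on {j \<in> B. letter w j = i} r}"
  let ?L = "letter w ` {1..n}"
  have finP: "finite P"
    using P by (rule finite_elements[rotated]) simp
  have "card (PiE ({1..} \<times> P) ?F) = card (PiE (?L \<times> P) ?F)"
  proof (rule card_PiE_singletons)
    show "?L \<times> P \<subseteq> {1..} \<times> P"
      using letter_pos[OF w] by auto
    fix x assume x: "x \<in> {1..} \<times> P - ?L \<times> P"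
    obtain i B where iB: "x = (i, B)"
      by force
    have "{j \<in> B. letter w j = i} = {}"
      using x partition_block_facts(3)[OF P, of B] unfolding iB by auto
    moreover have "{r. linear_order_on {} r} = {{}}"
      by (auto simp: order_on_defs)
    ultimately show "?F x = {{}}"
      unfolding iB by (simp only: prod.case)
  qed
  also have "\<dots> = (\<Prod>x\<in>?L \<times> P. card (?F x))"
    using finP by (intro card_PiE) auto
  also have "\<dots> = (\<Prod>(i, B)\<in>?L \<times> P. fact (card {j \<in> B. letter w j = i}))"
    using partition_block_facts(1)[OF P] by (intro prod.cong refl) (auto simp: card_linear_orders)
  also have "\<dots> = (\<Prod>i\<in>?L. \<Prod>B\<in>P. fact (card {j \<in> B. letter w j = i}))"
    by (rule prod.cartesian_product[symmetric])
  also have "\<dots> = (\<Prod>B\<in>P. \<Prod>i\<in>?L. fact (card {j \<in> B. letter w j = i}))"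
    by (rule prod.swap)
  also have "\<dots> = (\<Prod>B\<in>P. mult_fact (content (letter w) B))"
  proof (rule prod.cong[OF refl])
    fix B assume B: "B \<in> P"
    note B' = partition_block_facts[OF P B]
    have "mult_fact (content (letter w) B) = (\<Prod>i\<in>?L. fact (count (content (letter w) B) i))"
      using B' by (intro mult_fact_superset) auto
    then show "(\<Prod>i\<in>?L. fact (card {j \<in> B. letter w j = i})) = mult_fact (content (letter w) B)"
      by (simp add: count_content[OF B'(1)])
  qed
  finally show ?thesis
    using w by (simp add: nc_h_def)
qed

lemma lift_sym_h:
  assumes l: "int_partition n l"
  shows "lift (sym_h l) = fscale (of_nat (mults_fact l))
    (\<Sum>P | partition_on {1..n} P \<and> setpart_type P = l. nc_h n P :: _ \<Rightarrow> 'k::field)"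
  unfolding sym_h_def
proof (rule lift_product[OF _ l, where c = 1, unfolded mult_1_left])
  let ?g = "\<lambda>k. indicator {M. set_mset M \<subseteq> {1..} \<and> size M = k} :: nat multiset \<Rightarrow> 'k"
  show "set_mset M \<subseteq> {1..} \<and> size M = k" if "?g k M \<noteq> 0" for k M
    using that by (auto simp: indicator_def split: if_splits)
  fix P w assume w: "w \<in> nc_words n" and P: "partition_on {1..n} P"
  show "(\<Prod>B\<in>P. of_nat (mult_fact (content (letter w) B)) * ?g (card B) (content (letter w) B)) = nc_h n P w"
    unfolding nc_h_eq_prod[OF w P]
  proof (rule prod.cong[OF refl])
    fix B assume B: "B \<in> P"
    have "set_mset (content (letter w) B) \<subseteq> {1..}"
      using letter_pos[OF w] partition_block_facts[OF P B] by auto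
    then show "of_nat (mult_fact (content (letter w) B)) * ?g (card B) (content (letter w) B)
        = of_nat (mult_fact (content (letter w) B))"
      by (simp add: indicator_def)
  qed
qed (rule nc_outside)


section \<open>The kernel of a word\<close>

text \<open>The set partition of the positions of \<open>w\<close> according to their letters.\<close>

definition word_kernel :: "nat \<Rightarrow> nat list \<Rightarrow> nat set set" where
  "word_kernel n w = (\<lambda>i. {j \<in> {1..n}. letter w j = i}) ` (letter w ` {1..n})"

lemma kernel_partition: "partition_on {1..n} (word_kernel n w)"
  by (rule partition_onI) (auto simp: word_kernel_def disjnt_def)

lemma kernel_same_block:
  assumes "j \<in> {1..n}" "k \<in> {1..n}"
  shows "(\<exists>B\<in>word_kernel n w. j \<in> B \<and> k \<in> B) \<longleftrightarrow> letter w j = letter w k"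
  using assms by (auto simp: word_kernel_def)

lemma refines_iff_same_block:
  assumes "partition_on I P" "partition_on I Q"
  shows "refines I P Q \<longleftrightarrow> (\<forall>j\<in>I. \<forall>k\<in>I. (\<exists>B\<in>P. j \<in> B \<and> k \<in> B) \<longrightarrow> (\<exists>B\<in>Q. j \<in> B \<and> k \<in> B))"
proof
  assume "refines I P Q"
  then have sub: "\<exists>C\<in>Q. B \<subseteq> C" if "B \<in> P" for B
    using that by (simp add: refines_def)
  show "\<forall>j\<in>I. \<forall>k\<in>I. (\<exists>B\<in>P. j \<in> B \<and> k \<in> B) \<longrightarrow> (\<exists>B\<in>Q. j \<in> B \<and> k \<in> B)"
  proof (intro ballI impI, elim bexE conjE)
    fix j k B assume "B \<in> P" "j \<in> B" "k \<in> B"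
    then show "\<exists>C\<in>Q. j \<in> C \<and> k \<in> C"
      using sub[of B] by auto
  qed
next
  assume same: "\<forall>j\<in>I. \<forall>k\<in>I. (\<exists>B\<in>P. j \<in> B \<and> k \<in> B) \<longrightarrow> (\<exists>B\<in>Q. j \<in> B \<and> k \<in> B)"
  have "\<exists>C\<in>Q. B \<subseteq> C" if B: "B \<in> P" for B
  proof -
    obtain j where j: "j \<in> B"
      using B partition_onD3[OF assms(1)] by (metis ex_in_conv)
    have BI: "B \<subseteq> I"
      using B partition_onD1[OF assms(1)] by auto
    obtain C where C: "C \<in> Q" "j \<in> C"
      using j BI partition_onD1[OF assms(2)] by auto
    have "k \<in> C" if k: "k \<in> B" for k
    proof -
      obtain D where D: "D \<in> Q" "j \<in> D" "k \<in> D"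
        using same B j k BI by blast
      then show ?thesis
        using partition_on_block_unique[OF assms(2) C(1) D(1) C(2)] by simp
    qed
    then show ?thesis
      using C by auto
  qed
  then show "refines I P Q"
    using assms by (simp add: refines_def)
qed

lemma refines_kernel_iff:
  assumes "partition_on {1..n} P"
  shows "refines {1..n} P (word_kernel n w)
      \<longleftrightarrow> (\<forall>j\<in>{1..n}. \<forall>k\<in>{1..n}. (\<exists>B\<in>P. j \<in> B \<and> k \<in> B) \<longrightarrow> letter w j = letter w k)"
    and "refines {1..n} (word_kernel n w) P
      \<longleftrightarrow> (\<forall>j\<in>{1..n}. \<forall>k\<in>{1..n}. letter w j = letter w k \<longrightarrow> (\<exists>B\<in>P. j \<in> B \<and> k \<in> B))"
  unfolding refines_iff_same_block[OF assms kernel_partition] refines_iff_same_block[OF kernel_partition assms]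
  by (intro ball_cong refl, simp only: kernel_same_block)+

lemma nc_p_kernel:
  assumes "w \<in> nc_words n" "partition_on {1..n} P"
  shows "(nc_p n P w :: 'k::field) = (if refines {1..n} P (word_kernel n w) then 1 else 0)"
  unfolding refines_kernel_iff[OF assms(2)] using assms(1) by (simp add: nc_p_def indicator_def)

lemma nc_m_kernel:
  assumes "w \<in> nc_words n" "partition_on {1..n} P"
  shows "(nc_m n P w :: 'k::field) = (if P = word_kernel n w then 1 else 0)"
proof -
  have "P = word_kernel n w \<longleftrightarrow> refines {1..n} P (word_kernel n w) \<and> refines {1..n} (word_kernel n w) P"
    using refines_asym[of "{1..n}" P "word_kernel n w"] refines_refl[OF assms(2)] by auto
  also have "\<dots> \<longleftrightarrow> (\<forall>j\<in>{1..n}. \<forall>k\<in>{1..n}. letter w j = letter w k \<longleftrightarrow> (\<exists>B\<in>P. j \<in> B \<and> k \<in> B))"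
    unfolding refines_kernel_iff[OF assms(2)] ball_conj_distrib[symmetric]
    by (intro ball_cong refl iffI) simp_all
  finally show ?thesis
    using assms(1) by (simp add: nc_m_def indicator_def)
qed

text \<open>The block of a letter has as many elements as the letter has occurrences, so that the monomial function
  containing the commutative image of \<open>w\<close> is given by the type of the kernel.\<close>

lemma card_kernel_blocks:
  assumes "w \<in> nc_words n"
  shows "image_mset card (mset_set (word_kernel n w)) = image_mset (count (mset w)) (mset_set (set_mset (mset w)))"
proof -
  have len: "length w = n"
    using assms by (simp add: nc_words_def)
  let ?B = "\<lambda>i. {j \<in> {1..n}. letter w j = i}" and ?L = "letter w ` {1..n}"
  have L: "set_mset (mset w) = ?L"
    unfolding content_letters[OF len, symmetric] by simp
  have "inj_on ?B ?L"
    by (rule inj_onI) blast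
  then have "mset_set (word_kernel n w) = image_mset ?B (mset_set ?L)"
    unfolding word_kernel_def by (rule image_mset_mset_set[symmetric])
  then have "image_mset card (mset_set (word_kernel n w)) = image_mset (\<lambda>i. card (?B i)) (mset_set ?L)"
    by (simp add: multiset.map_comp comp_def)
  also have "(\<lambda>i. card (?B i)) = count (mset w)"
    unfolding content_letters[OF len, symmetric] by (rule ext) (rule count_content[symmetric], simp)
  finally show ?thesis
    by (simp only: L)
qed

lemma lift_sym_m:
  assumes l: "int_partition n l"
  shows "lift (sym_m l) = fscale (of_nat (parts_fact l))
    (\<Sum>P | partition_on {1..n} P \<and> setpart_type P = l. nc_m n P :: _ \<Rightarrow> 'k::field)"
proof
  fix w :: "nat list"
  let ?M = "mset w"
  have parts: "mult_fact ?M = parts_fact l" if "image_mset (count ?M) (mset_set (set_mset ?M)) = mset l"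
  proof -
    have "parts_fact l = prod_mset (image_mset fact (mset l))"
      by (simp add: parts_fact_def prod_mset_prod_list flip: mset_map)
    then show ?thesis
      by (simp add: that[symmetric] multiset.map_comp comp_def prod_unfold_prod_mset mult_fact_def del: set_mset_mset)
  qed
  show "lift (sym_m l) w = fscale (of_nat (parts_fact l))
    (\<Sum>P | partition_on {1..n} P \<and> setpart_type P = l. nc_m n P :: _ \<Rightarrow> 'k::field) w"
  proof (cases "w \<in> nc_words n")
    case True
    have "(\<Sum>P | partition_on {1..n} P \<and> setpart_type P = l. nc_m n P w)
        = (\<Sum>P | partition_on {1..n} P \<and> setpart_type P = l. if P = word_kernel n w then 1 else 0 :: 'k)"
      by (intro sum.cong refl nc_m_kernel[OF True]) simp
    also have "\<dots> = (if setpart_type (word_kernel n w) = l then 1 else 0)"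
    proof -
      have "finite {P. partition_on {1..n} P \<and> setpart_type P = l}"
        by (rule finite_subset[OF _ finitely_many_partition_on[of "{1..n}"]]) auto
      then show ?thesis
        using kernel_partition[of n w] by (simp add: sum.delta)
    qed
    finally have sum: "(\<Sum>P | partition_on {1..n} P \<and> setpart_type P = l. nc_m n P w)
        = (if setpart_type (word_kernel n w) = l then 1 else 0 :: 'k)" .
    have "sym_m l ?M = (if setpart_type (word_kernel n w) = l then 1 else 0 :: 'k)"
      unfolding setpart_type_eq_iff_mset[OF l] card_kernel_blocks[OF True]
      using True by (auto simp: sym_m_def indicator_def nc_words_def)
    then show ?thesis
      unfolding sum_partitions_apply sum lift_def
      using parts[unfolded card_kernel_blocks[OF True, symmetric] setpart_type_eq_iff_mset[OF l, symmetric]]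
      by (cases "setpart_type (word_kernel n w) = l") (simp_all only: if_True if_False mult_zero_right refl)
  next
    case False
    have "sym_m l ?M = (0 :: 'k)"
    proof (rule ccontr)
      assume "sym_m l ?M \<noteq> (0 :: 'k)"
      then have M: "set_mset ?M \<subseteq> {1..}" "image_mset (count ?M) (mset_set (set_mset ?M)) = mset l"
        by (auto simp: sym_m_def indicator_def split: if_splits)
      have "size ?M = sum_mset (image_mset (count ?M) (mset_set (set_mset ?M)))"
        by (simp add: size_multiset_overloaded_eq sum_unfold_sum_mset)
      also have "\<dots> = sum_list l"
        unfolding M(2) by (simp add: sum_mset_sum_list)
      finally show False
        using False M(1) l by (auto simp: nc_words_def int_partition_def)
    qed
    then show ?thesis
      unfolding sum_partitions_apply lift_def by (simp add: nc_outside[OF False])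
  qed
qed


section \<open>Symmetric power series\<close>

lemma Sym_support: "f \<in> Sym \<Longrightarrow> f M \<noteq> 0 \<Longrightarrow> set_mset M \<subseteq> {1..}"
  by (auto simp: Sym_def)

lemma Sym_permute: "f \<in> Sym \<Longrightarrow> \<pi> permutes {1..n} \<Longrightarrow> f (image_mset \<pi> M) = f M"
  by (auto simp: Sym_def)

lemma SymI:
  assumes "\<And>M. f M \<noteq> 0 \<Longrightarrow> set_mset M \<subseteq> {1..} \<and> size M \<le> d"
    and "\<And>\<pi> n M. \<pi> permutes {1..n} \<Longrightarrow> f (image_mset \<pi> M) = f M"
  shows "f \<in> Sym"
  unfolding Sym_def using assms by blast

lemma image_mset_perm_inv:
  assumes "bij \<pi>"
  shows "image_mset (inv \<pi>) (image_mset \<pi> M) = M" "image_mset \<pi> (image_mset (inv \<pi>) M) = M"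
  using assms by (simp_all add: multiset.map_comp comp_def bij_is_inj surj_f_inv_f[OF bij_is_surj])

lemma permutes_positive:
  assumes "\<pi> permutes {1..n::nat}"
  shows "1 \<le> \<pi> x \<longleftrightarrow> 1 \<le> x"
  using permutes_in_image[OF assms, of x] permutes_not_in[OF assms, of x] by (cases "x \<in> {1..n}") auto

lemma indicator_in_Sym:
  assumes "\<And>M. M \<in> X \<Longrightarrow> set_mset M \<subseteq> {1..} \<and> size M \<le> d"
    and "\<And>\<pi> n M. \<pi> permutes {1..n} \<Longrightarrow> M \<in> X \<Longrightarrow> image_mset \<pi> M \<in> X"
  shows "(indicator X :: nat multiset \<Rightarrow> 'k::field) \<in> Sym"
proof -
  have "image_mset \<pi> M \<in> X \<longleftrightarrow> M \<in> X" if \<pi>: "\<pi> permutes {1..n}" for \<pi> n M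
    using assms(2)[OF \<pi>, of M] assms(2)[OF permutes_inv[OF \<pi>], of "image_mset \<pi> M"]
      image_mset_perm_inv[OF permutes_bij[OF \<pi>]] by auto
  then show ?thesis
    using assms(1) by (intro SymI[where d = d]) (auto simp: indicator_def split: if_splits)
qed

lemma ps_mult_in_Sym:
  assumes f: "f \<in> Sym" and g: "(g :: nat multiset \<Rightarrow> 'k::field) \<in> Sym"
  shows "ps_mult f g \<in> Sym"
proof -
  obtain d e where d: "\<And>M. f M \<noteq> 0 \<Longrightarrow> size M \<le> d" and e: "\<And>M. g M \<noteq> 0 \<Longrightarrow> size M \<le> e"
    using f g by (auto simp: Sym_def)
  have supp: "set_mset M \<subseteq> {1..} \<and> size M \<le> d + e" if nz: "ps_mult f g M \<noteq> 0" for M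
  proof -
    obtain A where A: "A \<subseteq># M" "f A \<noteq> 0" "g (M - A) \<noteq> 0"
      using nz by (rule ps_mult_nonzero)
    then obtain D where D: "M = A + D"
      by (auto simp: mset_subset_eq_exists_conv)
    then show ?thesis
      using A d[of A] e[of D] Sym_support[OF f, of A] Sym_support[OF g, of D] by auto
  qed
  have "ps_mult f g (image_mset \<pi> M) = ps_mult f g M" if \<pi>: "\<pi> permutes {1..n}" for \<pi> n M
    unfolding ps_mult_def
  proof (rule sum.reindex_bij_witness[where i = "image_mset \<pi>" and j = "image_mset (inv \<pi>)"])
    note inv = image_mset_perm_inv[OF permutes_bij[OF \<pi>]]
    fix A assume "A \<in> {A. A \<subseteq># image_mset \<pi> M}"
    then have A: "A \<subseteq># image_mset \<pi> M"
      by simp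
    show "image_mset \<pi> (image_mset (inv \<pi>) A) = A"
      by (rule inv)
    have sub: "image_mset (inv \<pi>) A \<subseteq># M"
      using image_mset_subseteq_mono[OF A, of "inv \<pi>"] by (simp only: inv)
    then show "image_mset (inv \<pi>) A \<in> {A. A \<subseteq># M}"
      by simp
    have "image_mset \<pi> (M - image_mset (inv \<pi>) A) = image_mset \<pi> M - A"
      using image_mset_Diff[OF sub, of \<pi>] by (simp only: inv)
    then show "f (image_mset (inv \<pi>) A) * g (M - image_mset (inv \<pi>) A) = f A * g (image_mset \<pi> M - A)"
      using Sym_permute[OF f \<pi>, of "image_mset (inv \<pi>) A"] Sym_permute[OF g \<pi>, of "M - image_mset (inv \<pi>) A"]
      by (simp only: inv)
  next
    fix A assume "A \<in> {A. A \<subseteq># M}"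
    then show "image_mset (inv \<pi>) (image_mset \<pi> A) = A" "image_mset \<pi> A \<in> {A. A \<subseteq># image_mset \<pi> M}"
      using image_mset_perm_inv[OF permutes_bij[OF \<pi>]] by (auto intro: image_mset_subseteq_mono)
  qed
  then show ?thesis
    using supp by (intro SymI)
qed

lemma foldr_ps_mult_in_Sym:
  assumes "\<And>k. g k \<in> Sym"
  shows "foldr ps_mult (map g l) ps_one \<in> (Sym :: (nat multiset \<Rightarrow> 'k::field) set)"
proof (induction l)
  case Nil
  show ?case
    unfolding ps_one_def by (auto intro!: indicator_in_Sym[where d = 0])
next
  case (Cons k l)
  then show ?case
    using assms by (simp add: ps_mult_in_Sym)
qed

lemma permute_positive_mset:
  assumes "\<pi> permutes {1..n::nat}" "set_mset M \<subseteq> {1..}"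
  shows "set_mset (image_mset \<pi> M) \<subseteq> {1..}"
  using assms(2) permutes_positive[OF assms(1)] by auto

lemma sym_p_in_Sym: "(sym_p l :: nat multiset \<Rightarrow> 'k::field) \<in> Sym"
  unfolding sym_p_def
proof (rule foldr_ps_mult_in_Sym)
  fix k
  show "(indicator {replicate_mset k i | i. 1 \<le> i} :: nat multiset \<Rightarrow> 'k) \<in> Sym"
  proof (rule indicator_in_Sym[where d = k])
    fix \<pi> and n :: nat and M :: "nat multiset" assume \<pi>: "(\<pi> :: nat \<Rightarrow> nat) permutes {1..n}" and "M \<in> {replicate_mset k i | i. 1 \<le> i}"
    then obtain i where "M = replicate_mset k i" "1 \<le> i"
      by auto
    then have "image_mset \<pi> M = replicate_mset k (\<pi> i)" "1 \<le> \<pi> i"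
      using permutes_positive[OF \<pi>] by (simp_all only: image_replicate_mset)
    then show "image_mset \<pi> M \<in> {replicate_mset k i | i. 1 \<le> i}"
      by blast
  qed (auto split: if_splits)
qed

lemma count_image_mset_bij:
  assumes "bij \<pi>"
  shows "count (image_mset \<pi> M) i = count M (inv \<pi> i)"
proof -
  have "count (image_mset \<pi> M) (\<pi> x) = count M x" for x
    using bij_is_inj[OF assms] by (induction M) (auto dest: injD)
  from this[of "inv \<pi> i"] show ?thesis
    by (simp add: surj_f_inv_f[OF bij_is_surj[OF assms]])
qed

lemma sym_e_in_Sym: "(sym_e l :: nat multiset \<Rightarrow> 'k::field) \<in> Sym"
  unfolding sym_e_def
proof (rule foldr_ps_mult_in_Sym)
  fix k
  show "(indicator {M. set_mset M \<subseteq> {1..} \<and> size M = k \<and> (\<forall>i. count M i \<le> 1)} :: nat multiset \<Rightarrow> 'k) \<in> Sym"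
  proof (rule indicator_in_Sym[where d = k])
    fix \<pi> and n :: nat and M :: "nat multiset" assume \<pi>: "(\<pi> :: nat \<Rightarrow> nat) permutes {1..n}"
      and M: "M \<in> {M. set_mset M \<subseteq> {1..} \<and> size M = k \<and> (\<forall>i. count M i \<le> 1)}"
    then show "image_mset \<pi> M \<in> {M. set_mset M \<subseteq> {1..} \<and> size M = k \<and> (\<forall>i. count M i \<le> 1)}"
      using permute_positive_mset[OF \<pi>, of M] by (simp add: count_image_mset_bij[OF permutes_bij[OF \<pi>]])
  qed auto
qed

lemma sym_h_in_Sym: "(sym_h l :: nat multiset \<Rightarrow> 'k::field) \<in> Sym"
  unfolding sym_h_def
proof (rule foldr_ps_mult_in_Sym)
  fix k
  show "(indicator {M. set_mset M \<subseteq> {1..} \<and> size M = k} :: nat multiset \<Rightarrow> 'k) \<in> Sym"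
  proof (rule indicator_in_Sym[where d = k])
    fix \<pi> and n :: nat and M :: "nat multiset" assume \<pi>: "(\<pi> :: nat \<Rightarrow> nat) permutes {1..n}"
      and "M \<in> {M. set_mset M \<subseteq> {1..} \<and> size M = k}"
    then show "image_mset \<pi> M \<in> {M. set_mset M \<subseteq> {1..} \<and> size M = k}"
      using permute_positive_mset[OF \<pi>, of M] by simp
  qed auto
qed

lemma sym_m_in_Sym: "(sym_m l :: nat multiset \<Rightarrow> 'k::field) \<in> Sym"
  unfolding sym_m_def
proof (rule indicator_in_Sym[where d = "sum_list l"])
  fix M :: "nat multiset"
  assume M: "M \<in> {M. set_mset M \<subseteq> {1..} \<and> image_mset (count M) (mset_set (set_mset M)) = mset l}"
  have "size M = sum_mset (image_mset (count M) (mset_set (set_mset M)))"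
    by (simp add: size_multiset_overloaded_eq sum_unfold_sum_mset)
  then show "set_mset M \<subseteq> {1..} \<and> size M \<le> sum_list l"
    using M by (simp add: sum_mset_sum_list)
next
  fix \<pi> and n :: nat and M :: "nat multiset" assume \<pi>: "(\<pi> :: nat \<Rightarrow> nat) permutes {1..n}"
    and M: "M \<in> {M. set_mset M \<subseteq> {1..} \<and> image_mset (count M) (mset_set (set_mset M)) = mset l}"
  have bij: "bij \<pi>"
    using \<pi> by (rule permutes_bij)
  have "mset_set (set_mset (image_mset \<pi> M)) = image_mset \<pi> (mset_set (set_mset M))"
    using bij_is_inj[OF bij] by (simp add: image_mset_mset_set inj_on_subset[OF _ subset_UNIV])
  then have "image_mset (count (image_mset \<pi> M)) (mset_set (set_mset (image_mset \<pi> M)))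
      = image_mset (count M) (mset_set (set_mset M))"
    by (simp only: multiset.map_comp comp_def count_image_mset_bij[OF bij] inv_f_f[OF bij_is_inj[OF bij]])
  then show "image_mset \<pi> M \<in> {M. set_mset M \<subseteq> {1..} \<and> image_mset (count M) (mset_set (set_mset M)) = mset l}"
    using M permute_positive_mset[OF \<pi>, of M] by (simp del: set_image_mset)
qed

lemma rho_in_Sym:
  assumes f: "(f :: nat list \<Rightarrow> 'k::field) \<in> NCSym"
  shows "rho f \<in> Sym"
proof -
  have supp: "set w \<subseteq> {1..}" if "f w \<noteq> 0" for w
    using f that by (auto simp: NCSym_def)
  obtain d where d: "\<And>w. f w \<noteq> 0 \<Longrightarrow> length w \<le> d"
    using f by (auto simp: NCSym_def)
  have sub: "set_mset M \<subseteq> {1..} \<and> size M \<le> d" if "rho f M \<noteq> 0" for M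
  proof -
    have "\<exists>w\<in>{w. mset w = M}. f w \<noteq> 0"
    proof (rule ccontr)
      assume "\<not> (\<exists>w\<in>{w. mset w = M}. f w \<noteq> 0)"
      then have "rho f M = 0"
        unfolding rho_def by (intro sum.neutral) auto
      then show False
        using that by simp
    qed
    then obtain w where "mset w = M" "f w \<noteq> 0"
      by auto
    then show ?thesis
      using supp[of w] d[of w] by auto
  qed
  have "rho f (image_mset \<pi> M) = rho f M" if \<pi>: "\<pi> permutes {1..n}" for \<pi> n M
    unfolding rho_def
  proof (rule sum.reindex_bij_witness[where i = "map \<pi>" and j = "map (inv \<pi>)"])
    have bij: "bij \<pi>"
      using \<pi> by (rule permutes_bij)
    have inv: "map \<pi> (map (inv \<pi>) w) = w" "map (inv \<pi>) (map \<pi> w) = w" for w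
      using bij by (simp_all add: comp_def bij_is_inj surj_f_inv_f[OF bij_is_surj] map_idI)
    fix w
    show "map \<pi> (map (inv \<pi>) w) = w" "map (inv \<pi>) (map \<pi> w) = w"
      by (rule inv)+
    show "w \<in> {w. mset w = image_mset \<pi> M} \<Longrightarrow> map (inv \<pi>) w \<in> {w. mset w = M}"
      using image_mset_perm_inv[OF bij] by simp
    show "w \<in> {w. mset w = M} \<Longrightarrow> map \<pi> w \<in> {w. mset w = image_mset \<pi> M}"
      by simp
    have "f (map \<pi> (map (inv \<pi>) w)) = f (map (inv \<pi>) w)"
      using f \<pi> by (auto simp: NCSym_def simp del: map_map)
    then show "f (map (inv \<pi>) w) = f w"
      by (simp only: inv)
  qed
  then show ?thesis
    using sub by (intro SymI)
qed

lemma lift_in_NCSym: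
  assumes f: "(f :: nat multiset \<Rightarrow> 'k::field) \<in> Sym"
  shows "lift f \<in> NCSym"
proof -
  obtain d where d: "\<And>M. f M \<noteq> 0 \<Longrightarrow> size M \<le> d"
    using f by (auto simp: Sym_def)
  have "set w \<subseteq> {1..} \<and> length w \<le> d" if "lift f w \<noteq> 0" for w
    using that Sym_support[OF f, of "mset w"] d[of "mset w"] by (auto simp: lift_def)
  moreover have "lift f (map \<pi> w) = lift f w" if \<pi>: "\<pi> permutes {1..n}" for \<pi> n w
    using Sym_permute[OF f \<pi>] mult_fact_image_inj[OF permutes_inj[OF \<pi>]] by (simp add: lift_def)
  ultimately show ?thesis
    unfolding NCSym_def by blast
qed

text \<open>A multiset \<open>M\<close> of size \<open>n\<close> has \<open>n! / mult_fact M\<close> rearrangements, and \<open>lift f\<close> has the coefficient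
  \<open>mult_fact M * f M\<close> at each of them.\<close>

lemma rho_lift:
  fixes f :: "nat multiset \<Rightarrow> 'k::field"
  assumes "f \<in> Sym_degree n"
  shows "rho (lift f) = fscale (of_nat (fact n)) f"
proof
  fix M
  have "rho (lift f) M = (\<Sum>w | mset w = M. of_nat (mult_fact M) * f M)"
    unfolding rho_def by (intro sum.cong refl) (auto simp: lift_def)
  also have "\<dots> = of_nat (card (permutations_of_multiset M) * mult_fact M) * f M"
    by (simp add: permutations_of_multiset_def)
  also have "card (permutations_of_multiset M) * mult_fact M = fact (size M)"
    unfolding mult_fact_def by (rule card_permutations_of_multiset_aux)
  also have "of_nat (fact (size M)) * f M = of_nat (fact n) * f M"
    using assms by (cases "f M = 0") (auto simp: Sym_degree_def)
  finally show "rho (lift f) M = fscale (of_nat (fact n)) f M"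
    by (simp add: fscale_def)
qed


section \<open>Sums over the symmetric group\<close>

text \<open>Each element of the orbit \<open>X\<close> is reached from \<open>x\<close> by as many permutations as the stabilizer of \<open>x\<close> has
  elements.\<close>

lemma orbit_sum:
  fixes F :: "'x \<Rightarrow> 'k::comm_semiring_1"
  assumes "finite I" "finite X"
    and closed: "\<And>\<pi>. \<pi> permutes I \<Longrightarrow> act \<pi> x \<in> X"
    and transitive: "\<And>y. y \<in> X \<Longrightarrow> \<exists>\<pi>. \<pi> permutes I \<and> act \<pi> x = y"
    and comp: "\<And>\<pi> \<pi>' y. \<pi> permutes I \<Longrightarrow> \<pi>' permutes I \<Longrightarrow> act (\<pi> \<circ> \<pi>') y = act \<pi> (act \<pi>' y)"
    and id: "act id x = x"
  shows "(\<Sum>\<pi> | \<pi> permutes I. F (act \<pi> x))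
       = of_nat (card {\<pi>. \<pi> permutes I \<and> act \<pi> x = x}) * (\<Sum>y\<in>X. F y)"
proof -
  have fiber: "card {\<pi>. \<pi> permutes I \<and> act \<pi> x = y} = card {\<pi>. \<pi> permutes I \<and> act \<pi> x = x}"
    if y: "y \<in> X" for y
  proof -
    obtain \<pi>0 where \<pi>0: "\<pi>0 permutes I" "act \<pi>0 x = y"
      using transitive[OF y] by blast
    have inv: "act (inv \<pi>0) y = x"
      using comp[OF permutes_inv[OF \<pi>0(1)] \<pi>0(1), of x] id permutes_inv_o(2)[OF \<pi>0(1)] \<pi>0(2) by simp
    have "bij_betw ((\<circ>) \<pi>0) {\<pi>. \<pi> permutes I \<and> act \<pi> x = x} {\<pi>. \<pi> permutes I \<and> act \<pi> x = y}"
    proof (rule bij_betw_byWitness[where f' = "(\<circ>) (inv \<pi>0)"])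
      show "(\<circ>) \<pi>0 ` {\<pi>. \<pi> permutes I \<and> act \<pi> x = x} \<subseteq> {\<pi>. \<pi> permutes I \<and> act \<pi> x = y}"
        using \<pi>0 comp by (auto intro: permutes_compose)
      show "(\<circ>) (inv \<pi>0) ` {\<pi>. \<pi> permutes I \<and> act \<pi> x = y} \<subseteq> {\<pi>. \<pi> permutes I \<and> act \<pi> x = x}"
        using permutes_inv[OF \<pi>0(1)] inv comp by (auto intro: permutes_compose)
    qed (use permutes_inv_o[OF \<pi>0(1)] in \<open>auto simp: comp_assoc[symmetric]\<close>)
    then show ?thesis
      by (simp add: bij_betw_same_card)
  qed
  have "(\<Sum>\<pi> | \<pi> permutes I. F (act \<pi> x)) = (\<Sum>y\<in>X. \<Sum>\<pi>\<in>{\<pi> \<in> {\<pi>. \<pi> permutes I}. act \<pi> x = y}. F (act \<pi> x))"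
    using assms(1,2) closed by (intro sum.group[symmetric] finite_permutations) auto
  also have "\<dots> = (\<Sum>y\<in>X. of_nat (card {\<pi>. \<pi> permutes I \<and> act \<pi> x = x}) * F y)"
  proof (rule sum.cong[OF refl])
    fix y assume y: "y \<in> X"
    have "(\<Sum>\<pi>\<in>{\<pi> \<in> {\<pi>. \<pi> permutes I}. act \<pi> x = y}. F (act \<pi> x))
        = (\<Sum>\<pi>\<in>{\<pi>. \<pi> permutes I \<and> act \<pi> x = y}. F y)"
      by (rule sum.cong) auto
    then show "(\<Sum>\<pi>\<in>{\<pi> \<in> {\<pi>. \<pi> permutes I}. act \<pi> x = y}. F (act \<pi> x))
        = of_nat (card {\<pi>. \<pi> permutes I \<and> act \<pi> x = x}) * F y"
      using fiber[OF y] by simp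
  qed
  finally show ?thesis
    by (simp only: sum_distrib_left)
qed

lemma same_type_conjugate:
  assumes "partition_on {1..n} P" "partition_on {1..n} Q" "setpart_type P = setpart_type Q"
  shows "\<exists>\<pi>. \<pi> permutes {1..n} \<and> setpart_act \<pi> P = Q"
proof -
  obtain \<sigma> \<tau> where \<sigma>: "\<sigma> permutes {1..n}" "orbit \<sigma> ` {1..n} = P"
    and \<tau>: "\<tau> permutes {1..n}" "orbit \<tau> ` {1..n} = Q"
    using ex_permutation_with_orbits[OF _ assms(1)] ex_permutation_with_orbits[OF _ assms(2)] by blast
  obtain \<pi> where \<pi>: "\<pi> permutes {1..n}" "perm_act \<pi> \<sigma> = \<tau>"
    using conjugate_if_same_orbit_sizes[OF _ \<sigma>(1) \<tau>(1)] assms(3)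
    unfolding setpart_type_eq_iff \<sigma>(2) \<tau>(2) by blast
  then show ?thesis
    using perm_act_orbits_setpart[OF _ \<pi>(1) \<sigma>(1)] \<sigma>(2) \<tau>(2) by auto
qed

lemma setpart_type_partition:
  assumes "partition_on {1..n} P"
  shows "int_partition n (setpart_type P)"
proof -
  have "sum_list (setpart_type P) = sum_mset (image_mset card (mset_set P))"
    by (simp flip: mset_setpart_type sum_mset_sum_list)
  also have "\<dots> = card {1..n}"
    using product_partition[OF assms partition_block_facts(1)[OF assms]] by (simp add: sum_unfold_sum_mset)
  finally have "sum_list (setpart_type P) = n"
    by simp
  moreover have "sorted_wrt (\<ge>) (setpart_type P)"
    by (simp add: setpart_type_def sorted_wrt_rev)
  moreover have "0 < k" if "k \<in> set (setpart_type P)" for k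
  proof -
    have "k \<in># image_mset card (mset_set P)"
      using that by (simp flip: mset_setpart_type)
    then obtain B where "B \<in> P" "k = card B"
      using finite_elements[OF _ assms] by auto
    then show ?thesis
      using partition_block_facts(1,2)[OF assms] by (simp add: card_gt_0_iff)
  qed
  ultimately show ?thesis
    by (simp add: int_partition_def)
qed

lemma sym_p_constant_word: "sym_p l (replicate_mset (sum_list l) 1) = (1 :: 'k::field)"
proof (induction l)
  case Nil
  show ?case
    by (simp add: sym_p_def ps_one_def)
next
  case (Cons k l)
  let ?M = "replicate_mset (sum_list (k # l)) (1 :: nat)"
  have "sym_p (k # l) ?M = (\<Sum>A | A \<subseteq># ?M. indicator {replicate_mset k i | i. 1 \<le> i} A * sym_p l (?M - A) :: 'k)"
    by (simp add: sym_p_def ps_mult_def)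
  also have "\<dots> = (\<Sum>A\<in>{replicate_mset k 1}. indicator {replicate_mset k i | i. 1 \<le> i} A * sym_p l (?M - A))"
  proof (rule sum.mono_neutral_right)
    show "finite {A. A \<subseteq># ?M}"
      by (rule finite_subset[of _ "(\<lambda>m. replicate_mset m 1) ` {..sum_list (k # l)}"])
        (auto simp: image_iff elim!: msubseteq_replicate_msetE)
    show "{replicate_mset k 1} \<subseteq> {A. A \<subseteq># ?M}"
      by (simp add: replicate_mset_msubseteq_iff)
    show "\<forall>A\<in>{A. A \<subseteq># ?M} - {replicate_mset k 1}. indicator {replicate_mset k i | i. 1 \<le> i} A * sym_p l (?M - A) = (0 :: 'k)"
    proof
      fix A assume A: "A \<in> {A. A \<subseteq># ?M} - {replicate_mset k 1}"
      then obtain m where m: "A = replicate_mset m 1"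
        by (auto elim!: msubseteq_replicate_msetE)
      have "A \<noteq> replicate_mset k i" for i
      proof
        assume eq: "A = replicate_mset k i"
        then have "size (replicate_mset m (1::nat)) = size (replicate_mset k i)"
          using m by simp
        then show False
          using A m by simp
      qed
      then show "indicator {replicate_mset k i | i. 1 \<le> i} A * sym_p l (?M - A) = (0 :: 'k)"
        by (auto simp: indicator_def)
    qed
  qed
  also have "\<dots> = sym_p l (?M - replicate_mset k 1)"
  proof -
    have "replicate_mset k (1 :: nat) \<in> {replicate_mset k i | i. 1 \<le> i}"
      by blast
    then show ?thesis
      by (subst sum.insert) (simp_all only: finite.emptyI empty_iff not_False_eq_True sum.empty add_0_right
          indicator_simps(1) mult_1_left)
  qed
  also have "?M - replicate_mset k 1 = replicate_mset (sum_list l) 1"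
    by (simp add: multiset_eq_iff)
  finally show ?case
    using Cons.IH by simp
qed

text \<open>The left-hand side is the sum of \<open>p\<^sub>Q\<close> over all \<open>Q\<close> of the type of \<open>P\<close>, multiplied by the order \<open>s\<close> of
  the stabilizer of \<open>P\<close>; by \<open>lift_sym_p\<close>, the right-hand side is another multiple of the same sum.  Both sides
  have the value \<open>n!\<close> at a constant word, where every \<open>p\<^sub>Q\<close> is 1, so that the multiples agree.\<close>

lemma sum_permutes_nc_p:
  assumes P: "partition_on {1..n} P"
  shows "(\<Sum>\<pi> | \<pi> permutes {1..n}. nc_p n (setpart_act \<pi> P)) = (lift (sym_p (setpart_type P)) :: _ \<Rightarrow> 'k::field_char_0)"
proof -
  let ?l = "setpart_type P"
  let ?X = "{Q. partition_on {1..n} Q \<and> setpart_type Q = ?l}"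
  define s where "s = card {\<pi>. \<pi> permutes {1..n} \<and> setpart_act \<pi> P = P}"
  define t where "t = parts_fact ?l * mults_fact ?l"
  have l: "int_partition n ?l"
    using P by (rule setpart_type_partition)
  have finX: "finite ?X"
    by (rule finite_subset[OF _ finitely_many_partition_on[of "{1..n}"]]) auto
  have sum: "(\<Sum>\<pi> | \<pi> permutes {1..n}. F (setpart_act \<pi> P)) = of_nat s * (\<Sum>Q\<in>?X. F Q :: 'k)" for F
    unfolding s_def
  proof (rule orbit_sum[OF _ finX])
    fix \<pi> :: "nat \<Rightarrow> nat" assume "\<pi> permutes {1..n}"
    then show "setpart_act \<pi> P \<in> ?X"
      using P by (auto intro: setpart_act_partition_on setpart_type_act permutes_bij)
  next
    fix Q assume "Q \<in> ?X"
    then show "\<exists>\<pi>. \<pi> permutes {1..n} \<and> setpart_act \<pi> P = Q"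
      using P by (intro same_type_conjugate) auto
  next
    show "setpart_act (\<pi> \<circ> \<pi>') Q = setpart_act \<pi> (setpart_act \<pi>' Q)" for \<pi> \<pi>' Q
      by (rule setpart_act_comp)
    show "setpart_act id P = P"
      by (simp only: setpart_act_def image_id id_apply image_ident)
  qed simp
  have lift_p: "lift (sym_p ?l) w = of_nat t * (\<Sum>Q\<in>?X. nc_p n Q w :: 'k)" for w
    unfolding lift_sym_p[OF l] sum_partitions_apply t_def ..
  have "of_nat t * of_nat (card ?X) = (of_nat s * of_nat (card ?X) :: 'k)"
  proof -
    let ?w = "replicate n (1 :: nat)"
    have w: "?w \<in> nc_words n"
      by (auto simp: nc_words_def)
    have "nc_p n Q ?w = (1 :: 'k)" for Q
      using w by (auto simp: nc_p_def indicator_def letter_def)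
    then have "of_nat t * of_nat (card ?X) = (lift (sym_p ?l) ?w :: 'k)"
      unfolding lift_p by simp
    also have "\<dots> = fact n"
      using sym_p_constant_word[of ?l] l by (simp add: lift_def int_partition_def mult_fact_replicate)
    also have "\<dots> = (\<Sum>\<pi> | \<pi> permutes {1..n}. 1)"
      using card_permutations[of "{1..n}" n] by simp
    also have "\<dots> = of_nat s * of_nat (card ?X)"
      using sum[of "\<lambda>_. 1"] by simp
    finally show ?thesis .
  qed
  moreover have "card ?X \<noteq> 0"
    using P finX by auto
  ultimately have "(of_nat t :: 'k) = of_nat s"
    by simp
  then show ?thesis
    by (intro ext) (simp only: lift_p sum_apply sum[of "\<lambda>Q. nc_p n Q _"])
qed

text \<open>The centralizer of \<open>\<sigma>\<close> is its stabilizer under conjugation, so that the left-hand side is the sum over all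
  \<open>\<pi>\<close> of the function of the orbit partition of \<open>\<pi>\<sigma>\<pi>\<^sup>-\<^sup>1\<close>, which is the image of the orbit partition of
  \<open>\<sigma>\<close> under \<open>\<pi>\<close>.\<close>

lemma centralizer_sum:
  assumes \<sigma>: "\<sigma> \<in> perms n"
  shows "fscale (of_nat (centralizer_order n \<sigma>))
      (\<Sum>\<tau> | \<tau> \<in> perms n \<and> cycle_type n \<tau> = cycle_type n \<sigma>. nc_p n (orbit \<tau> ` {1..n}))
    = (lift (sym_p (cycle_type n \<sigma>)) :: _ \<Rightarrow> 'k::field_char_0)"
proof
  fix w
  let ?X = "{\<tau>. \<tau> \<in> perms n \<and> cycle_type n \<tau> = cycle_type n \<sigma>}"
  have \<sigma>': "\<sigma> permutes {1..n}"
    using \<sigma> by (simp add: perms_def)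
  have finX: "finite ?X"
    by (rule finite_subset[of _ "perms n"]) (auto simp: perms_def finite_permutations)
  have stab: "perm_act \<pi> \<sigma> = \<sigma> \<longleftrightarrow> \<pi> \<circ> \<sigma> = \<sigma> \<circ> \<pi>" if "\<pi> permutes {1..n}" for \<pi>
  proof
    assume "perm_act \<pi> \<sigma> = \<sigma>"
    then have "\<pi> \<circ> \<sigma> \<circ> inv \<pi> \<circ> \<pi> = \<sigma> \<circ> \<pi>"
      by (simp add: perm_act_def)
    then show "\<pi> \<circ> \<sigma> = \<sigma> \<circ> \<pi>"
      by (simp add: comp_assoc permutes_inv_o(2)[OF that])
  next
    assume "\<pi> \<circ> \<sigma> = \<sigma> \<circ> \<pi>"
    then show "perm_act \<pi> \<sigma> = \<sigma>"
      by (simp add: perm_act_def comp_assoc permutes_inv_o(1)[OF that])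
  qed
  have "(\<Sum>\<pi> | \<pi> permutes {1..n}. nc_p n (orbit (perm_act \<pi> \<sigma>) ` {1..n}) w)
      = of_nat (card {\<pi>. \<pi> permutes {1..n} \<and> perm_act \<pi> \<sigma> = \<sigma>}) * (\<Sum>\<tau>\<in>?X. nc_p n (orbit \<tau> ` {1..n}) w :: 'k)"
  proof (rule orbit_sum[OF _ finX])
    fix \<pi> :: "nat \<Rightarrow> nat" assume \<pi>: "\<pi> permutes {1..n}"
    then show "perm_act \<pi> \<sigma> \<in> ?X"
      using perm_act_permutes[OF \<pi> \<sigma>'] perm_act_orbits_setpart[OF _ \<pi> \<sigma>'] setpart_type_act[OF permutes_bij[OF \<pi>]]
      by (simp add: perms_def cycle_type_def)
  next
    fix \<tau> assume "\<tau> \<in> ?X"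
    then show "\<exists>\<pi>. \<pi> permutes {1..n} \<and> perm_act \<pi> \<sigma> = \<tau>"
      using \<sigma>' by (intro conjugate_if_same_orbit_sizes) (auto simp: perms_def cycle_type_def setpart_type_eq_iff)
  next
    show "perm_act (\<pi> \<circ> \<pi>') \<tau> = perm_act \<pi> (perm_act \<pi>' \<tau>)"
      if "\<pi> permutes {1..n}" "\<pi>' permutes {1..n}" for \<pi> \<pi>' \<tau>
      using that by (intro perm_act_comp permutes_bij)
    show "perm_act id \<sigma> = \<sigma>"
      by (simp add: perm_act_def)
  qed simp
  also have "card {\<pi>. \<pi> permutes {1..n} \<and> perm_act \<pi> \<sigma> = \<sigma>} = centralizer_order n \<sigma>"
    unfolding centralizer_order_def using stab by (intro arg_cong[where f = card]) auto
  also have "(\<Sum>\<pi> | \<pi> permutes {1..n}. nc_p n (orbit (perm_act \<pi> \<sigma>) ` {1..n}) w)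
      = (\<Sum>\<pi> | \<pi> permutes {1..n}. nc_p n (setpart_act \<pi> (orbit \<sigma> ` {1..n}))) w"
    unfolding sum_apply using \<sigma>' by (intro sum.cong refl) (simp add: perm_act_orbits_setpart)
  also have "\<dots> = (lift (sym_p (cycle_type n \<sigma>)) w :: 'k)"
    unfolding cycle_type_def using sum_permutes_nc_p[OF partition_on_orbits[OF finite_atLeastAtMost \<sigma>']]
    by (rule fun_cong)
  finally show "fscale (of_nat (centralizer_order n \<sigma>))
      (\<Sum>\<tau> | \<tau> \<in> perms n \<and> cycle_type n \<tau> = cycle_type n \<sigma>. nc_p n (orbit \<tau> ` {1..n})) w
    = (lift (sym_p (cycle_type n \<sigma>)) w :: 'k)"
    by (simp only: fscale_def sum_apply)
qed


section \<open>Power sums span the symmetric functions\<close>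

text \<open>Each position receives the smallest position of its block as its letter.\<close>

lemma ex_word_with_kernel:
  assumes "partition_on {1..n} P"
  shows "\<exists>w. w \<in> nc_words n \<and> word_kernel n w = P"
proof -
  let ?w = "map (\<lambda>j. Min {k \<in> {1..n}. \<exists>B\<in>P. Suc j \<in> B \<and> k \<in> B}) [0..<n]"
  have letter: "letter ?w j = Min {k \<in> {1..n}. \<exists>B\<in>P. j \<in> B \<and> k \<in> B}" if "j \<in> {1..n}" for j
    using that by (cases j) (auto simp: letter_def)
  have block: "{k \<in> {1..n}. \<exists>B\<in>P. j \<in> B \<and> k \<in> B} = B" if "B \<in> P" "j \<in> B" for B j
    using that partition_on_block_unique[OF assms] partition_block_facts(3)[OF assms] by blast
  have Min: "Min B \<in> B" if "B \<in> P" for B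
    using partition_block_facts(1,2)[OF assms that] by simp
  have same: "letter ?w j = letter ?w k \<longleftrightarrow> (\<exists>B\<in>P. j \<in> B \<and> k \<in> B)" if jk: "j \<in> {1..n}" "k \<in> {1..n}" for j k
  proof -
    obtain B C where BC: "B \<in> P" "j \<in> B" "C \<in> P" "k \<in> C"
      using jk partition_onD1[OF assms] by blast
    have letters: "letter ?w j = Min B" "letter ?w k = Min C"
      using BC jk letter block by simp_all
    show ?thesis
    proof
      assume "letter ?w j = letter ?w k"
      then have "Min B \<in> C"
        using letters Min[OF BC(3)] by simp
      then have "B = C"
        using partition_on_block_unique[OF assms BC(1,3) Min[OF BC(1)]] by simp
      then show "\<exists>B\<in>P. j \<in> B \<and> k \<in> B"
        using BC by auto
    next
      assume "\<exists>B\<in>P. j \<in> B \<and> k \<in> B"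
      then have "B = C"
        using BC partition_on_block_unique[OF assms] by metis
      then show "letter ?w j = letter ?w k"
        using letters by simp
    qed
  qed
  have pos: "1 \<le> letter ?w j" if j: "j \<in> {1..n}" for j
  proof -
    obtain B where B: "B \<in> P" "j \<in> B"
      using j partition_onD1[OF assms] by blast
    then show ?thesis
      using letter[OF j] block Min[OF B(1)] partition_block_facts(3)[OF assms B(1)] by force
  qed
  have "set ?w \<subseteq> {1..}"
  proof
    fix x assume "x \<in> set ?w"
    then obtain i where i: "i < n" "x = ?w ! i"
      by (auto simp: in_set_conv_nth)
    then have "x = letter ?w (Suc i)"
      by (simp add: letter_def)
    then show "x \<in> {1..}"
      using pos[of "Suc i"] i by simp
  qed
  then have w: "?w \<in> nc_words n"
    by (simp add: nc_words_def)
  have "nc_m n P ?w = (1 :: rat)"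
    using w same by (simp add: nc_m_def indicator_def)
  moreover have "nc_m n P ?w = (if P = word_kernel n ?w then 1 else 0 :: rat)"
    by (rule nc_m_kernel[OF w assms])
  ultimately have "word_kernel n ?w = P"
    by (simp split: if_splits)
  then show ?thesis
    using w by blast
qed

text \<open>The letters of one word are renamed injectively to those of the other; an arbitrary bijection of the remaining
  elements of an initial segment completes this to a permutation.\<close>

lemma same_kernel_relabel:
  assumes "w \<in> nc_words n" "w' \<in> nc_words n" "word_kernel n w = word_kernel n w'"
  shows "\<exists>N \<pi>. \<pi> permutes {1..N} \<and> map \<pi> w = w'"
proof -
  have len: "length w = n" "length w' = n"
    using assms by (auto simp: nc_words_def)
  have same: "w ! i = w ! j \<longleftrightarrow> w' ! i = w' ! j" if "i < n" "j < n" for i j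
    using kernel_same_block[of "Suc i" n "Suc j" w] kernel_same_block[of "Suc i" n "Suc j" w'] that
    by (simp add: assms(3) letter_def)
  define N where "N = Max (insert 0 (set w \<union> set w'))"
  have sub: "set w \<subseteq> {1..N}" "set w' \<subseteq> {1..N}"
    using assms(1,2) by (auto simp: N_def nc_words_def intro!: Max_ge)
  define f where "f x = w' ! (LEAST i. i < n \<and> w ! i = x)" for x
  have f: "f (w ! i) = w' ! i" if "i < n" for i
  proof -
    have "(LEAST j. j < n \<and> w ! j = w ! i) < n \<and> w ! (LEAST j. j < n \<and> w ! j = w ! i) = w ! i"
      by (rule LeastI) (use that in simp)
    then show ?thesis
      using same[of "LEAST j. j < n \<and> w ! j = w ! i" i] that by (simp add: f_def)
  qed
  have im: "f ` set w = set w'"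
  proof -
    have "set w = (!) w ` {..<n}" "set w' = (!) w' ` {..<n}"
      using len by (auto simp: set_conv_nth)
    then show ?thesis
      using f by (auto simp: image_iff)
  qed
  have inj: "inj_on f (set w)"
    by (rule inj_onI) (use f same len in \<open>auto simp: in_set_conv_nth\<close>)
  have "card ({1..N} - set w) = card ({1..N} - set w')"
    using sub card_image[OF inj] im by (simp add: card_Diff_subset)
  then obtain g where g: "bij_betw g ({1..N} - set w) ({1..N} - set w')"
    using finite_same_card_bij[of "{1..N} - set w" "{1..N} - set w'"] by auto
  define \<pi> where "\<pi> x = (if x \<in> set w then f x else if x \<in> {1..N} then g x else x)" for x
  have "bij_betw \<pi> (set w) (set w')"
    using inj im by (subst bij_betw_cong[of _ _ f]) (auto simp: \<pi>_def bij_betw_def)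
  moreover have "bij_betw \<pi> ({1..N} - set w) ({1..N} - set w')"
    using g by (subst bij_betw_cong[of _ _ g]) (auto simp: \<pi>_def)
  ultimately have "bij_betw \<pi> (set w \<union> ({1..N} - set w)) (set w' \<union> ({1..N} - set w'))"
    by (rule bij_betw_combine) auto
  moreover have "set w \<union> ({1..N} - set w) = {1..N}" "set w' \<union> ({1..N} - set w') = {1..N}"
    using sub by auto
  ultimately have "\<pi> permutes {1..N}"
    using sub(1) by (intro bij_imp_permutes) (auto simp: \<pi>_def)
  moreover have "map \<pi> w = w'"
    using f len by (intro nth_equalityI) (auto simp: \<pi>_def)
  ultimately show ?thesis
    by blast
qed

text \<open>A noncommutative symmetric function takes the same value at all words with the same kernel, and \<open>p\<^sub>Q\<close> is the
  indicator of the words whose kernel is coarser than \<open>Q\<close>.  The coefficients are therefore obtained by Moebius inversion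
  from the values at words \<open>v P\<close> with kernel \<open>P\<close>.\<close>

lemma NCSym_combination_of_nc_p:
  fixes F :: "nat list \<Rightarrow> 'k::field"
  assumes F: "F \<in> NCSym"
  shows "\<exists>d. \<forall>w\<in>nc_words n. F w = (\<Sum>Q\<in>setparts n. d Q * nc_p n Q w)"
proof -
  let ?r = "setpart_order {1..n}"
  obtain v where v: "\<And>P. P \<in> setparts n \<Longrightarrow> v P \<in> nc_words n \<and> word_kernel n (v P) = P"
    using ex_word_with_kernel unfolding setparts_def by (metis mem_Collect_eq)
  define d where "d Q = (\<Sum>P | (P, Q) \<in> ?r. of_int (mobius ?r P Q) * F (v P))" for Q
  have "F w = (\<Sum>Q\<in>setparts n. d Q * nc_p n Q w)" if w: "w \<in> nc_words n" for w
  proof -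
    let ?K = "word_kernel n w"
    have K: "?K \<in> setparts n"
      unfolding setparts_def using kernel_partition by blast
    have nc: "nc_p n Q w = (if (Q, ?K) \<in> ?r then 1 else 0 :: 'k)" if "Q \<in> setparts n" for Q
      using that by (subst nc_p_kernel[OF w]) (simp_all add: setparts_def setpart_order_def)
    have "(\<Sum>Q\<in>setparts n. d Q * nc_p n Q w)
        = (\<Sum>Q | (Q, ?K) \<in> ?r. \<Sum>P | (P, Q) \<in> ?r. of_int (mobius ?r P Q) * F (v P))"
    proof (rule sum.mono_neutral_cong_right[OF Pi.deg.finite_carrier])
      show "{Q. (Q, ?K) \<in> ?r} \<subseteq> setparts n"
        using Pi.deg.r_carrier(1)[of _ _ n] by blast
      then show "d Q * nc_p n Q w = (\<Sum>P | (P, Q) \<in> ?r. of_int (mobius ?r P Q) * F (v P))"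
        if "Q \<in> {Q. (Q, ?K) \<in> ?r}" for Q
        using that nc[of Q] by (auto simp: d_def)
    qed (simp add: nc)
    also have "\<dots> = F (v ?K)"
    proof (rule Pi.deg.sum_below_collapse[OF K])
      show "(\<Sum>Q | (P, Q) \<in> ?r \<and> (Q, ?K) \<in> ?r. of_int (mobius ?r P Q)) = (if P = ?K then 1 else 0 :: 'k)"
        if "(P, ?K) \<in> ?r" for P
        using arg_cong[OF Pi.deg.sum_mobius_above[OF that], of "of_int :: int \<Rightarrow> 'k"] by simp
    qed
    also have "\<dots> = F w"
    proof -
      obtain N \<pi> where \<pi>: "\<pi> permutes {1..N}" "map \<pi> (v ?K) = w"
        using same_kernel_relabel[of "v ?K" n w] v[OF K] w by auto
      have "F (map \<pi> (v ?K)) = F (v ?K)"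
        using F \<pi>(1) unfolding NCSym_def by blast
      then show ?thesis
        by (simp only: \<pi>(2))
    qed
    finally show ?thesis ..
  qed
  then show ?thesis
    by blast
qed

text \<open>Moving the blocks by \<open>\<pi>\<close> has the same effect as permuting the positions of the word.\<close>

lemma nc_p_setpart_act:
  assumes \<pi>: "\<pi> permutes {1..n}" and w: "w \<in> nc_words n"
  shows "\<exists>w'\<in>nc_words n. mset w' = mset w \<and> (\<forall>Q. nc_p n (setpart_act \<pi> Q) w = (nc_p n Q w' :: 'k::field))"
proof -
  let ?w = "map (\<lambda>i. letter w (\<pi> (Suc i))) [0..<n]"
  have len: "length w = n"
    using w by (simp add: nc_words_def)
  have letter: "letter ?w j = letter w (\<pi> j)" if "j \<in> {1..n}" for j
    using that by (cases j) (auto simp: letter_def)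
  have "mset ?w = content (letter ?w) {1..n}"
    by (rule content_letters[symmetric]) simp
  also have "\<dots> = image_mset (\<lambda>j. letter w (\<pi> j)) (mset_set {1..n})"
    by (rule image_mset_cong) (use letter in simp)
  also have "\<dots> = image_mset (letter w) (image_mset \<pi> (mset_set {1..n}))"
    by (simp add: multiset.map_comp comp_def)
  also have "image_mset \<pi> (mset_set {1..n}) = mset_set {1..n}"
    by (simp only: image_mset_mset_set[OF permutes_inj_on[OF \<pi>]] permutes_image[OF \<pi>])
  also have "image_mset (letter w) (mset_set {1..n}) = mset w"
    by (rule content_letters[OF len])
  finally have mset: "mset ?w = mset w" .
  then have w': "?w \<in> nc_words n"
    using w mset_eq_setD[OF mset] by (simp add: nc_words_def)
  have "nc_p n (setpart_act \<pi> Q) w = (nc_p n Q ?w :: 'k)" for Q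
  proof -
    have inj: "\<pi> j \<in> \<pi> ` B \<longleftrightarrow> j \<in> B" for j B
      using permutes_inj[OF \<pi>] by (auto dest: injD)
    let ?R = "\<lambda>j k. (\<exists>B\<in>setpart_act \<pi> Q. j \<in> B \<and> k \<in> B) \<longrightarrow> letter w j = letter w k"
    have "(\<forall>j\<in>{1..n}. \<forall>k\<in>{1..n}. ?R j k) \<longleftrightarrow> (\<forall>j\<in>\<pi> ` {1..n}. \<forall>k\<in>\<pi> ` {1..n}. ?R j k)"
      by (simp only: permutes_image[OF \<pi>])
    also have "\<dots> \<longleftrightarrow> (\<forall>j\<in>{1..n}. \<forall>k\<in>{1..n}. ?R (\<pi> j) (\<pi> k))"
      by simp
    also have "\<dots> \<longleftrightarrow> (\<forall>j\<in>{1..n}. \<forall>k\<in>{1..n}. (\<exists>B\<in>Q. j \<in> B \<and> k \<in> B) \<longrightarrow> letter ?w j = letter ?w k)"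
      by (intro ball_cong refl) (simp only: letter setpart_act_def bex_simps inj)
    finally show ?thesis
      using w w' by (simp only: nc_p_def indicator_def mem_Collect_eq simp_thms)
  qed
  then show ?thesis
    using mset w' by blast
qed

text \<open>The value of \<open>lift f\<close> at a word does not change when its positions are permuted.  Averaging a combination of
  the \<open>p\<^sub>Q\<close> over these permutations gives a combination of lifts of power sums by \<open>sum_permutes_nc_p\<close>, and the
  common factor \<open>mult_fact M\<close> of all the lifts can be cancelled.\<close>

lemma Sym_combination_of_sym_p:
  fixes f :: "nat multiset \<Rightarrow> 'k::field_char_0"
  assumes f: "f \<in> Sym"
  shows "\<exists>d. \<forall>M. size M = n \<longrightarrow> f M = (\<Sum>Q\<in>setparts n. d Q * sym_p (setpart_type Q) M)"
proof -
  obtain d where d: "\<And>w. w \<in> nc_words n \<Longrightarrow> lift f w = (\<Sum>Q\<in>setparts n. d Q * nc_p n Q w)"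
    using NCSym_combination_of_nc_p[OF lift_in_NCSym[OF f]] by blast
  have "f M = (\<Sum>Q\<in>setparts n. d Q / fact n * sym_p (setpart_type Q) M)" if M: "size M = n" for M
  proof (cases "set_mset M \<subseteq> {1..}")
    case True
    obtain w where w: "mset w = M"
      using ex_mset by blast
    have nc: "w \<in> nc_words n"
      using w True M by (auto simp: nc_words_def)
    have perm: "lift f w = (\<Sum>Q\<in>setparts n. d Q * nc_p n (setpart_act \<pi> Q) w)"
      if \<pi>: "\<pi> permutes {1..n}" for \<pi>
    proof -
      obtain w' where w': "w' \<in> nc_words n" "mset w' = mset w"
        "\<And>Q. nc_p n (setpart_act \<pi> Q) w = (nc_p n Q w' :: 'k)"
        using nc_p_setpart_act[OF \<pi> nc] by blast
      have "lift f w = lift f w'"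
        by (simp add: lift_def w'(2))
      then show ?thesis
        by (simp only: d[OF w'(1)] w'(3))
    qed
    have "fact n * lift f w = (\<Sum>\<pi> | \<pi> permutes {1..n}. lift f w)"
      using card_permutations[of "{1..n}" n] by simp
    also have "\<dots> = (\<Sum>\<pi> | \<pi> permutes {1..n}. \<Sum>Q\<in>setparts n. d Q * nc_p n (setpart_act \<pi> Q) w)"
      using perm by (intro sum.cong refl) auto
    also have "\<dots> = (\<Sum>Q\<in>setparts n. \<Sum>\<pi> | \<pi> permutes {1..n}. d Q * nc_p n (setpart_act \<pi> Q) w)"
      by (rule sum.swap)
    also have "\<dots> = (\<Sum>Q\<in>setparts n. d Q * lift (sym_p (setpart_type Q)) w)"
    proof (rule sum.cong[OF refl])
      fix Q assume "Q \<in> setparts n"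
      then show "(\<Sum>\<pi> | \<pi> permutes {1..n}. d Q * nc_p n (setpart_act \<pi> Q) w) = d Q * lift (sym_p (setpart_type Q)) w"
        using sum_permutes_nc_p[of n Q] by (simp add: setparts_def sum_distrib_left sum_apply flip: sum_permutes_nc_p)
    qed
    also have "\<dots> = of_nat (mult_fact M) * (\<Sum>Q\<in>setparts n. d Q * sym_p (setpart_type Q) M)"
      by (simp add: lift_def w sum_distrib_left mult_ac)
    finally have "of_nat (mult_fact M) * (fact n * f M) = of_nat (mult_fact M) * (\<Sum>Q\<in>setparts n. d Q * sym_p (setpart_type Q) M)"
      by (simp add: lift_def w mult_ac)
    then have "fact n * f M = (\<Sum>Q\<in>setparts n. d Q * sym_p (setpart_type Q) M)"
      using mult_fact_pos[of M] by simp
    then show ?thesis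
      by (simp add: sum_divide_distrib[symmetric] field_simps)
  next
    case False
    then have "f M = 0" "sym_p l M = (0 :: 'k)" for l
      using Sym_support[OF f] Sym_support[OF sym_p_in_Sym] by blast+
    then show ?thesis
      by simp
  qed
  then show ?thesis
    by (intro exI[of _ "\<lambda>Q. d Q / fact n"]) auto
qed


section \<open>The spaces and maps of the composition\<close>

lemma (in graded_poset) linear_ext_bounded:
  fixes w :: "nat \<times> 'b \<Rightarrow> ('c \<Rightarrow> 'k::field)"
  assumes "x \<in> graded_space B" "\<And>n b. b \<in> B n \<Longrightarrow> graded_coord r (n, b) x \<noteq> 0 \<Longrightarrow> n \<le> d"
  shows "linear_ext fscale (SIGMA n:UNIV. B n) basis w x
       = (\<Sum>n\<le>d. \<Sum>b\<in>B n. fscale (graded_coord r (n, b) x) (w (n, b)))"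
proof -
  have "linear_ext fscale (SIGMA n:UNIV. B n) basis w x
      = (\<Sum>j\<in>(SIGMA n:{..d}. B n). fscale (graded_coord r j x) (w j))"
    using assms deg.finite_carrier by (intro linear_ext_graded) auto
  also have "\<dots> = (\<Sum>n\<le>d. \<Sum>b\<in>B n. fscale (graded_coord r (n, b) x) (w (n, b)))"
    using deg.finite_carrier by (subst sum.Sigma) (auto simp: split_def)
  finally show ?thesis .
qed

lemma (in graded_poset) coords_bounded:
  assumes "x \<in> graded_space B"
  shows "\<exists>d. \<forall>n b. b \<in> B n \<longrightarrow> graded_coord r (n, b) x \<noteq> 0 \<longrightarrow> n \<le> d"
proof -
  let ?J = "{j \<in> (SIGMA n:UNIV. B n). graded_coord r j x \<noteq> 0}"
  have fin: "finite (fst ` ?J)"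
    using finite_coords(1)[OF assms] by simp
  have "n \<le> Max (fst ` ?J)" if "b \<in> B n" "graded_coord r (n, b) x \<noteq> 0" for n b
    using that by (intro Max_ge[OF fin]) (auto simp: image_iff intro: bexI[of _ "(n, b)"])
  then show ?thesis
    by blast
qed

lemma Psi_diff: "Psi I (x - y) = Psi I x - Psi I y"
  unfolding Psi_def by (simp only: minus_apply fun_vs.scale_left_diff_distrib sum_subtractf)

lemma Psi_zero: "Psi I 0 = 0"
  using Psi_diff[of I 0 0] by (simp only: diff_self)

lemma Psi_add: "Psi I (x + y) = Psi I x + Psi I y"
  unfolding Psi_def by (simp only: plus_fun_apply fun_vs.scale_left_distrib sum.distrib)

lemma Psi_scale: "Psi I (fscale c x) = fscale c (Psi I x)"
proof -
  have "fscale (fscale c x \<sigma>) v = fscale c (fscale (x \<sigma>) v)" for \<sigma> and v :: "'a set set \<Rightarrow> 'b"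
    by (simp add: fscale_def mult.assoc)
  then show ?thesis
    unfolding Psi_def by (simp only: fun_vs.scale_sum_right)
qed

lemma K_Psi_add: "K_Psi (x + y) = K_Psi x + K_Psi y"
proof (rule ext, clarify)
  fix n P
  have "curry (x + y) n = curry x n + curry y n"
    by auto
  then show "K_Psi (x + y) (n, P) = (K_Psi x + K_Psi y) (n, P)"
    by (simp only: K_Psi_def prod.case Psi_add plus_fun_apply)
qed

lemma K_Psi_scale: "K_Psi (fscale c x) = fscale c (K_Psi x)"
proof (rule ext, clarify)
  fix n P
  have "curry (fscale c x) n = fscale c (curry x n)"
    by (auto simp: fscale_def)
  then have "K_Psi (fscale c x) (n, P) = fscale c (Psi {1..n} (curry x n)) P"
    by (simp only: K_Psi_def prod.case Psi_scale)
  then show "K_Psi (fscale c x) (n, P) = fscale c (K_Psi x) (n, P)"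
    by (simp only: K_Psi_def prod.case fscale_def)
qed

lemma K_Psi_diff: "K_Psi (x - y) = K_Psi x - K_Psi y"
  using K_Psi_add[of "x - y" y] by (simp only: diff_add_cancel eq_diff_eq)

lemma K_Psi_zero: "K_Psi 0 = 0"
  using K_Psi_diff[of 0 0] by (simp only: diff_self)

lemma K_Psi_in_degree: "K_Psi (in_degree n v) = in_degree n (Psi {1..n} v)"
proof (rule ext, clarify)
  fix m P
  show "K_Psi (in_degree n v) (m, P) = in_degree n (Psi {1..n} v) (m, P)"
  proof (cases "m = n")
    case True
    then show ?thesis
      by (simp add: K_Psi_def curry_in_degree in_degree_apply)
  next
    case False
    then have "curry (in_degree n v) m = 0"
      by (simp only: curry_in_degree if_False)
    then have "K_Psi (in_degree n v) (m, P) = 0"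
      by (simp only: K_Psi_def prod.case Psi_zero zero_fun_apply)
    then show ?thesis
      using False by (simp add: in_degree_apply)
  qed
qed

lemma sum_over_orbit_fibers:
  "(\<Sum>P\<in>setparts n. \<Sum>\<tau> | \<tau> \<in> perms n \<and> orbit \<tau> ` {1..n} = P. g \<tau> P) = (\<Sum>\<tau>\<in>perms n. g \<tau> (orbit \<tau> ` {1..n}))"
proof -
  have "orbit \<tau> ` {1..n} \<in> setparts n" if "\<tau> \<in> perms n" for \<tau>
    using that partition_on_orbits[of "{1..n}" \<tau>] by (simp add: perms_def setparts_def)
  then have "(\<Sum>\<tau>\<in>perms n. g \<tau> (orbit \<tau> ` {1..n}))
      = (\<Sum>P\<in>setparts n. \<Sum>\<tau>\<in>{\<tau> \<in> perms n. orbit \<tau> ` {1..n} = P}. g \<tau> (orbit \<tau> ` {1..n}))"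
    by (intro sum.group[symmetric] S.deg.finite_carrier Pi.deg.finite_carrier) auto
  also have "\<dots> = (\<Sum>P\<in>setparts n. \<Sum>\<tau> | \<tau> \<in> perms n \<and> orbit \<tau> ` {1..n} = P. g \<tau> P)"
    by (intro sum.cong refl) auto
  finally show ?thesis ..
qed

lemma linear_ext_K_Psi:
  fixes w :: "nat \<times> nat set set \<Rightarrow> ('c \<Rightarrow> 'k::field)"
  assumes x: "x \<in> graded_space perms"
    and d: "\<And>n \<tau>. \<tau> \<in> perms n \<Longrightarrow> coord_S (n, \<tau>) x \<noteq> 0 \<Longrightarrow> n \<le> d"
  shows "linear_ext fscale (SIGMA n:UNIV. setparts n)
      (\<lambda>(n, P). in_degree n (p_vec (setpart_order {1..n}) P)) w (K_Psi x)
    = (\<Sum>n\<le>d. \<Sum>\<tau>\<in>perms n. fscale (coord_S (n, \<tau>) x) (w (n, orbit \<tau> ` {1..n})))"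
proof -
  have "linear_ext fscale (SIGMA n:UNIV. setparts n)
      (\<lambda>(n, P). in_degree n (p_vec (setpart_order {1..n}) P)) w (K_Psi x)
    = (\<Sum>n\<le>d. \<Sum>P\<in>setparts n. fscale (coord_Pi (n, P) (K_Psi x)) (w (n, P)))"
  proof (rule Pi.linear_ext_bounded[OF K_Psi_graded_space[OF x]])
    fix n P assume P: "P \<in> setparts n" "coord_Pi (n, P) (K_Psi x) \<noteq> 0"
    show "n \<le> d"
    proof (rule ccontr)
      assume "\<not> n \<le> d"
      then have "coord_Pi (n, P) (K_Psi x) = 0"
        unfolding coord_K_Psi[OF P(1)] using d by (intro sum.neutral) blast
      then show False
        using P(2) by simp
    qed
  qed
  also have "\<dots> = (\<Sum>n\<le>d. \<Sum>P\<in>setparts n. \<Sum>\<tau> | \<tau> \<in> perms n \<and> orbit \<tau> ` {1..n} = P.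
      fscale (coord_S (n, \<tau>) x) (w (n, P)))"
    by (intro sum.cong refl) (simp only: coord_K_Psi fun_vs.scale_sum_left)
  also have "\<dots> = (\<Sum>n\<le>d. \<Sum>\<tau>\<in>perms n. fscale (coord_S (n, \<tau>) x) (w (n, orbit \<tau> ` {1..n})))"
    by (simp only: sum_over_orbit_fibers)
  finally show ?thesis .
qed


section \<open>Psi on coinvariants\<close>

text \<open>Both sides have the same p-coordinates, because conjugation by \<open>\<sigma>\<close> moves the orbits of a permutation by
  \<open>\<sigma>\<close>.  Hence \<open>K_Psi\<close> induces a map on coinvariants.\<close>

lemma Psi_equivariant:
  fixes x :: "(nat \<Rightarrow> nat) \<Rightarrow> 'k::field"
  assumes \<sigma>: "\<sigma> permutes {1..n}" and x: "\<And>\<tau>. x \<tau> \<noteq> 0 \<Longrightarrow> \<tau> \<in> perms n"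
  shows "Psi {1..n} (push_forward (perm_act \<sigma>) x) = push_forward (setpart_act \<sigma>) (Psi {1..n} x)"
proof (rule Pi.deg.eq_if_p_coord_eq)
  have supp: "P \<in> setparts n" if "Psi {1..n} z P \<noteq> 0" for z :: "(nat \<Rightarrow> nat) \<Rightarrow> 'k" and P
    using Psi_support[OF finite_atLeastAtMost that] by (simp add: setparts_def)
  show "P \<in> setparts n" if "Psi {1..n} (push_forward (perm_act \<sigma>) x) P \<noteq> 0" for P
    using that by (rule supp)
  show "P \<in> setparts n" if "push_forward (setpart_act \<sigma>) (Psi {1..n} x) P \<noteq> 0" for P
    using Pi.push_forward_support[OF \<sigma> supp that] .
  fix P assume P: "P \<in> setparts n"
  have "P \<in> setpart_act \<sigma> ` setparts n"
    using Pi.act_bij[OF \<sigma>] P by (simp add: bij_betw_def)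
  then obtain Q where Q: "Q \<in> setparts n" "P = setpart_act \<sigma> Q"
    by blast
  have inj: "inj (setpart_act \<sigma>)"
    using setpart_act_inv(1)[OF permutes_bij[OF \<sigma>]] by (metis injI)
  have "p_coord (setpart_order {1..n}) (Psi {1..n} (push_forward (perm_act \<sigma>) x)) P
      = (\<Sum>\<tau> | \<tau> permutes {1..n} \<and> orbit \<tau> ` {1..n} = P. p_coord (perm_order {1..n}) (push_forward (perm_act \<sigma>) x) \<tau>)"
    using P by (intro p_coord_Psi) (auto simp: setparts_def)
  also have "\<dots> = (\<Sum>\<tau> | \<tau> permutes {1..n} \<and> orbit \<tau> ` {1..n} = Q. p_coord (perm_order {1..n}) x \<tau>)"
  proof -
    note inv = perm_act_inv[OF permutes_bij[OF \<sigma>]]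
    have orb: "orbit (perm_act \<sigma> \<tau>) ` {1..n} = P \<longleftrightarrow> orbit \<tau> ` {1..n} = Q" if "\<tau> permutes {1..n}" for \<tau>
      unfolding perm_act_orbits_setpart[OF finite_atLeastAtMost \<sigma> that] Q(2) by (rule inj_eq[OF inj])
    have "bij_betw (perm_act \<sigma>) {\<tau>. \<tau> permutes {1..n} \<and> orbit \<tau> ` {1..n} = Q}
        {\<tau>. \<tau> permutes {1..n} \<and> orbit \<tau> ` {1..n} = P}"
    proof (rule bij_betw_byWitness[where f' = "perm_act (inv \<sigma>)"])
      show "perm_act \<sigma> ` {\<tau>. \<tau> permutes {1..n} \<and> orbit \<tau> ` {1..n} = Q} \<subseteq> {\<tau>. \<tau> permutes {1..n} \<and> orbit \<tau> ` {1..n} = P}"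
        using orb perm_act_permutes[OF \<sigma>] by (intro image_subsetI) (simp only: mem_Collect_eq)
      show "perm_act (inv \<sigma>) ` {\<tau>. \<tau> permutes {1..n} \<and> orbit \<tau> ` {1..n} = P} \<subseteq> {\<tau>. \<tau> permutes {1..n} \<and> orbit \<tau> ` {1..n} = Q}"
      proof clarify
        fix \<tau> assume \<tau>: "\<tau> permutes {1..n}" "P = orbit \<tau> ` {1..n}"
        have "perm_act (inv \<sigma>) \<tau> permutes {1..n}"
          using perm_act_permutes[OF permutes_inv[OF \<sigma>] \<tau>(1)] .
        then show "perm_act (inv \<sigma>) \<tau> permutes {1..n} \<and> orbit (perm_act (inv \<sigma>) \<tau>) ` {1..n} = Q"
          using orb[of "perm_act (inv \<sigma>) \<tau>"] \<tau>(2) inv(2) by simp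
      qed
    qed (simp_all add: inv)
    then have "(\<Sum>\<tau> | \<tau> permutes {1..n} \<and> orbit \<tau> ` {1..n} = P. p_coord (perm_order {1..n}) (push_forward (perm_act \<sigma>) x) \<tau>)
        = (\<Sum>\<tau> | \<tau> permutes {1..n} \<and> orbit \<tau> ` {1..n} = Q. p_coord (perm_order {1..n}) (push_forward (perm_act \<sigma>) x) (perm_act \<sigma> \<tau>))"
      by (rule sum.reindex_bij_betw[symmetric])
    also have "\<dots> = (\<Sum>\<tau> | \<tau> permutes {1..n} \<and> orbit \<tau> ` {1..n} = Q. p_coord (perm_order {1..n}) x \<tau>)"
      using x by (intro sum.cong refl S.deg.p_coord_push_forward[OF S.act_bij[OF \<sigma>] S.act_order[OF \<sigma>]])
        (auto simp: perms_def)
    finally show ?thesis .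
  qed
  also have "\<dots> = p_coord (setpart_order {1..n}) (Psi {1..n} x) Q"
    using Q(1) by (intro p_coord_Psi[symmetric]) (auto simp: setparts_def)
  also have "\<dots> = p_coord (setpart_order {1..n}) (push_forward (setpart_act \<sigma>) (Psi {1..n} x)) P"
    unfolding Q(2)
    by (rule Pi.deg.p_coord_push_forward[OF Pi.act_bij[OF \<sigma>] Pi.act_order[OF \<sigma>] supp Q(1), symmetric])
  finally show "p_coord (setpart_order {1..n}) (Psi {1..n} (push_forward (perm_act \<sigma>) x)) P
      = p_coord (setpart_order {1..n}) (push_forward (setpart_act \<sigma>) (Psi {1..n} x)) P" .
qed

lemma K_Psi_relators:
  assumes "y \<in> (coinv_relators perms perm_act :: (_ \<Rightarrow> 'k::field) set)"
  shows "K_Psi y \<in> coinv_relators setparts setpart_act"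
  using assms unfolding coinv_relators_def[of perms]
proof (induction rule: fun_vs.span_induct)
  let ?R = "coinv_relators setparts setpart_act :: (_ \<Rightarrow> 'k) set"
  have sub: "fun_vs.subspace ?R"
    unfolding coinv_relators_def by (rule fun_vs.subspace_span)
  show "fun_vs.subspace {a. K_Psi a \<in> ?R}"
  proof (rule fun_vs.subspaceI)
    show "0 \<in> {a. K_Psi a \<in> ?R}"
      unfolding mem_Collect_eq K_Psi_zero by (rule fun_vs.subspace_0[OF sub])
  next
    fix x y assume "x \<in> {a. K_Psi a \<in> ?R}"
      "y \<in> {a. K_Psi a \<in> ?R}"
    then show "x + y \<in> {a. K_Psi a \<in> ?R}"
      unfolding mem_Collect_eq K_Psi_add by (rule fun_vs.subspace_add[OF sub])
  next
    fix c x assume "x \<in> {a. K_Psi a \<in> ?R}"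
    then show "fscale c x \<in> {a. K_Psi a \<in> ?R}"
      unfolding mem_Collect_eq K_Psi_scale by (rule fun_vs.subspace_scale[OF sub])
  qed
  fix a assume "a \<in> {in_degree n (x - push_forward (perm_act \<sigma>) x) | n \<sigma> (x :: _ \<Rightarrow> 'k).
        \<sigma> permutes {1..n} \<and> (\<forall>b. x b \<noteq> 0 \<longrightarrow> b \<in> perms n)}"
  then obtain n \<sigma> and x :: "_ \<Rightarrow> 'k" where a: "a = in_degree n (x - push_forward (perm_act \<sigma>) x)"
    and \<sigma>: "\<sigma> permutes {1..n}" and x: "\<forall>b. x b \<noteq> 0 \<longrightarrow> b \<in> perms n"
    by blast
  have "K_Psi a = in_degree n (Psi {1..n} x - push_forward (setpart_act \<sigma>) (Psi {1..n} x))"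
    unfolding a K_Psi_in_degree Psi_diff using x by (subst Psi_equivariant[OF \<sigma>]) auto
  moreover have "P \<in> setparts n" if "Psi {1..n} x P \<noteq> 0" for P
    using Psi_support[OF finite_atLeastAtMost that] by (simp add: setparts_def)
  ultimately show "K_Psi a \<in> coinv_relators setparts setpart_act"
    unfolding coinv_relators_def using \<sigma> by (intro fun_vs.span_base) blast
qed

lemma Kbar_Psi_class:
  assumes C: "C \<in> Kbar_S" "y \<in> C"
  shows "Kbar_Psi C = coinv_rel setparts setpart_act `` {K_Psi y}"
  unfolding Kbar_Psi_def
proof (rule the_elem_class[OF C[unfolded Kbar_S_def]])
  fix x y :: "nat \<times> (nat \<Rightarrow> nat) \<Rightarrow> 'a" assume xy: "(x, y) \<in> coinv_rel perms perm_act"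
  then have "x \<in> graded_space perms" "y \<in> graded_space perms" "x - y \<in> coinv_relators perms perm_act"
    by (simp_all add: coinv_rel_def)
  then have "(K_Psi x, K_Psi y) \<in> coinv_rel setparts setpart_act"
    using K_Psi_relators[of "x - y", unfolded K_Psi_diff] by (simp add: coinv_rel_def K_Psi_graded_space)
  then show "coinv_rel setparts setpart_act `` {K_Psi x} = coinv_rel setparts setpart_act `` {K_Psi y}"
    by (rule equiv_class_eq[OF equiv_coinv_rel])
qed

text \<open>The p-basis vector of a set partition is the image of that of any permutation with these orbits.\<close>

lemma K_Psi_surjective:
  fixes x :: "nat \<times> nat set set \<Rightarrow> 'k::field"
  assumes x: "x \<in> graded_space setparts"
  shows "\<exists>y\<in>graded_space perms. K_Psi y = x"
proof -
  let ?J = "SIGMA n:UNIV. setparts n"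
  define F where "F = {j \<in> ?J. coord_Pi j x \<noteq> 0}"
  have F: "finite F"
    unfolding F_def by (rule Pi.finite_coords(1)[OF x])
  define s where "s n P = (SOME \<sigma>. \<sigma> permutes {1..n} \<and> orbit \<sigma> ` {1..n} = P)" for n :: nat and P
  have s: "s n P \<in> perms n" "orbit (s n P) ` {1..n} = P" if "P \<in> setparts n" for n P
    using someI_ex[OF ex_permutation_with_orbits[of "{1..n}" P]] that
    by (simp_all add: s_def setparts_def perms_def)
  let ?F = "(\<lambda>(n, P). (n, s n P)) ` F"
  have sub: "?F \<subseteq> (SIGMA n:UNIV. perms n)"
    using s(1) by (auto simp: F_def)
  obtain y where y: "y \<in> graded_space perms"
    "\<And>j. j \<in> (SIGMA n:UNIV. perms n) \<Longrightarrow>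
      coord_S j y = (if j \<in> ?F then (case j of (n, \<sigma>) \<Rightarrow> coord_Pi (n, orbit \<sigma> ` {1..n}) x) else 0)"
    using S.ex_with_coords[OF finite_imageI[OF F] sub] by blast
  have "K_Psi y = x"
  proof (rule Pi.eq_if_graded_coord_eq[OF K_Psi_graded_space[OF y(1)] x])
    fix j assume "j \<in> ?J"
    then obtain n Q where j: "j = (n, Q)" and Q: "Q \<in> setparts n"
      by auto
    let ?T = "{\<tau>. \<tau> \<in> perms n \<and> orbit \<tau> ` {1..n} = Q}"
    have "coord_S (n, \<tau>) y = (if \<tau> = s n Q then coord_Pi (n, Q) x else 0)" if \<tau>: "\<tau> \<in> ?T" for \<tau>
    proof -
      have "(n, \<tau>) \<in> ?F \<longleftrightarrow> \<tau> = s n Q \<and> (n, Q) \<in> F"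
        using \<tau> s by (auto simp: F_def image_iff)
      moreover have "coord_Pi (n, Q) x = 0" if "(n, Q) \<notin> F"
        using that Q by (simp add: F_def)
      ultimately show ?thesis
        using y(2)[of "(n, \<tau>)"] \<tau> by auto
    qed
    then have "coord_Pi (n, Q) (K_Psi y) = (\<Sum>\<tau>\<in>?T. if \<tau> = s n Q then coord_Pi (n, Q) x else 0)"
      unfolding coord_K_Psi[OF Q] by (intro sum.cong refl)
    also have "\<dots> = coord_Pi (n, Q) x"
    proof -
      have "finite ?T"
        by (rule finite_subset[OF _ S.deg.finite_carrier[of n]]) auto
      then show ?thesis
        using s[OF Q] by (simp add: sum.delta)
    qed
    finally show "coord_Pi j (K_Psi y) = coord_Pi j x"
      by (simp only: j)
  qed
  then show ?thesis
    using y(1) by blast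
qed

lemma Kbar_Psi_surjective:
  assumes "C \<in> Kbar_Pi"
  shows "\<exists>D\<in>Kbar_S. Kbar_Psi D = (C :: (_ \<Rightarrow> 'k::field) set)"
proof -
  obtain x where x: "x \<in> graded_space setparts" "C = coinv_rel setparts setpart_act `` {x}"
    using assms unfolding Kbar_Pi_def by (rule coinvariants_cases)
  obtain y where y: "y \<in> graded_space perms" "K_Psi y = x"
    using K_Psi_surjective[OF x(1)] by blast
  have "coinv_rel perms perm_act `` {y} \<in> Kbar_S"
    unfolding Kbar_S_def using y(1) by (rule class_in_coinvariants)
  moreover have "Kbar_Psi (coinv_rel perms perm_act `` {y}) = C"
    using Kbar_Psi_class[OF calculation class_self[OF y(1)]] y(2) x(2) by simp
  ultimately show ?thesis
    by blast
qed


section \<open>The map to symmetric functions\<close>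

abbreviation phi_Pi :: "(nat \<times> nat set set \<Rightarrow> 'k::field) \<Rightarrow> (nat multiset \<Rightarrow> 'k)" where
  "phi_Pi \<equiv> linear_ext fscale (SIGMA n:UNIV. setparts n)
     (\<lambda>(n, P). in_degree n (p_vec (setpart_order {1..n}) P)) (\<lambda>(n, P). sym_p (setpart_type P))"

lemma fbar_Pi_class:
  assumes "C \<in> Kbar_Pi" "x \<in> C"
  shows "fbar_Pi C = phi_Pi x"
  unfolding fbar_Pi_def
proof (rule Pi.linear_ext_class)
  show "C \<in> coinvariants setparts setpart_act" "x \<in> C"
    using assms by (simp_all add: Kbar_Pi_def)
  fix n and \<sigma> :: "nat \<Rightarrow> nat" and P assume "\<sigma> permutes {1..n}"
  then show "(\<lambda>(n :: nat, P). sym_p (setpart_type P)) (n, setpart_act \<sigma> P)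
      = ((\<lambda>(n :: nat, P). sym_p (setpart_type P)) (n, P) :: _ \<Rightarrow> 'a)"
    by (simp add: setpart_type_act permutes_bij)
qed

lemma sym_p_degree:
  assumes "(sym_p l M :: 'k::field) \<noteq> 0"
  shows "size M = sum_list l"
proof -
  have "set_mset M \<subseteq> {1..} \<and> size M = sum_list l"
    by (rule product_support[OF _ assms[unfolded sym_p_def]]) (auto simp: indicator_def split: if_splits)
  then show ?thesis
    by simp
qed

lemma fbar_Pi_surjective:
  fixes f :: "nat multiset \<Rightarrow> 'k::field_char_0"
  assumes f: "f \<in> Sym"
  shows "\<exists>C\<in>Kbar_Pi. fbar_Pi C = f"
proof -
  obtain D where D: "\<And>M. f M \<noteq> 0 \<Longrightarrow> size M \<le> D"
    using f by (auto simp: Sym_def)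
  obtain c where c: "\<And>n M. size M = n \<Longrightarrow> f M = (\<Sum>Q\<in>setparts n. c n Q * sym_p (setpart_type Q) M)"
    using Sym_combination_of_sym_p[OF f] by metis
  let ?F = "SIGMA n:{..D}. setparts n"
  have F: "finite ?F" "?F \<subseteq> (SIGMA n:UNIV. setparts n)"
    using Pi.deg.finite_carrier by auto
  obtain x where x: "x \<in> graded_space setparts"
    "\<And>j. j \<in> (SIGMA n:UNIV. setparts n) \<Longrightarrow> coord_Pi j x = (if j \<in> ?F then case j of (n, Q) \<Rightarrow> c n Q else 0)"
    using Pi.ex_with_coords[OF F] by blast
  have "phi_Pi x = f"
  proof
    fix M
    have "phi_Pi x = (\<Sum>n\<le>D. \<Sum>Q\<in>setparts n. fscale (coord_Pi (n, Q) x) (case (n, Q) of (n, Q) \<Rightarrow> sym_p (setpart_type Q)))"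
      using x(2) by (intro Pi.linear_ext_bounded[OF x(1)]) (auto split: if_splits)
    then have "phi_Pi x M = (\<Sum>n\<le>D. \<Sum>Q\<in>setparts n. coord_Pi (n, Q) x * sym_p (setpart_type Q) M)"
      by (simp only: sum_apply fscale_def prod.case)
    also have "\<dots> = (\<Sum>n\<le>D. if n = size M then f M else 0)"
    proof (rule sum.cong[OF refl])
      fix n assume n: "n \<in> {..D}"
      have coords: "coord_Pi (n, Q) x = c n Q" if "Q \<in> setparts n" for Q
        using x(2)[of "(n, Q)"] that n by simp
      show "(\<Sum>Q\<in>setparts n. coord_Pi (n, Q) x * sym_p (setpart_type Q) M) = (if n = size M then f M else 0)"
      proof (cases "n = size M")
        case True
        then show ?thesis
          using c[of M n] coords by simp
      next
        case False
        have "sym_p (setpart_type Q) M = (0 :: 'k)" if "Q \<in> setparts n" for Q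
          using setpart_type_partition[of n Q] that False sym_p_degree[of "setpart_type Q" M]
          by (auto simp: setparts_def int_partition_def)
        then show ?thesis
          using False by simp
      qed
    qed
    also have "\<dots> = f M"
      using D[of M] by (cases "f M = 0") (simp_all add: sum.delta)
    finally show "phi_Pi x M = f M" .
  qed
  moreover have cls: "coinv_rel setparts setpart_act `` {x} \<in> Kbar_Pi"
    unfolding Kbar_Pi_def using x(1) by (rule class_in_coinvariants)
  ultimately show ?thesis
    using fbar_Pi_class[OF cls class_self[OF x(1)]] by (intro bexI[OF _ cls]) simp
qed


section \<open>The maps to functions on permutations\<close>

lemma centralizer_order_act:
  assumes \<pi>: "\<pi> permutes {1..n}"
  shows "centralizer_order n (perm_act \<pi> \<sigma>) = centralizer_order n \<sigma>"
proof -
  have comp: "perm_act \<pi> \<tau> \<circ> perm_act \<pi> \<rho> = perm_act \<pi> (\<tau> \<circ> \<rho>)" for \<tau> \<rho>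
    using permutes_inv_o(2)[OF \<pi>] by (simp add: perm_act_def fun_eq_iff permutes_inverses(2)[OF \<pi>])
  note inv = perm_act_inv[OF permutes_bij[OF \<pi>]]
  have eq_iff: "perm_act \<pi> \<tau> = perm_act \<pi> \<rho> \<longleftrightarrow> \<tau> = \<rho>" for \<tau> \<rho>
    using inv(1) by metis
  have "bij_betw (perm_act \<pi>) {\<tau>. \<tau> permutes {1..n} \<and> \<tau> \<circ> \<sigma> = \<sigma> \<circ> \<tau>}
      {\<tau>. \<tau> permutes {1..n} \<and> \<tau> \<circ> perm_act \<pi> \<sigma> = perm_act \<pi> \<sigma> \<circ> \<tau>}"
  proof (rule bij_betw_byWitness[where f' = "perm_act (inv \<pi>)"])
    show "perm_act \<pi> ` {\<tau>. \<tau> permutes {1..n} \<and> \<tau> \<circ> \<sigma> = \<sigma> \<circ> \<tau>}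
        \<subseteq> {\<tau>. \<tau> permutes {1..n} \<and> \<tau> \<circ> perm_act \<pi> \<sigma> = perm_act \<pi> \<sigma> \<circ> \<tau>}"
      using perm_act_permutes[OF \<pi>] comp by auto
    show "perm_act (inv \<pi>) ` {\<tau>. \<tau> permutes {1..n} \<and> \<tau> \<circ> perm_act \<pi> \<sigma> = perm_act \<pi> \<sigma> \<circ> \<tau>}
        \<subseteq> {\<tau>. \<tau> permutes {1..n} \<and> \<tau> \<circ> \<sigma> = \<sigma> \<circ> \<tau>}"
    proof (intro subsetI, elim imageE)
      fix \<rho> \<tau> assume \<rho>: "\<rho> = perm_act (inv \<pi>) \<tau>"
        and "\<tau> \<in> {\<tau>. \<tau> permutes {1..n} \<and> \<tau> \<circ> perm_act \<pi> \<sigma> = perm_act \<pi> \<sigma> \<circ> \<tau>}"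
      then have \<tau>: "\<tau> permutes {1..n}" "\<tau> \<circ> perm_act \<pi> \<sigma> = perm_act \<pi> \<sigma> \<circ> \<tau>"
        by auto
      have "\<tau> = perm_act \<pi> \<rho>"
        unfolding \<rho> by (rule inv(2)[symmetric])
      then have "perm_act \<pi> (\<rho> \<circ> \<sigma>) = perm_act \<pi> (\<sigma> \<circ> \<rho>)"
        using \<tau>(2) by (simp only: comp)
      then have "\<rho> \<circ> \<sigma> = \<sigma> \<circ> \<rho>"
        by (simp only: eq_iff)
      then show "\<rho> \<in> {\<tau>. \<tau> permutes {1..n} \<and> \<tau> \<circ> \<sigma> = \<sigma> \<circ> \<tau>}"
        using perm_act_permutes[OF permutes_inv[OF \<pi>] \<tau>(1)] \<rho> by simp
    qed
  qed (simp_all add: inv)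
  then show ?thesis
    by (simp add: centralizer_order_def bij_betw_same_card)
qed

lemma cycle_type_act:
  assumes "\<pi> permutes {1..n}" "\<sigma> \<in> perms n"
  shows "cycle_type n (perm_act \<pi> \<sigma>) = cycle_type n \<sigma>"
  using assms perm_act_orbits_setpart[of "{1..n}" \<pi> \<sigma>] setpart_type_act[OF permutes_bij[OF assms(1)]]
  by (simp add: cycle_type_def perms_def)

text \<open>The bound \<open>d\<close> on the degrees turns the sum over the finite support of \<open>y\<close> into sums over whole symmetric groups.\<close>

lemma fbar_S_class:
  assumes C: "C \<in> Kbar_S" "y \<in> C" and y: "y \<in> graded_space perms"
    and d: "\<And>n \<tau>. \<tau> \<in> perms n \<Longrightarrow> coord_S (n, \<tau>) y \<noteq> 0 \<Longrightarrow> n \<le> d"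
  shows "fbar_S C = (\<Sum>n\<le>d. \<Sum>\<sigma>\<in>perms n. fscale (coord_S (n, \<sigma>) y) (fscale (of_nat (centralizer_order n \<sigma>))
        (indicator {(n, \<tau>) | \<tau>. \<tau> \<in> perms n \<and> cycle_type n \<tau> = cycle_type n \<sigma>}) :: _ \<Rightarrow> 'k::field))"
proof -
  let ?w = "\<lambda>(n, \<sigma>). fscale (of_nat (centralizer_order n \<sigma>))
        (indicator {(n, \<tau>) | \<tau>. \<tau> \<in> perms n \<and> cycle_type n \<tau> = cycle_type n \<sigma>}) :: _ \<Rightarrow> 'k"
  have "fbar_S C = linear_ext fscale (SIGMA n:UNIV. perms n)
     (\<lambda>(n, \<sigma>). in_degree n (p_vec (perm_order {1..n}) \<sigma>)) ?w y"
    unfolding fbar_S_def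
  proof (rule S.linear_ext_class)
    show "C \<in> coinvariants perms perm_act" "y \<in> C"
      using C by (simp_all add: Kbar_S_def)
    fix n \<sigma> and \<tau> :: "nat \<Rightarrow> nat" assume "\<sigma> permutes {1..n}" "\<tau> \<in> perms n"
    then show "?w (n, perm_act \<sigma> \<tau>) = ?w (n, \<tau>)"
      by (simp add: centralizer_order_act cycle_type_act)
  qed
  then show ?thesis
    using S.linear_ext_bounded[where w = ?w, OF y d] by simp
qed

lemma f_S_graded:
  assumes "u \<in> graded_space perms"
  shows "f_S u j = (if j \<in> (SIGMA n:UNIV. perms n) then coord_S j u else 0 :: 'k::field)"
proof -
  let ?F = "{j \<in> (SIGMA n:UNIV. perms n). coord_S j u \<noteq> 0}"
  have F: "finite ?F"
    by (rule S.finite_coords(1)[OF assms])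
  have "f_S u = (\<Sum>j\<in>?F. fscale (coord_S j u) ((\<lambda>(n, \<sigma>). indicator {(n, \<sigma>)}) j))"
    unfolding f_S_def by (rule S.linear_ext_graded[OF assms F]) auto
  then have "f_S u j = (\<Sum>i\<in>?F. if i = j then coord_S i u else 0)"
    by (simp only: sum_apply) (intro sum.cong refl, auto simp: fscale_def indicator_def split_def)
  then show ?thesis
    using F by (auto simp: sum.delta)
qed

lemma f_S_surjective:
  assumes v: "(v :: _ \<Rightarrow> 'k::field) \<in> graded_space perms"
  shows "\<exists>u\<in>K_S. f_S u = v"
proof -
  have F: "finite {j. v j \<noteq> 0}" "{j. v j \<noteq> 0} \<subseteq> (SIGMA n:UNIV. perms n)"
    using v by (auto simp: graded_space_def)
  obtain u where u: "u \<in> graded_space perms"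
    "\<And>j. j \<in> (SIGMA n:UNIV. perms n) \<Longrightarrow> coord_S j u = (if j \<in> {j. v j \<noteq> 0} then v j else 0)"
    using S.ex_with_coords[OF F] by blast
  have "f_S u j = v j" for j
    using f_S_graded[OF u(1), of j] u(2)[of j] F(2)
    by (cases "j \<in> (SIGMA n:UNIV. perms n)") auto
  then show ?thesis
    using u(1) by (intro bexI[of _ u]) (auto simp: K_S_def)
qed


section \<open>The composition is the lift\<close>

lemma inv_into_if_surjective:
  assumes "\<exists>x\<in>A. g x = y"
  shows "inv_into A g y \<in> A" "g (inv_into A g y) = y"
proof -
  have "y \<in> g ` A"
    using assms by blast
  then show "inv_into A g y \<in> A" "g (inv_into A g y) = y"
    by (rule inv_into_into, rule f_inv_into_f)
qed

text \<open>Let \<open>y\<close> represent the element of the coinvariants of permutations obtained from \<open>f\<close>.  Then \<open>f\<close> is the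
  combination of the power sums of the cycle types of the \<open>\<sigma>\<close>, with the p-coordinates of \<open>y\<close> as
  coefficients; the remaining maps send \<open>y\<close> to the same combination of the sums in \<open>centralizer_sum\<close>,
  which are the lifts of these power sums.  Each inverse map enters through an equation such as
  \<open>fbar_Pi C = f\<close>, which holds because the map is surjective.\<close>

lemma rho_tilde_eq_lift:
  fixes f :: "nat multiset \<Rightarrow> 'k::field_char_0"
  assumes f: "f \<in> Sym"
  shows "rho_tilde f = lift f"
proof -
  define C where "C = inv_into Kbar_Pi fbar_Pi f"
  have C: "C \<in> Kbar_Pi" "fbar_Pi C = f"
    unfolding C_def by (rule inv_into_if_surjective[OF fbar_Pi_surjective[OF f]])+
  define D where "D = inv_into Kbar_S Kbar_Psi C"
  have D: "D \<in> Kbar_S" "Kbar_Psi D = C"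
    unfolding D_def by (rule inv_into_if_surjective[OF Kbar_Psi_surjective[OF C(1)]])+
  obtain y where y: "y \<in> graded_space perms" "y \<in> D"
    using D(1) unfolding Kbar_S_def by (elim coinvariants_cases)
  obtain d where d: "\<And>n \<tau>. \<tau> \<in> perms n \<Longrightarrow> coord_S (n, \<tau>) y \<noteq> 0 \<Longrightarrow> n \<le> d"
    using S.coords_bounded[OF y(1)] by blast
  have "K_Psi y \<in> C"
    using class_self[OF K_Psi_graded_space[OF y(1)]] Kbar_Psi_class[OF D(1) y(2)] D(2) by auto
  then have "f = phi_Pi (K_Psi y)"
    using fbar_Pi_class[OF C(1)] C(2) by simp
  also have "\<dots> = (\<Sum>n\<le>d. \<Sum>\<tau>\<in>perms n. fscale (coord_S (n, \<tau>) y) (sym_p (cycle_type n \<tau>)))"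
    using linear_ext_K_Psi[where w = "\<lambda>(n, P). sym_p (setpart_type P)", OF y(1) d] by (simp add: cycle_type_def)
  finally have f_eq: "f = (\<Sum>n\<le>d. \<Sum>\<tau>\<in>perms n. fscale (coord_S (n, \<tau>) y) (sym_p (cycle_type n \<tau>)))" .
  let ?class = "\<lambda>n \<sigma>. {\<tau>. \<tau> \<in> perms n \<and> cycle_type n \<tau> = cycle_type n \<sigma>}"
  define v where "v = fbar_S D"
  have v: "v = (\<Sum>n\<le>d. \<Sum>\<sigma>\<in>perms n. fscale (coord_S (n, \<sigma>) y) (fscale (of_nat (centralizer_order n \<sigma>))
        (indicator {(n, \<tau>) | \<tau>. \<tau> \<in> perms n \<and> cycle_type n \<tau> = cycle_type n \<sigma>})))"
    unfolding v_def by (rule fbar_S_class[OF D(1) y(2,1) d])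
  have v_apply: "v (m, \<tau>) = (if m \<le> d \<and> \<tau> \<in> perms m then \<Sum>\<sigma>\<in>perms m.
      coord_S (m, \<sigma>) y * (of_nat (centralizer_order m \<sigma>) * indicator (?class m \<sigma>) \<tau>) else 0)" for m \<tau>
  proof -
    have "v (m, \<tau>) = (\<Sum>n\<le>d. if n = m then \<Sum>\<sigma>\<in>perms n.
      coord_S (n, \<sigma>) y * (of_nat (centralizer_order n \<sigma>) * indicator (?class n \<sigma>) \<tau>) else 0)"
      unfolding v sum_apply fscale_def
      by (intro sum.cong refl) (auto simp: indicator_def intro!: sum.cong sum.neutral)
    also have "\<dots> = (if m \<le> d then \<Sum>\<sigma>\<in>perms m.
      coord_S (m, \<sigma>) y * (of_nat (centralizer_order m \<sigma>) * indicator (?class m \<sigma>) \<tau>) else 0)"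
      by (simp add: sum.delta)
    also have "\<dots> = (if m \<le> d \<and> \<tau> \<in> perms m then \<Sum>\<sigma>\<in>perms m.
      coord_S (m, \<sigma>) y * (of_nat (centralizer_order m \<sigma>) * indicator (?class m \<sigma>) \<tau>) else 0)"
      by (auto intro!: sum.neutral)
    finally show ?thesis .
  qed
  have "v \<in> graded_space perms"
  proof -
    have supp: "n \<le> d \<and> \<tau> \<in> perms n" if "v (n, \<tau>) \<noteq> 0" for n \<tau>
      using that unfolding v_apply by (simp split: if_splits)
    then have "{j. v j \<noteq> 0} \<subseteq> (SIGMA n:{..d}. perms n)"
      by auto
    moreover have "finite (SIGMA n:{..d}. perms n)"
      using S.deg.finite_carrier by auto
    ultimately have "finite {j. v j \<noteq> 0}"
      by (rule finite_subset)
    then show ?thesis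
      using supp by (auto simp: graded_space_def)
  qed
  define u where "u = inv_into K_S f_S v"
  have u: "u \<in> K_S" "f_S u = v"
    unfolding u_def by (rule inv_into_if_surjective[OF f_S_surjective[OF \<open>v \<in> graded_space perms\<close>]])+
  have u_graded: "u \<in> graded_space perms"
    using u(1) by (simp add: K_S_def)
  have coord_u: "coord_S (n, \<tau>) u = v (n, \<tau>)" if "\<tau> \<in> perms n" for n \<tau>
    using f_S_graded[OF u_graded, of "(n, \<tau>)"] that u(2) by simp
  have bound: "n \<le> d" if "\<tau> \<in> perms n" "coord_S (n, \<tau>) u \<noteq> 0" for n \<tau>
    using that(2) unfolding coord_u[OF that(1)] v_apply by (simp split: if_splits)
  have "rho_tilde f = f_Pi (K_Psi u)"
    by (simp add: rho_tilde_def u_def v_def D_def C_def)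
  also have "\<dots> = (\<Sum>n\<le>d. \<Sum>\<tau>\<in>perms n. fscale (coord_S (n, \<tau>) u) (nc_p n (orbit \<tau> ` {1..n})))"
    unfolding f_Pi_def using linear_ext_K_Psi[where w = "\<lambda>(n, P). nc_p n P", OF u_graded bound]
    by (simp only: prod.case)
  finally have rho_eq: "rho_tilde f = (\<Sum>n\<le>d. \<Sum>\<tau>\<in>perms n. fscale (coord_S (n, \<tau>) u) (nc_p n (orbit \<tau> ` {1..n})))" .
  show ?thesis
  proof
    fix w
    have "rho_tilde f w = (\<Sum>n\<le>d. \<Sum>\<tau>\<in>perms n. v (n, \<tau>) * nc_p n (orbit \<tau> ` {1..n}) w)"
      unfolding rho_eq sum_apply fscale_def by (intro sum.cong refl) (simp only: coord_u)
    also have "\<dots> = (\<Sum>n\<le>d. \<Sum>\<sigma>\<in>perms n. coord_S (n, \<sigma>) y * lift (sym_p (cycle_type n \<sigma>)) w)"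
    proof (rule sum.cong[OF refl])
      fix n assume n: "n \<in> {..d}"
      have "(\<Sum>\<tau>\<in>perms n. v (n, \<tau>) * nc_p n (orbit \<tau> ` {1..n}) w)
          = (\<Sum>\<tau>\<in>perms n. \<Sum>\<sigma>\<in>perms n. coord_S (n, \<sigma>) y * (of_nat (centralizer_order n \<sigma>) *
              (indicator (?class n \<sigma>) \<tau> * nc_p n (orbit \<tau> ` {1..n}) w)))"
        using n by (intro sum.cong refl) (simp add: v_apply sum_distrib_right mult.assoc)
      also have "\<dots> = (\<Sum>\<sigma>\<in>perms n. \<Sum>\<tau>\<in>perms n. coord_S (n, \<sigma>) y * (of_nat (centralizer_order n \<sigma>) *
              (indicator (?class n \<sigma>) \<tau> * nc_p n (orbit \<tau> ` {1..n}) w)))"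
        by (rule sum.swap)
      also have "\<dots> = (\<Sum>\<sigma>\<in>perms n. coord_S (n, \<sigma>) y * lift (sym_p (cycle_type n \<sigma>)) w)"
      proof (rule sum.cong[OF refl])
        fix \<sigma> assume \<sigma>: "\<sigma> \<in> perms n"
        have "(\<Sum>\<tau>\<in>perms n. indicator (?class n \<sigma>) \<tau> * nc_p n (orbit \<tau> ` {1..n}) w)
            = (\<Sum>\<tau>\<in>?class n \<sigma>. nc_p n (orbit \<tau> ` {1..n}) w :: 'k)"
          by (rule sum.mono_neutral_cong_right) (auto simp: S.deg.finite_carrier indicator_def)
        moreover have "fscale (of_nat (centralizer_order n \<sigma>)) (\<Sum>\<tau>\<in>?class n \<sigma>. nc_p n (orbit \<tau> ` {1..n})) w
            = (lift (sym_p (cycle_type n \<sigma>)) w :: 'k)"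
          by (rule fun_cong[OF centralizer_sum[OF \<sigma>]])
        ultimately have "of_nat (centralizer_order n \<sigma>) *
            (\<Sum>\<tau>\<in>perms n. indicator (?class n \<sigma>) \<tau> * nc_p n (orbit \<tau> ` {1..n}) w)
            = (lift (sym_p (cycle_type n \<sigma>)) w :: 'k)"
          by (simp only: fscale_def sum_apply)
        then show "(\<Sum>\<tau>\<in>perms n. coord_S (n, \<sigma>) y * (of_nat (centralizer_order n \<sigma>) *
              (indicator (?class n \<sigma>) \<tau> * nc_p n (orbit \<tau> ` {1..n}) w)))
            = coord_S (n, \<sigma>) y * lift (sym_p (cycle_type n \<sigma>)) w"
          by (simp only: sum_distrib_left[symmetric])
      qed
      finally show "(\<Sum>\<tau>\<in>perms n. v (n, \<tau>) * nc_p n (orbit \<tau> ` {1..n}) w)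
          = (\<Sum>\<sigma>\<in>perms n. coord_S (n, \<sigma>) y * lift (sym_p (cycle_type n \<sigma>)) w)" .
    qed
    also have "\<dots> = lift (\<Sum>n\<le>d. \<Sum>\<tau>\<in>perms n. fscale (coord_S (n, \<tau>) y) (sym_p (cycle_type n \<tau>))) w"
      unfolding lift_def sum_apply fscale_def by (simp add: sum_distrib_left mult_ac)
    finally show "rho_tilde f w = lift f w"
      by (simp only: f_eq[symmetric])
  qed
qed

theorem proposition5p15:
  shows "(rho :: (nat list \<Rightarrow> 'k::field_char_0) \<Rightarrow> _) \<in> NCSym \<rightarrow> Sym
    \<and> (rho_tilde :: (nat multiset \<Rightarrow> 'k) \<Rightarrow> _) \<in> Sym \<rightarrow> NCSym
    \<and> (\<forall>n. \<forall>f \<in> (Sym_degree n :: (nat multiset \<Rightarrow> 'k) set).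
          (rho \<circ> rho_tilde) f = fscale (of_nat (fact n)) f)
    \<and> (\<forall>n l. int_partition n l \<longrightarrow>
          rho_tilde (sym_m l :: nat multiset \<Rightarrow> 'k)
            = fscale (of_nat (parts_fact l))
                (\<Sum>P | partition_on {1..n} P \<and> setpart_type P = l. nc_m n P)
        \<and> rho_tilde (sym_p l :: nat multiset \<Rightarrow> 'k)
            = fscale (of_nat (parts_fact l * mults_fact l))
                (\<Sum>P | partition_on {1..n} P \<and> setpart_type P = l. nc_p n P)
        \<and> rho_tilde (sym_e l :: nat multiset \<Rightarrow> 'k)
            = fscale (of_nat (mults_fact l))
                (\<Sum>P | partition_on {1..n} P \<and> setpart_type P = l. nc_e n P)
        \<and> rho_tilde (sym_h l :: nat multiset \<Rightarrow> 'k)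
            = fscale (of_nat (mults_fact l))
                (\<Sum>P | partition_on {1..n} P \<and> setpart_type P = l. nc_h n P))"
proof (intro conjI allI impI ballI funcsetI)
  show "rho f \<in> Sym" if "f \<in> NCSym" for f :: "nat list \<Rightarrow> 'k"
    using that by (rule rho_in_Sym)
  show "rho_tilde f \<in> NCSym" if "f \<in> Sym" for f :: "nat multiset \<Rightarrow> 'k"
    using that by (simp add: rho_tilde_eq_lift lift_in_NCSym)
  show "(rho \<circ> rho_tilde) f = fscale (of_nat (fact n)) f" if "f \<in> Sym_degree n" for n and f :: "nat multiset \<Rightarrow> 'k"
    using that rho_lift[OF that] by (simp add: rho_tilde_eq_lift Sym_degree_def)
qed (simp_all only: rho_tilde_eq_lift sym_m_in_Sym sym_p_in_Sym sym_e_in_Sym sym_h_in_Sym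
    lift_sym_m lift_sym_p lift_sym_e lift_sym_h)

end
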